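(* Assume the time-harmonic problem is well-posed at the frequency $\omega>0$ (in the sense given in the context, with stability constant $C_{\rm stab}$). Let $\phi\in L(\Omega)$. Then for every $\mathscr U_0\in\mathscr L(\Omega)$, the filtered field $F_{\phi,\omega}\mathscr U_0$ is the unique element of $V(\Omega)$ such that $$ i\omega\,(F_{\phi,\omega}\mathscr U_0,v)_{\varepsilon,\mu}+a(F_{\phi,\omega}\mathscr U_0,v)=(\phi,v)_{\varepsilon,\mu}+\frac{\omega}{\pi}\,(\mathscr U_0-P_{\phi,\omega}\mathscr U_0,\,v)_{\varepsilon,\mu}\qquad\text{for all } v\in V(\Omega). $$ As a direct consequence, if $\psi\in L(\Omega)$ and $U\in V(\Omega)$ is the unique solution of $i\omega(U,w)_{\varepsilon,\mu}+a(U,w)=(\psi,w)_{\varepsilon,\mu}$ for all $w\in V(\Omega)$, then $$ |||U-F_{\psi,\omega}\mathscr U_0|||\le\frac{\omega}{\pi}\,C_{\rm stab}\,\|(I-P_{\psi,\omega})\mathscr U_0\|_{\varepsilon,\mu}\qquad\text{for all }\mathscr U_0\in\mathscr V(\Omega). $$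
   Context: Geometry and coefficients. $\Omega\subset\mathbb R^3$ is a Lipschitz domain with outward unit normal $\boldsymbol n$; its boundary $\Gamma=\partial\Omega$ is partitioned into two relatively open disjoint subsets $\Gamma_{\rm P},\Gamma_{\rm I}$ (either may be empty) with $\overline{\Gamma_{\rm P}}\cap\overline{\Gamma_{\rm I}}=\emptyset$. The measurable, uniformly bounded functions $\varepsilon,\mu,\sigma$ on $\Omega$ take values in real symmetric $3\times3$ matrices; $\varepsilon,\mu$ are uniformly elliptic; $\sigma=0$ outside a set $\Omega_\sigma\subset\Omega$ with Lipschitz boundary and $\sigma$ is uniformly elliptic on $\Omega_\sigma$. On $\Gamma_{\rm I}$, $Z$ is a measurable, uniformly bounded, real symmetric-matrix-valued function which is tangential ($Z\boldsymbol n=0$, so it acts on tangent vectors) and uniformly elliptic on tangent vectors; $Y=Z^{-1}$ is its inverse (on the tangent plane). $\boldsymbol v_\tau=\boldsymbol n\times(\boldsymbol v\times\boldsymbol n)$ is the tangential trace. Spaces. For $\mathbb K=\mathbb R$ or $\mathbb C$: $\boldsymbol{\mathcal X}(\Omega,\mathbb K)$ is the space of $\boldsymbol v\in L^2(\Omega,\mathbb K)^3$ with $\nabla\times\boldsymbol v\in L^2(\Omega,\mathbb K)^3$ and $\boldsymbol v_\tau|_{\Gamma_{\rm I}}\in L^2(\Gamma_{\rm I},\mathbb K)^3$; $\boldsymbol{\mathcal X}_{\Gamma_{\rm P}}(\Omega,\mathbb K)$ is its subspace of fields with $\boldsymbol v_\tau=0$ on $\Gamma_{\rm P}$. $L(\Omega)=L^2(\Omega,\mathbb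 C)^3\times L^2(\Omega,\mathbb C)^3$ and $V(\Omega)=\boldsymbol{\mathcal X}_{\Gamma_{\rm P}}(\Omega,\mathbb C)\times\boldsymbol{\mathcal X}(\Omega,\mathbb C)$; $\mathscr L(\Omega),\mathscr V(\Omega)$ are their real-valued counterparts. $\mathscr V_{\rm I}(\Omega)=\{[\boldsymbol e,\boldsymbol h]\in\mathscr V(\Omega): \boldsymbol e\times\boldsymbol n+Z\boldsymbol h_\tau=0\text{ on }\Gamma_{\rm I}\}$. Inner product: $([\boldsymbol v,\boldsymbol w],[\boldsymbol v',\boldsymbol w'])_{\varepsilon,\mu}=(\varepsilon\boldsymbol v,\boldsymbol v')_\Omega+(\mu\boldsymbol w,\boldsymbol w')_\Omega$ ($L^2$ inner products, conjugate-linear in the second argument), with norm $\|\cdot\|_{\varepsilon,\mu}$. Write $\|\cdot\|_{\chi,D}^2=(\chi\,\cdot,\cdot)_D$ for a tensor $\chi$. Energy norm on $V(\Omega)$: $$|||[\boldsymbol v,\boldsymbol w]|||^2=\omega^2\|\boldsymbol v\|_{\varepsilon,\Omega}^2+\|\boldsymbol v_\tau\|_{Y,\Gamma_{\rm I}}^2+\|\nabla\times\boldsymbol v\|_{\mu^{-1},\Omega}^2+\|\sigma\boldsymbol v\|_{\varepsilon^{-1},\Omega}^2+\omega^2\|\boldsymbol w\|_{\mu,\Omega}^2+\|\boldsymbol w_\tau\|_{Z,\Gamma_{\rm I}}^2+\|\nabla\times\boldsymbol w\|_{\varepsilon^{-1},\Omega}^2.$$ Sesquilinear form: $a([\boldsymbol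 e,\boldsymbol h],[\boldsymbol v,\boldsymbol w])=(\sigma\boldsymbol e,\boldsymbol v)_\Omega+(Y\boldsymbol e_\tau,\boldsymbol v_\tau)_{\Gamma_{\rm I}}+(Z\boldsymbol h_\tau,\boldsymbol w_\tau)_{\Gamma_{\rm I}}+(\boldsymbol h,\nabla\times\boldsymbol v)_\Omega-(\boldsymbol e,\nabla\times\boldsymbol w)_\Omega$. Well-posedness at frequency $\omega$: for every $\phi\in L(\Omega)$ there is a unique $S_\omega\phi\in V(\Omega)$ with $i\omega(S_\omega\phi,w)_{\varepsilon,\mu}+a(S_\omega\phi,w)=(\phi,w)_{\varepsilon,\mu}$ for all $w\in V(\Omega)$, and $|||S_\omega\phi|||\le C_{\rm stab}\|\phi\|_{\varepsilon,\mu}$. Propagator and filter. $T=2\pi/\omega$. For $\mathscr U_0\in\mathscr V_{\rm I}(\Omega)$ and $\phi\in L(\Omega)$ there is a unique $\mathscr U\in C^1(0,T;\mathscr L(\Omega))\cap C^0(0,T;\mathscr V_{\rm I}(\Omega))$ with $\mathscr U(0)=\mathscr U_0$ and $(\dot{\mathscr U}(t),v)_{\varepsilon,\mu}+a(\mathscr U(t),v)=(\operatorname{Re}(\phi e^{i\omega t}),v)_{\varepsilon,\mu}$ for all $v\in\mathscr V(\Omega)$, $t\in(0,T)$. The solution map $\mathscr U_0\mapsto\mathscr U$ extends by density and continuity to $\mathscr U_0\in\mathscr L(\Omega)$, with $\mathscr U\in C^0(0,T;\mathscr L(\Omega))$. For $\mathscr U_0\in\mathscr L(\Omega)$ set $P_{\phi,\omega}\mathscr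 U_0=\mathscr U(T)$ and $F_{\phi,\omega}\mathscr U_0=\frac2T\int_0^T\mathscr U(t)e^{-i\omega t}\,dt$.
   Formalization: In V_I the condition e×n+Zh_τ=0 conflicts with the form a for outward n (forcing e_τ=h_τ=0 on Γ_I), so both signs ±e×n+Zh_τ=0 are covered, and the well-posedness and continuous extension of the time-dependent problem, asserted in the setting, are hypotheses. *)

theory Defs
  imports "HOL-Analysis.Analysis"
begin

section \<open>Geometry\<close>

text \<open>
  In a ball around each frontier point, \<open>S\<close> lies strictly on one side of the graph of a
  Lipschitz function over the plane orthogonal to a unit vector \<open>a\<close>. Nothing is required on
  the graph itself, so that \<open>S\<close> need not be open.
\<close>

definition has_lipschitz_boundary :: "(real^3) set \<Rightarrow> bool" where
  "has_lipschitz_boundary S \<longleftrightarrow>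
     (\<forall>p \<in> frontier S. \<exists>r>0. \<exists>a \<gamma> K. norm a = 1 \<and> K-lipschitz_on UNIV (\<gamma> :: real^3 \<Rightarrow> real) \<and>
        (\<forall>x \<in> ball p r.
           (x \<bullet> a > \<gamma> (x - (x \<bullet> a) *\<^sub>R a) \<longrightarrow> x \<in> S) \<and>
           (x \<bullet> a < \<gamma> (x - (x \<bullet> a) *\<^sub>R a) \<longrightarrow> x \<notin> S)))"

definition lipschitz_domain :: "(real^3) set \<Rightarrow> bool" where
  "lipschitz_domain S \<longleftrightarrow> open S \<and> connected S \<and> S \<noteq> {} \<and> has_lipschitz_boundary S"

text \<open>
  The plane orthogonal to \<open>n\<close> is tangent to the boundary at \<open>x\<close> and \<open>n\<close> points out of \<open>S\<close>.
  For a Lipschitz boundary such an \<open>n\<close> is unique wherever it exists, and it exists at almost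
  every boundary point (those where the local graph function is differentiable).
\<close>

definition is_outward_normal :: "(real^3) set \<Rightarrow> real^3 \<Rightarrow> real^3 \<Rightarrow> bool" where
  "is_outward_normal S x n \<longleftrightarrow> norm n = 1 \<and>
     (\<forall>e>0. \<exists>d>0. \<forall>y \<in> ball x d.
        ((y - x) \<bullet> n > e * norm (y - x) \<longrightarrow> y \<notin> S) \<and>
        ((y - x) \<bullet> n < - e * norm (y - x) \<longrightarrow> y \<in> S))"

text \<open>
  Two-dimensional Hausdorff (outer) measure, normalised by \<open>pi / 4\<close> so that it is the usual
  surface area.
\<close>

definition hausdorff2_pre :: "real \<Rightarrow> (real^3) set \<Rightarrow> ennreal" where
  "hausdorff2_pre \<delta> A =
     (INF C \<in> {C :: nat \<Rightarrow> (real^3) set. A \<subseteq> (\<Union>i. C i) \<and> (\<forall>i. bounded (C i) \<and> diameter (C i) \<le> \<delta>)}.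
        \<Sum>i. ennreal (pi / 4 * (diameter (C i))\<^sup>2))"

definition hausdorff2 :: "(real^3) set \<Rightarrow> ennreal" where
  "hausdorff2 A = (SUP \<delta> \<in> {0<..}. hausdorff2_pre \<delta> A)"

definition surface_measure :: "(real^3) set \<Rightarrow> (real^3) measure" where
  "surface_measure S = measure_of UNIV (sets borel) (\<lambda>A. hausdorff2 (A \<inter> S))"

section \<open>Complex vector algebra and square-integrable fields\<close>

type_synonym field3 = "real^3 \<Rightarrow> complex^3"

definition cvec :: "real^3 \<Rightarrow> complex^3" where
  "cvec u = (\<chi> i. complex_of_real (u $ i))"

definition cmat :: "real^3^3 \<Rightarrow> complex^3^3" where
  "cmat A = (\<chi> i j. complex_of_real (A $ i $ j))"

definition cinner :: "complex^3 \<Rightarrow> complex^3 \<Rightarrow> complex" where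
  "cinner u v = (\<Sum>i\<in>UNIV. u $ i * cnj (v $ i))"

definition ccross :: "complex^3 \<Rightarrow> complex^3 \<Rightarrow> complex^3" where
  "ccross u v = vector [u$2 * v$3 - u$3 * v$2, u$3 * v$1 - u$1 * v$3, u$1 * v$2 - u$2 * v$1]"

definition L2 :: "(real^3) measure \<Rightarrow> field3 set" where
  "L2 M = {f. f \<in> borel_measurable M \<and> integrable M (\<lambda>x. (norm (f x))\<^sup>2)}"

definition l2ip :: "(real^3) measure \<Rightarrow> field3 \<Rightarrow> field3 \<Rightarrow> complex" where
  "l2ip M f g = (LINT x|M. cinner (f x) (g x))"

definition wip :: "(real^3) measure \<Rightarrow> (real^3 \<Rightarrow> real^3^3) \<Rightarrow> field3 \<Rightarrow> field3 \<Rightarrow> complex" where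
  "wip M A f g = l2ip M (\<lambda>x. cmat (A x) *v f x) g"

section \<open>Weak curl\<close>

primrec Ck :: "nat \<Rightarrow> (real^3 \<Rightarrow> real^3) \<Rightarrow> bool" where
  "Ck 0 f \<longleftrightarrow> continuous_on UNIV f"
| "Ck (Suc k) f \<longleftrightarrow>
     (\<exists>f'. (\<forall>x. (f has_derivative f' x) (at x)) \<and> (\<forall>h. Ck k (\<lambda>x. f' x h)))"

definition fsupp :: "(real^3 \<Rightarrow> real^3) \<Rightarrow> (real^3) set" where
  "fsupp w = closure {x. w x \<noteq> 0}"

definition test_field :: "(real^3 \<Rightarrow> real^3) \<Rightarrow> bool" where
  "test_field w \<longleftrightarrow> (\<forall>k. Ck k w) \<and> compact (fsupp w)"

definition partial_deriv :: "3 \<Rightarrow> 3 \<Rightarrow> (real^3 \<Rightarrow> real^3) \<Rightarrow> real^3 \<Rightarrow> real" where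
  "partial_deriv j i w x = frechet_derivative w (at x) (axis j 1) $ i"

definition classical_curl :: "(real^3 \<Rightarrow> real^3) \<Rightarrow> real^3 \<Rightarrow> real^3" where
  "classical_curl w x = vector [partial_deriv 2 3 w x - partial_deriv 3 2 w x,
                                partial_deriv 3 1 w x - partial_deriv 1 3 w x,
                                partial_deriv 1 2 w x - partial_deriv 2 1 w x]"

definition has_weak_curl :: "(real^3) set \<Rightarrow> field3 \<Rightarrow> field3 \<Rightarrow> bool" where
  "has_weak_curl S v c \<longleftrightarrow> c \<in> L2 (lebesgue_on S) \<and>
     (\<forall>w. test_field w \<and> fsupp w \<subseteq> S \<longrightarrow>
        l2ip (lebesgue_on S) v (\<lambda>x. cvec (classical_curl w x)) =
        l2ip (lebesgue_on S) c (\<lambda>x. cvec (w x)))"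

text \<open>Determined almost everywhere in \<open>S\<close> whenever a square-integrable weak curl exists.\<close>

definition weak_curl :: "(real^3) set \<Rightarrow> field3 \<Rightarrow> field3" where
  "weak_curl S v = (SOME c. has_weak_curl S v c)"

section \<open>Data of the problem\<close>

record maxwell =
  Omega :: "(real^3) set"
  GammaP :: "(real^3) set"
  GammaI :: "(real^3) set"
  nu :: "real^3 \<Rightarrow> real^3"
  eps :: "real^3 \<Rightarrow> real^3^3"
  mu :: "real^3 \<Rightarrow> real^3^3"
  sig :: "real^3 \<Rightarrow> real^3^3"
  Zimp :: "real^3 \<Rightarrow> real^3^3"

abbreviation vol :: "maxwell \<Rightarrow> (real^3) measure" where
  "vol D \<equiv> lebesgue_on (Omega D)"

abbreviation surf :: "maxwell \<Rightarrow> (real^3) measure" where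
  "surf D \<equiv> surface_measure (GammaI D)"

definition bounded_symmetric_on :: "(real^3) set \<Rightarrow> (real^3 \<Rightarrow> real^3^3) \<Rightarrow> bool" where
  "bounded_symmetric_on S A \<longleftrightarrow> A \<in> borel_measurable (lebesgue_on S) \<and>
     (\<exists>B. \<forall>x\<in>S. norm (A x) \<le> B) \<and> (\<forall>x\<in>S. transpose (A x) = A x)"

definition elliptic_on :: "(real^3) set \<Rightarrow> (real^3 \<Rightarrow> real^3^3) \<Rightarrow> bool" where
  "elliptic_on S A \<longleftrightarrow> (\<exists>c>0. \<forall>x\<in>S. \<forall>\<xi>. c * (norm \<xi>)\<^sup>2 \<le> \<xi> \<bullet> (A x *v \<xi>))"

text \<open>
  The unit normal only exists almost everywhere on the boundary, so it is a measurable field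
  \<open>nu\<close> that is the outward normal at almost every point of \<open>GammaI\<close>, the only part of the
  boundary where it is used; correspondingly the pointwise properties of the impedance hold
  almost everywhere on \<open>GammaI\<close>.
\<close>

definition maxwell_setting :: "maxwell \<Rightarrow> bool" where
  "maxwell_setting D \<longleftrightarrow>
     lipschitz_domain (Omega D) \<and>
     openin (top_of_set (frontier (Omega D))) (GammaP D) \<and>
     openin (top_of_set (frontier (Omega D))) (GammaI D) \<and>
     GammaP D \<union> GammaI D = frontier (Omega D) \<and>
     GammaP D \<inter> GammaI D = {} \<and>
     closure (GammaP D) \<inter> closure (GammaI D) = {} \<and>
     nu D \<in> borel_measurable borel \<and>
     (AE x in surf D. is_outward_normal (Omega D) x (nu D x)) \<and>
     bounded_symmetric_on (Omega D) (eps D) \<and> elliptic_on (Omega D) (eps D) \<and>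
     bounded_symmetric_on (Omega D) (mu D) \<and> elliptic_on (Omega D) (mu D) \<and>
     bounded_symmetric_on (Omega D) (sig D) \<and>
     (\<exists>Os. Os \<subseteq> Omega D \<and> has_lipschitz_boundary Os \<and>
        (\<forall>x \<in> Omega D - Os. sig D x = 0) \<and> elliptic_on Os (sig D)) \<and>
     Zimp D \<in> borel_measurable borel \<and>
     (\<exists>B. AE x in surf D. norm (Zimp D x) \<le> B) \<and>
     (AE x in surf D. transpose (Zimp D x) = Zimp D x \<and> Zimp D x *v nu D x = 0) \<and>
     (\<exists>c>0. AE x in surf D. \<forall>\<xi>. \<xi> \<bullet> nu D x = 0 \<longrightarrow> c * (norm \<xi>)\<^sup>2 \<le> \<xi> \<bullet> (Zimp D x *v \<xi>))"

text \<open>Inverse of the impedance on the tangent plane, extended by zero in the normal direction.\<close>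

definition Yadm :: "maxwell \<Rightarrow> real^3 \<Rightarrow> real^3^3" where
  "Yadm D x = (THE Y. Y *v nu D x = 0 \<and>
     (\<forall>\<xi>. \<xi> \<bullet> nu D x = 0 \<longrightarrow> (Y *v \<xi>) \<bullet> nu D x = 0 \<and> Zimp D x *v (Y *v \<xi>) = \<xi>))"

section \<open>Tangential traces and function spaces\<close>

text \<open>
  Traces of fields with square-integrable curl are defined by duality through Green's formula
  \<open>(curl v, w) - (v, curl w) = (n \<times> v, w)\<close> (volume terms on the left, boundary term on the
  right), tested with smooth \<open>w\<close>. Since \<open>n \<times> v\<close> only involves the tangential part, a tangential
  field \<open>g\<close> is the trace \<open>n \<times> (v \<times> n)\<close> on \<open>GammaI\<close> iff the formula holds with boundary term
  \<open>(n \<times> g, w)\<close> over \<open>GammaI\<close> for all \<open>w\<close> supported away from \<open>GammaP\<close>.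
\<close>

definition green :: "maxwell \<Rightarrow> field3 \<Rightarrow> (real^3 \<Rightarrow> real^3) \<Rightarrow> complex" where
  "green D v w = l2ip (vol D) (weak_curl (Omega D) v) (\<lambda>x. cvec (w x))
               - l2ip (vol D) v (\<lambda>x. cvec (classical_curl w x))"

definition has_tangential_trace :: "maxwell \<Rightarrow> field3 \<Rightarrow> field3 \<Rightarrow> bool" where
  "has_tangential_trace D v g \<longleftrightarrow> g \<in> L2 (surf D) \<and>
     (AE x in surf D. cinner (g x) (cvec (nu D x)) = 0) \<and>
     (\<forall>w. test_field w \<and> fsupp w \<inter> GammaP D = {} \<longrightarrow>
        green D v w = l2ip (surf D) (\<lambda>x. ccross (cvec (nu D x)) (g x)) (\<lambda>x. cvec (w x)))"

definition tangential_trace :: "maxwell \<Rightarrow> field3 \<Rightarrow> field3" where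
  "tangential_trace D v = (SOME g. has_tangential_trace D v g)"

definition zero_trace_GammaP :: "maxwell \<Rightarrow> field3 \<Rightarrow> bool" where
  "zero_trace_GammaP D v \<longleftrightarrow>
     (\<forall>w. test_field w \<and> fsupp w \<inter> GammaI D = {} \<longrightarrow> green D v w = 0)"

definition Xspace :: "maxwell \<Rightarrow> field3 set" where
  "Xspace D = {v. v \<in> L2 (vol D) \<and> (\<exists>c. has_weak_curl (Omega D) v c) \<and>
             (\<exists>g. has_tangential_trace D v g)}"

definition XPspace :: "maxwell \<Rightarrow> field3 set" where
  "XPspace D = {v \<in> Xspace D. zero_trace_GammaP D v}"

text \<open>Elements of the product spaces are representatives; they are identified by \<open>em_eq\<close>.\<close>

type_synonym em = "field3 \<times> field3"

definition em_eq :: "maxwell \<Rightarrow> em \<Rightarrow> em \<Rightarrow> bool" where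
  "em_eq D U W \<longleftrightarrow> (AE x in vol D. fst U x = fst W x \<and> snd U x = snd W x)"

definition em_real :: "maxwell \<Rightarrow> em \<Rightarrow> bool" where
  "em_real D U \<longleftrightarrow> (AE x in vol D. \<forall>i. Im (fst U x $ i) = 0 \<and> Im (snd U x $ i) = 0)"

definition em_diff :: "em \<Rightarrow> em \<Rightarrow> em" where
  "em_diff U W = (\<lambda>x. fst U x - fst W x, \<lambda>x. snd U x - snd W x)"

definition em_scale :: "complex \<Rightarrow> em \<Rightarrow> em" where
  "em_scale c U = (\<lambda>x. c *s fst U x, \<lambda>x. c *s snd U x)"

definition em_Re :: "em \<Rightarrow> em" where
  "em_Re U = (\<lambda>x. \<chi> i. complex_of_real (Re (fst U x $ i)), \<lambda>x. \<chi> i. complex_of_real (Re (snd U x $ i)))"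

definition em_sum :: "('i \<Rightarrow> em) \<Rightarrow> 'i set \<Rightarrow> em" where
  "em_sum f I = (\<lambda>x. \<Sum>i\<in>I. fst (f i) x, \<lambda>x. \<Sum>i\<in>I. snd (f i) x)"

definition Lspace :: "maxwell \<Rightarrow> em set" where
  "Lspace D = L2 (vol D) \<times> L2 (vol D)"

definition Vspace :: "maxwell \<Rightarrow> em set" where
  "Vspace D = XPspace D \<times> Xspace D"

definition LspaceR :: "maxwell \<Rightarrow> em set" where
  "LspaceR D = {U \<in> Lspace D. em_real D U}"

definition VspaceR :: "maxwell \<Rightarrow> em set" where
  "VspaceR D = {U \<in> Vspace D. em_real D U}"

text \<open>
  The real fields \<open>[e, h]\<close> with \<open>s (e \<times> n) + Z h_tau = 0\<close> on \<open>GammaI\<close>, for an orientation sign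
  \<open>s\<close> equal to \<open>1\<close> or \<open>-1\<close>. The value \<open>s = 1\<close> is the condition as it is usually written, with
  \<open>n\<close> the outward normal. By Green's formula above, the variational formulation with the form
  \<open>aform\<close> below has the natural boundary condition of the case \<open>s = -1\<close> (that is, the same
  condition written with the inward normal), so both orientations are allowed.
\<close>

definition VspaceI :: "maxwell \<Rightarrow> real \<Rightarrow> em set" where
  "VspaceI D s = {U \<in> VspaceR D.
     AE x in surf D. s *\<^sub>R ccross (tangential_trace D (fst U) x) (cvec (nu D x))
                     + cmat (Zimp D x) *v tangential_trace D (snd U) x = 0}"

section \<open>Inner product, form and norms\<close>

definition ip :: "maxwell \<Rightarrow> em \<Rightarrow> em \<Rightarrow> complex" where
  "ip D U W = wip (vol D) (eps D) (fst U) (fst W) + wip (vol D) (mu D) (snd U) (snd W)"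

definition em_norm :: "maxwell \<Rightarrow> em \<Rightarrow> real" where
  "em_norm D U = sqrt (Re (ip D U U))"

definition aform :: "maxwell \<Rightarrow> em \<Rightarrow> em \<Rightarrow> complex" where
  "aform D U W =
     wip (vol D) (sig D) (fst U) (fst W)
     + wip (surf D) (Yadm D) (tangential_trace D (fst U)) (tangential_trace D (fst W))
     + wip (surf D) (Zimp D) (tangential_trace D (snd U)) (tangential_trace D (snd W))
     + l2ip (vol D) (snd U) (weak_curl (Omega D) (fst W))
     - l2ip (vol D) (fst U) (weak_curl (Omega D) (snd W))"

definition wnorm2 :: "(real^3) measure \<Rightarrow> (real^3 \<Rightarrow> real^3^3) \<Rightarrow> field3 \<Rightarrow> real" where
  "wnorm2 M A f = Re (wip M A f f)"

definition energy_norm :: "maxwell \<Rightarrow> real \<Rightarrow> em \<Rightarrow> real" where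
  "energy_norm D \<omega> U = sqrt (
     \<omega>\<^sup>2 * wnorm2 (vol D) (eps D) (fst U)
     + wnorm2 (surf D) (Yadm D) (tangential_trace D (fst U))
     + wnorm2 (vol D) (\<lambda>x. matrix_inv (mu D x)) (weak_curl (Omega D) (fst U))
     + wnorm2 (vol D) (\<lambda>x. matrix_inv (eps D x)) (\<lambda>x. cmat (sig D x) *v fst U x)
     + \<omega>\<^sup>2 * wnorm2 (vol D) (mu D) (snd U)
     + wnorm2 (surf D) (Zimp D) (tangential_trace D (snd U))
     + wnorm2 (vol D) (\<lambda>x. matrix_inv (eps D x)) (weak_curl (Omega D) (snd U)))"

section \<open>Time-harmonic problem\<close>

definition harmonic_solution :: "maxwell \<Rightarrow> real \<Rightarrow> em \<Rightarrow> em \<Rightarrow> bool" where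
  "harmonic_solution D \<omega> \<phi> S \<longleftrightarrow> S \<in> Vspace D \<and>
     (\<forall>w \<in> Vspace D. \<i> * of_real \<omega> * ip D S w + aform D S w = ip D \<phi> w)"

definition harmonic_wellposed :: "maxwell \<Rightarrow> real \<Rightarrow> real \<Rightarrow> bool" where
  "harmonic_wellposed D \<omega> Cstab \<longleftrightarrow>
     (\<forall>\<phi> \<in> Lspace D. \<exists>S. harmonic_solution D \<omega> \<phi> S \<and>
        (\<forall>S'. harmonic_solution D \<omega> \<phi> S' \<longrightarrow> em_eq D S' S) \<and>
        energy_norm D \<omega> S \<le> Cstab * em_norm D \<phi>)"

section \<open>Time-dependent problem, propagator and filter\<close>

definition period :: "real \<Rightarrow> real" where
  "period \<omega> = 2 * pi / \<omega>"

definition path_continuous :: "(em \<Rightarrow> real) \<Rightarrow> real set \<Rightarrow> (real \<Rightarrow> em) \<Rightarrow> bool" where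
  "path_continuous N I U \<longleftrightarrow> (\<forall>t\<in>I. ((\<lambda>\<tau>. N (em_diff (U \<tau>) (U t))) \<longlongrightarrow> 0) (at t within I))"

definition path_derivative :: "(em \<Rightarrow> real) \<Rightarrow> real set \<Rightarrow> (real \<Rightarrow> em) \<Rightarrow> (real \<Rightarrow> em) \<Rightarrow> bool" where
  "path_derivative N I U U' \<longleftrightarrow>
     (\<forall>t\<in>I. ((\<lambda>\<tau>. N (em_diff (em_scale (of_real (1 / (\<tau> - t))) (em_diff (U \<tau>) (U t))) (U' t)))
               \<longlongrightarrow> 0) (at t within I))"

definition strong_solution ::
    "maxwell \<Rightarrow> real \<Rightarrow> real \<Rightarrow> em \<Rightarrow> em \<Rightarrow> (real \<Rightarrow> em) \<Rightarrow> bool" where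
  "strong_solution D s \<omega> \<phi> U\<^sub>0 U \<longleftrightarrow>
     (\<forall>t \<in> {0..period \<omega>}. U t \<in> VspaceI D s) \<and>
     path_continuous (energy_norm D \<omega>) {0..period \<omega>} U \<and>
     em_eq D (U 0) U\<^sub>0 \<and>
     (\<exists>U'. (\<forall>t \<in> {0..period \<omega>}. U' t \<in> LspaceR D) \<and>
        path_derivative (em_norm D) {0..period \<omega>} U U' \<and>
        path_continuous (em_norm D) {0..period \<omega>} U' \<and>
        (\<forall>t \<in> {0<..<period \<omega>}. \<forall>v \<in> VspaceR D.
           ip D (U' t) v + aform D (U t) v
           = ip D (em_Re (em_scale (exp (\<i> * of_real (\<omega> * t))) \<phi>)) v))"

text \<open>
  Unique solvability for initial data in \<open>VspaceI\<close>, together with the density and the continuity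
  (affine dependence, hence a Lipschitz bound) by which the solution map extends to \<open>LspaceR\<close>.
\<close>

definition evolution_wellposed :: "maxwell \<Rightarrow> real \<Rightarrow> real \<Rightarrow> bool" where
  "evolution_wellposed D s \<omega> \<longleftrightarrow>
     (\<forall>\<phi> \<in> Lspace D. \<forall>U\<^sub>0 \<in> VspaceI D s.
        \<exists>U. strong_solution D s \<omega> \<phi> U\<^sub>0 U \<and>
            (\<forall>W. strong_solution D s \<omega> \<phi> U\<^sub>0 W \<longrightarrow> (\<forall>t \<in> {0..period \<omega>}. em_eq D (W t) (U t)))) \<and>
     (\<forall>U\<^sub>0 \<in> LspaceR D. \<forall>e>0. \<exists>W\<^sub>0 \<in> VspaceI D s. em_norm D (em_diff W\<^sub>0 U\<^sub>0) < e) \<and>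
     (\<forall>\<phi> \<in> Lspace D. \<exists>C. \<forall>U\<^sub>0 \<in> VspaceI D s. \<forall>W\<^sub>0 \<in> VspaceI D s. \<forall>U W.
        strong_solution D s \<omega> \<phi> U\<^sub>0 U \<longrightarrow> strong_solution D s \<omega> \<phi> W\<^sub>0 W \<longrightarrow>
        (\<forall>t \<in> {0..period \<omega>}. em_norm D (em_diff (U t) (W t)) \<le> C * em_norm D (em_diff U\<^sub>0 W\<^sub>0)))"

text \<open>
  The extension by density and continuity: uniform limits in time of solutions whose initial
  data lie in \<open>VspaceI\<close> and converge to \<open>U\<^sub>0\<close>.
\<close>

definition evolution ::
    "maxwell \<Rightarrow> real \<Rightarrow> real \<Rightarrow> em \<Rightarrow> em \<Rightarrow> (real \<Rightarrow> em) \<Rightarrow> bool" where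
  "evolution D s \<omega> \<phi> U\<^sub>0 U \<longleftrightarrow>
     (\<forall>t \<in> {0..period \<omega>}. U t \<in> LspaceR D) \<and>
     path_continuous (em_norm D) {0..period \<omega>} U \<and>
     (\<exists>u\<^sub>0 u. (\<forall>n::nat. u\<^sub>0 n \<in> VspaceI D s \<and> strong_solution D s \<omega> \<phi> (u\<^sub>0 n) (u n)) \<and>
        (\<lambda>n. em_norm D (em_diff (u\<^sub>0 n) U\<^sub>0)) \<longlonglongrightarrow> 0 \<and>
        (\<forall>e>0. \<forall>\<^sub>F n in sequentially. \<forall>t \<in> {0..period \<omega>}. em_norm D (em_diff (u n t) (U t)) < e))"

definition solution_map :: "maxwell \<Rightarrow> real \<Rightarrow> real \<Rightarrow> em \<Rightarrow> em \<Rightarrow> real \<Rightarrow> em" where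
  "solution_map D s \<omega> \<phi> U\<^sub>0 = (SOME U. evolution D s \<omega> \<phi> U\<^sub>0 U)"

text \<open>
  \<open>Lspace\<close>-valued integral: literally the library's \<open>has_integral\<close> on an interval, with the
  norm of \<open>Lspace\<close>. For continuous paths it is the Riemann (and Bochner) integral.
\<close>

definition has_em_integral :: "maxwell \<Rightarrow> (real \<Rightarrow> em) \<Rightarrow> em \<Rightarrow> real set \<Rightarrow> bool" where
  "has_em_integral D f G I \<longleftrightarrow> G \<in> Lspace D \<and>
     (\<forall>e>0. \<exists>\<gamma>. gauge \<gamma> \<and>
        (\<forall>p. p tagged_division_of I \<and> \<gamma> fine p \<longrightarrow>
           em_norm D (em_diff (em_sum (\<lambda>(t, K). em_scale (of_real (measure lborel K)) (f t)) p) G) < e))"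

definition em_integral :: "maxwell \<Rightarrow> real set \<Rightarrow> (real \<Rightarrow> em) \<Rightarrow> em" where
  "em_integral D I f = (SOME G. has_em_integral D f G I)"

definition propagator :: "maxwell \<Rightarrow> real \<Rightarrow> real \<Rightarrow> em \<Rightarrow> em \<Rightarrow> em" where
  "propagator D s \<omega> \<phi> U\<^sub>0 = solution_map D s \<omega> \<phi> U\<^sub>0 (period \<omega>)"

definition time_filter :: "maxwell \<Rightarrow> real \<Rightarrow> real \<Rightarrow> em \<Rightarrow> em \<Rightarrow> em" where
  "time_filter D s \<omega> \<phi> U\<^sub>0 =
     em_scale (of_real (2 / period \<omega>))
       (em_integral D {0..period \<omega>}
          (\<lambda>t. em_scale (exp (- \<i> * of_real (\<omega> * t))) (solution_map D s \<omega> \<phi> U\<^sub>0 t)))"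

end

theory Submission
  imports Defs
begin

text \<open>
  Multiplying the evolution equation by \<open>e\<^sup>-\<^sup>i\<^sup>\<omega>\<^sup>t\<close>, integrating over one period and integrating the
  time derivative by parts turns it into the time-harmonic equation for the filtered field, the
  boundary term of the integration by parts being \<open>\<omega>/\<pi> (U\<^sub>0 - P U\<^sub>0)\<close>. For initial data in
  \<open>VspaceI\<close> the path is continuous in the energy norm, so the filtered field lies in \<open>Vspace\<close>:
  curls and traces are defined by testing, and testing commutes with time integration. For
  general initial data the filtered fields of approximating strong solutions solve time-harmonic
  problems with convergent data, so by the stability bound they converge in the energy norm, and
  the limit must be the filtered field. The error estimate is the stability bound applied to the
  difference of two time-harmonic problems. That the forms are sesquilinear at all rests on the
  uniqueness of weak curls and of tangential traces, which follows by testing with bump functions;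
  for traces this needs that surface measure is finite on compact sets.
\<close>

section \<open>Square-integrable fields\<close>

text \<open>Curls, traces, solution paths and integrals are chosen by \<open>SOME\<close> and fields
  are mere representatives, so linearity holds only almost everywhere and fields are compared by
  pairing them with fixed test fields. This shapes the integration in time: Riemann sums are
  compared with scalar gauge integrals, uniformly over test fields, which yields the integral of a
  path together with its approximation in norm. The obstacle for general initial data is that the
  extended path need not take values in \<open>Vspace\<close>, so neither the form nor the evolution
  equation can be applied to it. What survives is the weak description of the filtered field by
  scalar integrals, and this is exactly what uniform convergence of paths preserves. Two mismatches
  have to be bridged: the evolution equation is tested with real fields but the harmonic one with
  complex fields, and averaging Re(\<phi> e^(i\<omega>t)) against the phase leaves the factor T/2,
  which the filter's 2/T = \<omega>/\<pi> cancels.\<close>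

lemma measurable_vec_nth [measurable (raw)]:
  assumes "f \<in> borel_measurable M"
  shows "(\<lambda>x. f x $ i :: 'a::real_normed_vector) \<in> borel_measurable M"
  by (rule borel_measurable_continuous_on[OF _ assms]) (intro continuous_intros)

lemma borel_measurable_vecI:
  fixes f :: "'b \<Rightarrow> 'a::euclidean_space ^ 'n"
  assumes "\<And>i. (\<lambda>x. f x $ i) \<in> borel_measurable M"
  shows "f \<in> borel_measurable M"
proof -
  have "f = (\<lambda>x. \<Sum>i\<in>UNIV. axis i (f x $ i))"
    by (auto simp: vec_eq_iff axis_def fun_eq_iff if_distrib cong: if_cong)
  moreover have "(\<lambda>x. axis i (f x $ i)) \<in> borel_measurable M" for i
  proof (rule borel_measurable_continuous_on[OF _ assms])
    show "continuous_on UNIV (axis i :: 'a \<Rightarrow> 'a ^ 'n)"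
      unfolding axis_def
    proof (rule continuous_on_vec_lambda)
      fix j
      show "continuous_on UNIV (\<lambda>x::'a. if j = i then x else 0)"
        by (cases "j = i") simp_all
    qed
  qed
  then have "(\<lambda>x. \<Sum>i\<in>UNIV. axis i (f x $ i)) \<in> borel_measurable M"
    by (intro borel_measurable_sum)
  ultimately show ?thesis
    by simp
qed

section \<open>Hermitian algebra of complex vectors\<close>

lemma Re_cinner: "Re (cinner u v) = u \<bullet> v"
  by (simp add: cinner_def inner_vec_def inner_complex_def)

lemma cinner_self: "cinner u u = of_real ((norm u)\<^sup>2)"
proof (rule complex_eqI)
  show "Im (cinner u u) = Im (complex_of_real ((norm u)\<^sup>2))"
    by (simp add: cinner_def)
qed (simp add: Re_cinner power2_norm_eq_inner)

lemma cinner_add_left: "cinner (u + v) w = cinner u w + cinner v w"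
  and cinner_diff_left: "cinner (u - v) w = cinner u w - cinner v w"
  and cinner_scale_left: "cinner (c *s u) w = c * cinner u w"
  and cinner_diff_right: "cinner w (u - v) = cinner w u - cinner w v"
  and cinner_scale_right: "cinner w (c *s u) = cnj c * cinner w u"
  and cinner_zero_left: "cinner 0 w = 0"
  by (simp_all add: cinner_def sum.distrib sum_subtractf algebra_simps sum_distrib_left)

lemma norm_scale: "norm (c *s (u :: complex^3)) = cmod c * norm u"
  by (simp add: norm_vec_def norm_mult L2_set_right_distrib)

lemma cmod_cinner_le: "cmod (cinner u v) \<le> norm u * norm v"
proof (cases "cinner u v = 0")
  case False
  \<comment> \<open>A unimodular phase turns the Hermitian product into its modulus, which
    \<open>Re_cinner\<close> identifies with the real inner product, so the real Cauchy-Schwarz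
    inequality applies.\<close>
  define c where "c = cnj (cinner u v) / of_real (cmod (cinner u v))"
  have "cinner (c *s u) v = of_real (cmod (cinner u v))"
    using False complex_norm_square[of "cinner u v"]
    by (simp add: c_def cinner_scale_left power2_eq_square field_simps)
  then have "cmod (cinner u v) = (c *s u) \<bullet> v"
    by (metis Re_cinner Re_complex_of_real)
  also have "\<dots> \<le> norm (c *s u) * norm v"
    by (rule norm_cauchy_schwarz)
  also have "norm (c *s u) = norm u"
    using False by (simp add: norm_scale c_def norm_divide)
  finally show ?thesis .
qed simp

lemma measurable_cinner [measurable (raw)]:
  assumes "f \<in> borel_measurable M" "g \<in> borel_measurable M"
  shows "(\<lambda>x. cinner (f x) (g x)) \<in> borel_measurable M"
  unfolding cinner_def
  by (intro borel_measurable_sum borel_measurable_times measurable_vec_nth assms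
      borel_measurable_continuous_on[where f = cnj] continuous_intros)

lemma measurable_scale [measurable (raw)]:
  assumes "c \<in> borel_measurable M" "f \<in> borel_measurable M"
  shows "(\<lambda>x. c x *s f x :: complex^3) \<in> borel_measurable M"
  using assms by (intro borel_measurable_vecI) simp

text \<open>Squared norms are used instead of norms: the factor 2 of \<open>norm_add_sq_le\<close>
  replaces the triangle inequality, and \<open>l2ip_self\<close> links them directly to
  pairings.\<close>

definition l2sq :: "(real^3) measure \<Rightarrow> field3 \<Rightarrow> real" where
  "l2sq M f = (LINT x|M. (norm (f x))\<^sup>2)"

lemma l2sq_nonneg [simp]: "0 \<le> l2sq M f"
  by (simp add: l2sq_def)

lemma L2_measurable: "f \<in> L2 M \<Longrightarrow> f \<in> borel_measurable M"
  and L2_integrable: "f \<in> L2 M \<Longrightarrow> integrable M (\<lambda>x. (norm (f x))\<^sup>2)"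
  by (simp_all add: L2_def)

lemma norm_add_sq_le: "(norm (u + v))\<^sup>2 \<le> 2 * (norm u)\<^sup>2 + 2 * (norm v)\<^sup>2"
  for u v :: "'a::real_normed_vector"
proof -
  have "(norm (u + v))\<^sup>2 \<le> (norm u + norm v)\<^sup>2"
    by (simp add: norm_triangle_ineq power_mono)
  also have "\<dots> \<le> 2 * (norm u)\<^sup>2 + 2 * (norm v)\<^sup>2"
    using sum_squares_bound[of "norm u" "norm v"] by (simp add: power2_sum)
  finally show ?thesis .
qed

lemma L2_bound:
  assumes "g \<in> borel_measurable M" "f \<in> L2 M" "AE x in M. norm (g x) \<le> C * norm (f x)"
  shows "g \<in> L2 M" and "l2sq M g \<le> C\<^sup>2 * l2sq M f"
proof -
  have int: "integrable M (\<lambda>x. C\<^sup>2 * (norm (f x))\<^sup>2)"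
    using L2_integrable[OF assms(2)] by simp
  have le: "AE x in M. (norm (g x))\<^sup>2 \<le> C\<^sup>2 * (norm (f x))\<^sup>2"
    using assms(3) by eventually_elim (metis norm_ge_zero power_mono power_mult_distrib)
  have int2: "integrable M (\<lambda>x. (norm (g x))\<^sup>2)"
    by (rule Bochner_Integration.integrable_bound[OF int]) (use assms(1) le in auto)
  then show "g \<in> L2 M"
    using assms(1) by (simp add: L2_def)
  have "l2sq M g \<le> (LINT x|M. C\<^sup>2 * (norm (f x))\<^sup>2)"
    unfolding l2sq_def by (rule integral_mono_AE[OF int2 int le])
  then show "l2sq M g \<le> C\<^sup>2 * l2sq M f"
    by (simp add: l2sq_def)
qed

lemma L2_add:
  assumes "f \<in> L2 M" "g \<in> L2 M"
  shows "(\<lambda>x. f x + g x) \<in> L2 M" and "l2sq M (\<lambda>x. f x + g x) \<le> 2 * l2sq M f + 2 * l2sq M g"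
proof -
  have [measurable]: "f \<in> borel_measurable M" "g \<in> borel_measurable M"
    using assms by (simp_all add: L2_def)
  have int: "integrable M (\<lambda>x. 2 * (norm (f x))\<^sup>2 + 2 * (norm (g x))\<^sup>2)"
    using assms by (simp add: L2_def)
  have int2: "integrable M (\<lambda>x. (norm (f x + g x))\<^sup>2)"
    by (rule Bochner_Integration.integrable_bound[OF int]) (simp_all add: norm_add_sq_le)
  then show "(\<lambda>x. f x + g x) \<in> L2 M"
    by (simp add: L2_def)
  have "l2sq M (\<lambda>x. f x + g x) \<le> (LINT x|M. 2 * (norm (f x))\<^sup>2 + 2 * (norm (g x))\<^sup>2)"
    unfolding l2sq_def by (rule integral_mono[OF int2 int]) (rule norm_add_sq_le)
  also have "\<dots> = 2 * l2sq M f + 2 * l2sq M g"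
    using assms by (simp add: l2sq_def L2_def)
  finally show "l2sq M (\<lambda>x. f x + g x) \<le> 2 * l2sq M f + 2 * l2sq M g" .
qed

lemma L2_scale:
  assumes "f \<in> L2 M"
  shows "(\<lambda>x. c *s f x) \<in> L2 M" and "l2sq M (\<lambda>x. c *s f x) = (cmod c)\<^sup>2 * l2sq M f"
  using assms by (simp_all add: L2_def l2sq_def norm_scale power_mult_distrib measurable_scale)

lemma vec_diff_scale: "u - v = u + (-1) *s v" for v :: "complex^3"
  by (simp add: vec_eq_iff)

lemma L2_diff:
  assumes "f \<in> L2 M" "g \<in> L2 M"
  shows "(\<lambda>x. f x - g x) \<in> L2 M" and "l2sq M (\<lambda>x. f x - g x) \<le> 2 * l2sq M f + 2 * l2sq M g"
  using L2_add[OF assms(1) L2_scale(1)[OF assms(2), of "-1"]] L2_scale(2)[OF assms(2), of "-1"]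
  by (simp_all flip: vec_diff_scale)

lemma L2_zero [simp]: "(\<lambda>x. 0) \<in> L2 M"
  by (simp add: L2_def)

lemma L2_sum:
  assumes "finite I" "\<And>i. i \<in> I \<Longrightarrow> f i \<in> L2 M"
  shows "(\<lambda>x. \<Sum>i\<in>I. f i x) \<in> L2 M"
  using assms by (induction I rule: finite_induct) (auto intro: L2_add)

lemma l2sq_zero_iff:
  assumes "f \<in> L2 M"
  shows "l2sq M f = 0 \<longleftrightarrow> (AE x in M. f x = 0)"
  unfolding l2sq_def by (subst integral_nonneg_eq_0_iff_AE) (use assms in \<open>auto simp: L2_def\<close>)

lemma l2sq_cong_AE:
  assumes "f \<in> L2 M" "g \<in> L2 M" "AE x in M. f x = g x"
  shows "l2sq M f = l2sq M g"
  unfolding l2sq_def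
proof (rule integral_cong_AE)
  show "AE x in M. (norm (f x))\<^sup>2 = (norm (g x))\<^sup>2"
    using assms(3) by eventually_elim simp
qed (use assms in \<open>auto simp: L2_def\<close>)

lemma l2ip_integrable:
  assumes "f \<in> L2 M" "g \<in> L2 M"
  shows "integrable M (\<lambda>x. cinner (f x) (g x))"
proof (rule Bochner_Integration.integrable_bound)
  show "integrable M (\<lambda>x. (norm (f x))\<^sup>2 + (norm (g x))\<^sup>2)"
    using assms by (simp add: L2_def)
  show "(\<lambda>x. cinner (f x) (g x)) \<in> borel_measurable M"
    using assms by (simp add: L2_def measurable_cinner)
  show "AE x in M. norm (cinner (f x) (g x)) \<le> norm ((norm (f x))\<^sup>2 + (norm (g x))\<^sup>2)"
  proof (rule AE_I2)
    fix x
    have "cmod (cinner (f x) (g x)) \<le> norm (f x) * norm (g x)"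
      by (rule cmod_cinner_le)
    also have "\<dots> \<le> (norm (f x))\<^sup>2 + (norm (g x))\<^sup>2"
      using sum_squares_bound[of "norm (f x)" "norm (g x)"]
        mult_nonneg_nonneg[OF norm_ge_zero[of "f x"] norm_ge_zero[of "g x"]] by linarith
    finally show "norm (cinner (f x) (g x)) \<le> norm ((norm (f x))\<^sup>2 + (norm (g x))\<^sup>2)"
      by simp
  qed
qed

lemma l2ip_add_left:
  "\<lbrakk>f \<in> L2 M; g \<in> L2 M; h \<in> L2 M\<rbrakk> \<Longrightarrow> l2ip M (\<lambda>x. f x + g x) h = l2ip M f h + l2ip M g h"
  by (simp add: l2ip_def cinner_add_left l2ip_integrable)

lemma l2ip_diff_left:
  "\<lbrakk>f \<in> L2 M; g \<in> L2 M; h \<in> L2 M\<rbrakk> \<Longrightarrow> l2ip M (\<lambda>x. f x - g x) h = l2ip M f h - l2ip M g h"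
  by (simp add: l2ip_def cinner_diff_left l2ip_integrable)

lemma l2ip_diff_right:
  "\<lbrakk>f \<in> L2 M; g \<in> L2 M; h \<in> L2 M\<rbrakk> \<Longrightarrow> l2ip M h (\<lambda>x. f x - g x) = l2ip M h f - l2ip M h g"
  by (simp add: l2ip_def cinner_diff_right l2ip_integrable)

lemma l2ip_scale_left: "l2ip M (\<lambda>x. c *s f x) h = c * l2ip M f h"
  by (simp add: l2ip_def cinner_scale_left)

lemma l2ip_scale_right: "l2ip M h (\<lambda>x. c *s f x) = cnj c * l2ip M h f"
  by (simp add: l2ip_def cinner_scale_right)

lemma l2ip_sum_left:
  assumes "finite I" "\<And>i. i \<in> I \<Longrightarrow> f i \<in> L2 M" "h \<in> L2 M"
  shows "l2ip M (\<lambda>x. \<Sum>i\<in>I. f i x) h = (\<Sum>i\<in>I. l2ip M (f i) h)"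
  using assms
proof (induction I rule: finite_induct)
  case empty
  show ?case by (simp add: l2ip_def cinner_zero_left)
next
  case (insert i I)
  then show ?case by (simp add: l2ip_add_left L2_sum)
qed

lemma l2ip_self: "l2ip M f f = of_real (l2sq M f)"
  unfolding l2ip_def l2sq_def cinner_self by (rule integral_complex_of_real)

lemma l2ip_cong_AE:
  assumes "f \<in> borel_measurable M" "f' \<in> borel_measurable M" "AE x in M. f x = f' x"
    and "g \<in> borel_measurable M" "g' \<in> borel_measurable M" "AE x in M. g x = g' x"
  shows "l2ip M f g = l2ip M f' g'"
  unfolding l2ip_def
proof (rule integral_cong_AE)
  show "AE x in M. cinner (f x) (g x) = cinner (f' x) (g' x)"
    using assms(3,6) by eventually_elim simp
qed (use assms in measurable)

lemma l2ip_cong_AE_left: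
  assumes "f \<in> L2 M" "f' \<in> L2 M" "AE x in M. f x = f' x" "g \<in> borel_measurable M"
  shows "l2ip M f g = l2ip M f' g"
  by (rule l2ip_cong_AE) (use assms in \<open>auto simp: L2_def\<close>)

lemma l2ip_cong_AE_right:
  assumes "g \<in> L2 M" "g' \<in> L2 M" "AE x in M. g x = g' x" "f \<in> borel_measurable M"
  shows "l2ip M f g = l2ip M f g'"
  by (rule l2ip_cong_AE) (use assms in \<open>auto simp: L2_def\<close>)

text \<open>The pairing is first bounded by the integral \<open>B\<close> of the product of the
  pointwise norms. The square of |f| - t |g| has nonnegative integral for every real t, and the
  discriminant of this quadratic bounds \<open>B\<close>.\<close>

lemma cmod_l2ip_le:
  assumes "f \<in> L2 M" "g \<in> L2 M"
  shows "cmod (l2ip M f g) \<le> sqrt (l2sq M f) * sqrt (l2sq M g)"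
proof -
  define B where "B = (LINT x|M. norm (f x) * norm (g x))"
  have [measurable]: "f \<in> borel_measurable M" "g \<in> borel_measurable M"
    using assms by (simp_all add: L2_def)
  have int: "integrable M (\<lambda>x. norm (f x) * norm (g x))"
  proof (rule Bochner_Integration.integrable_bound)
    show "integrable M (\<lambda>x. (norm (f x))\<^sup>2 + (norm (g x))\<^sup>2)"
      using assms by (simp add: L2_def)
    show "AE x in M. norm (norm (f x) * norm (g x)) \<le> norm ((norm (f x))\<^sup>2 + (norm (g x))\<^sup>2)"
    proof (rule AE_I2)
      fix x
      show "norm (norm (f x) * norm (g x)) \<le> norm ((norm (f x))\<^sup>2 + (norm (g x))\<^sup>2)"
        using sum_squares_bound[of "norm (f x)" "norm (g x)"]
          mult_nonneg_nonneg[OF norm_ge_zero[of "f x"] norm_ge_zero[of "g x"]]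
        unfolding real_norm_def by linarith
    qed
  qed measurable
  have "cmod (l2ip M f g) \<le> (LINT x|M. cmod (cinner (f x) (g x)))"
    unfolding l2ip_def by (rule integral_norm_bound)
  also have "\<dots> \<le> B"
    unfolding B_def
    by (rule integral_mono) (use l2ip_integrable[OF assms] int in \<open>auto intro: cmod_cinner_le\<close>)
  finally have le: "cmod (l2ip M f g) \<le> B" .
  have quad: "0 \<le> l2sq M f - 2 * t * B + t\<^sup>2 * l2sq M g" for t
  proof -
    have eq: "(norm (f x) - t * norm (g x))\<^sup>2
        = (norm (f x))\<^sup>2 - 2 * t * (norm (f x) * norm (g x)) + t\<^sup>2 * (norm (g x))\<^sup>2" for x
      by (simp add: power2_eq_square algebra_simps)
    have "0 \<le> (LINT x|M. (norm (f x) - t * norm (g x))\<^sup>2)"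
      by simp
    also have "\<dots> = l2sq M f - 2 * t * B + t\<^sup>2 * l2sq M g"
      unfolding eq using assms int by (simp add: l2sq_def B_def L2_def)
    finally show ?thesis .
  qed
  have "B\<^sup>2 \<le> l2sq M f * l2sq M g"
  proof (cases "l2sq M g = 0")
    case True
    have "B = 0"
    proof (rule ccontr)
      assume "B \<noteq> 0"
      \<comment> \<open>With leading coefficient zero the quadratic is affine in t, and this value
        of t makes it equal to -1.\<close>
      then show False
        using quad[of "(l2sq M f + 1) / (2 * B)"] True by (simp add: field_simps)
    qed
    then show ?thesis by simp
  next
    case False
    then have "0 < l2sq M g"
      using l2sq_nonneg[of M g] by linarith
    \<comment> \<open>The minimiser t = B / |g|^2 gives the sharp bound.\<close>
    then show ?thesis
      using quad[of "B / l2sq M g"] by (simp add: power2_eq_square field_simps)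
  qed
  then have "B \<le> sqrt (l2sq M f * l2sq M g)"
    using real_le_rsqrt by blast
  with le show ?thesis
    by (simp add: real_sqrt_mult)
qed

subsection \<open>Completeness\<close>

text \<open>Writing h_k as the product of 2^(k/2) h_k and 2^(-k/2), the arithmetic-geometric mean
  bounds 2 h_k by 2^k h_k^2 + 2^(-k). A geometric weight thus trades square summability for
  summability.\<close>

lemma summable_of_weighted_square:
  fixes h :: "nat \<Rightarrow> real"
  assumes "summable (\<lambda>k. 2 ^ k * (h k)\<^sup>2)" "\<And>k. 0 \<le> h k"
  shows "summable h"
proof (rule summable_comparison_test')
  show "summable (\<lambda>k. 2 ^ k * (h k)\<^sup>2 + (1/2) ^ k)"
    using assms(1) by (intro summable_add) (auto intro: summable_geometric)
  fix k :: nat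
  have "2 * (sqrt (2 ^ k) * h k) * sqrt ((1/2) ^ k) \<le> 2 ^ k * (h k)\<^sup>2 + (1/2) ^ k"
    using sum_squares_bound[of "sqrt (2 ^ k) * h k" "sqrt ((1/2) ^ k)"]
    by (simp add: power_mult_distrib)
  moreover have "sqrt (2 ^ k) * sqrt ((1/2) ^ k) = (1::real)"
    by (simp flip: real_sqrt_mult power_mult_distrib)
  then have "(sqrt (2 ^ k) * h k) * sqrt ((1/2) ^ k) = h k"
    by (metis mult.assoc mult.commute mult_1)
  ultimately have "2 * h k \<le> 2 ^ k * (h k)\<^sup>2 + (1/2) ^ k"
    by (metis mult.assoc)
  then show "norm (h k) \<le> 2 ^ k * (h k)\<^sup>2 + (1/2) ^ k"
    using assms(2)[of k] by simp
qed

text \<open>The increments are square-integrable but need not be integrable, since the measure may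
  be infinite, so their norms cannot be summed under the integral. Their squares weighted by 2^k
  can: these have integrals at most 2^(-k), so the weighted series is finite almost everywhere and
  the increments are absolutely summable there.\<close>

lemma L2_AE_convergent:
  assumes f: "\<And>k. f k \<in> L2 M" and fast: "\<And>k. l2sq M (\<lambda>x. f (Suc k) x - f k x) \<le> (1/4) ^ k"
  shows "AE x in M. convergent (\<lambda>k. f k x)"
proof -
  have [measurable]: "f k \<in> borel_measurable M" for k
    using f by (simp add: L2_def)
  define h where "h k x = norm (f (Suc k) x - f k x)" for k x
  have [measurable]: "h k \<in> borel_measurable M" for k
    unfolding h_def by measurable
  have nnk: "(\<integral>\<^sup>+x. ennreal (2 ^ k * (h k x)\<^sup>2) \<partial>M) \<le> ennreal ((1/2) ^ k)" for k
  proof -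
    have "(\<integral>\<^sup>+x. ennreal (2 ^ k * (h k x)\<^sup>2) \<partial>M) = ennreal (LINT x|M. 2 ^ k * (h k x)\<^sup>2)"
      using L2_integrable[OF L2_diff(1)[OF f f, of "Suc k" k]]
      by (intro nn_integral_eq_integral) (auto simp: h_def)
    also have "(LINT x|M. 2 ^ k * (h k x)\<^sup>2) = 2 ^ k * l2sq M (\<lambda>x. f (Suc k) x - f k x)"
      by (simp add: h_def l2sq_def)
    also have "\<dots> \<le> 2 ^ k * (1/4) ^ k"
      using fast by (intro mult_left_mono) auto
    also have "\<dots> = (1/2) ^ k"
      by (simp flip: power_mult_distrib)
    finally show ?thesis by (simp add: ennreal_leI)
  qed
  have "(\<integral>\<^sup>+x. (\<Sum>k. ennreal (2 ^ k * (h k x)\<^sup>2)) \<partial>M) = (\<Sum>k. \<integral>\<^sup>+x. ennreal (2 ^ k * (h k x)\<^sup>2) \<partial>M)"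
    by (rule nn_integral_suminf) measurable
  also have "\<dots> \<le> (\<Sum>k. ennreal ((1/2) ^ k))"
    by (intro suminf_le nnk) auto
  also have "\<dots> = ennreal (\<Sum>k. (1/2) ^ k)"
    by (intro suminf_ennreal2) (auto intro: summable_geometric)
  also have "\<dots> < \<infinity>"
    by simp
  finally have "AE x in M. (\<Sum>k. ennreal (2 ^ k * (h k x)\<^sup>2)) \<noteq> \<infinity>"
    by (intro nn_integral_PInf_AE) (auto simp: less_top)
  then show ?thesis
  proof eventually_elim
    case (elim x)
    then have "summable (\<lambda>k. 2 ^ k * (h k x)\<^sup>2)"
      by (intro summable_suminf_not_top) (auto simp: h_def)
    then have "summable (\<lambda>k. h k x)"
      by (rule summable_of_weighted_square) (simp add: h_def)
    then have "summable (\<lambda>k. f (Suc k) x - f k x)"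
      unfolding h_def by (rule summable_norm_cancel)
    then have "convergent (\<lambda>n. \<Sum>k<n. f (Suc k) x - f k x)"
      by (simp add: summable_iff_convergent)
    then have "convergent (\<lambda>n. f n x - f 0 x)"
      unfolding sum_lessThan_telescope[of "\<lambda>k. f k x"] .
    then show ?case
      using convergent_add[OF _ convergent_const[of "f 0 x"]] by fastforce
  qed
qed

text \<open>The Riesz-Fischer argument: a fast subsequence converges almost everywhere, and Fatou's
  lemma along it bounds the distance of every late member to the limit.\<close>

theorem L2_complete:
  assumes f: "\<And>k::nat. f k \<in> L2 M"
    and Cauchy: "\<And>e. e > 0 \<Longrightarrow> \<exists>N. \<forall>m\<ge>N. \<forall>n\<ge>N. l2sq M (\<lambda>x. f m x - f n x) \<le> e"
  obtains g where "g \<in> L2 M" "(\<lambda>k. l2sq M (\<lambda>x. f k x - g x)) \<longlonglongrightarrow> 0"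
proof -
  have meas [measurable]: "f k \<in> borel_measurable M" for k
    using f by (simp add: L2_def)
  obtain N where N: "\<And>e m n. \<lbrakk>e > 0; m \<ge> N e; n \<ge> N e\<rbrakk> \<Longrightarrow> l2sq M (\<lambda>x. f m x - f n x) \<le> e"
    using Cauchy by metis
  \<comment> \<open>\<open>r\<close> increases strictly and stays above the threshold for 4^(-k); it
    starts at \<open>N 1\<close> because 4^0 = 1.\<close>
  define r where "r = rec_nat (N 1) (\<lambda>k m. max (Suc m) (N ((1/4) ^ Suc k)))"
  have r_Suc: "r (Suc k) = max (Suc (r k)) (N ((1/4) ^ Suc k))" for k
    by (simp add: r_def)
  have rN: "N ((1/4) ^ k) \<le> r k" for k
    by (cases k) (simp_all add: r_def)
  have "strict_mono r"
    by (rule strict_mono_Suc_iff[THEN iffD2]) (simp add: r_Suc less_max_iff_disj)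
  then have r_ge: "k \<le> r k" for k
    by (rule strict_mono_imp_increasing)
  have "AE x in M. convergent (\<lambda>k. f (r k) x)"
  proof (rule L2_AE_convergent)
    fix k
    have "r k \<le> r (Suc k)" by (simp add: r_Suc)
    then show "l2sq M (\<lambda>x. f (r (Suc k)) x - f (r k) x) \<le> (1/4) ^ k"
      using rN[of k] by (intro N) auto
  qed (rule f)
  define g where "g x = lim (\<lambda>k. f (r k) x)" for x
  have [measurable]: "g \<in> borel_measurable M"
    unfolding g_def by measurable
  have conv: "AE x in M. (\<lambda>k. f (r k) x) \<longlonglongrightarrow> g x"
    using \<open>AE x in M. convergent _\<close> by eventually_elim (simp add: g_def convergent_LIMSEQ_iff)
  have fatou: "(\<integral>\<^sup>+x. ennreal ((norm (f n x - g x))\<^sup>2) \<partial>M) \<le> ennreal e"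
    if "e > 0" "n \<ge> N e" for e n
  proof -
    have "(\<integral>\<^sup>+x. ennreal ((norm (f n x - g x))\<^sup>2) \<partial>M)
        = (\<integral>\<^sup>+x. liminf (\<lambda>k. ennreal ((norm (f n x - f (r k) x))\<^sup>2)) \<partial>M)"
    proof (rule nn_integral_cong_AE)
      show "AE x in M. ennreal ((norm (f n x - g x))\<^sup>2)
          = liminf (\<lambda>k. ennreal ((norm (f n x - f (r k) x))\<^sup>2))"
        using conv
      proof eventually_elim
        case (elim x)
        have "(\<lambda>k. ennreal ((norm (f n x - f (r k) x))\<^sup>2)) \<longlonglongrightarrow> ennreal ((norm (f n x - g x))\<^sup>2)"
          by (intro tendsto_intros elim tendsto_ennrealI)
        then show ?case
          by (metis lim_imp_Liminf trivial_limit_sequentially)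
      qed
    qed
    also have "\<dots> \<le> liminf (\<lambda>k. \<integral>\<^sup>+x. ennreal ((norm (f n x - f (r k) x))\<^sup>2) \<partial>M)"
      by (rule nn_integral_liminf) measurable
    also have "\<dots> \<le> limsup (\<lambda>k. \<integral>\<^sup>+x. ennreal ((norm (f n x - f (r k) x))\<^sup>2) \<partial>M)"
      by (rule Liminf_le_Limsup) simp
    also have "\<dots> \<le> ennreal e"
    proof (rule Limsup_bounded)
      show "\<forall>\<^sub>F k in sequentially. (\<integral>\<^sup>+x. ennreal ((norm (f n x - f (r k) x))\<^sup>2) \<partial>M) \<le> ennreal e"
        using eventually_ge_at_top[of "N e"]
      proof eventually_elim
        case (elim k)
        have "(\<integral>\<^sup>+x. ennreal ((norm (f n x - f (r k) x))\<^sup>2) \<partial>M)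
            = ennreal (l2sq M (\<lambda>x. f n x - f (r k) x))"
          unfolding l2sq_def
          using L2_integrable[OF L2_diff(1)[OF f f]] by (intro nn_integral_eq_integral) auto
        also have "\<dots> \<le> ennreal e"
          using elim r_ge[of k] that by (intro ennreal_leI N) auto
        finally show ?case .
      qed
    qed
    finally show ?thesis .
  qed
  \<comment> \<open>The Fatou bound makes f n - g square-integrable before g is known to be; g is
    then recovered as a difference.\<close>
  have L2d: "(\<lambda>x. f n x - g x) \<in> L2 M" if "n \<ge> N 1" for n
  proof -
    have "integrable M (\<lambda>x. (norm (f n x - g x))\<^sup>2)"
      using le_less_trans[OF fatou[OF _ that], of \<infinity>] by (intro integrableI_bounded) auto
    then show ?thesis by (simp add: L2_def)
  qed
  have "g \<in> L2 M"
    using L2_diff(1)[OF f[of "N 1"] L2d[of "N 1"]] by simp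
  moreover have "(\<lambda>k. l2sq M (\<lambda>x. f k x - g x)) \<longlonglongrightarrow> 0"
  proof (rule LIMSEQ_I)
    fix e :: real
    assume "0 < e"
    show "\<exists>no. \<forall>n\<ge>no. norm (l2sq M (\<lambda>x. f n x - g x) - 0) < e"
    proof (intro exI[of _ "N (e/2)"] allI impI)
      fix n
      assume n: "N (e/2) \<le> n"
      have "ennreal (l2sq M (\<lambda>x. f n x - g x)) = (\<integral>\<^sup>+x. ennreal ((norm (f n x - g x))\<^sup>2) \<partial>M)"
        unfolding l2sq_def
        using L2_integrable[OF L2_diff(1)[OF f \<open>g \<in> L2 M\<close>]]
        by (intro nn_integral_eq_integral[symmetric]) auto
      also have "\<dots> \<le> ennreal (e/2)"
        using \<open>0 < e\<close> n by (intro fatou) auto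
      finally show "norm (l2sq M (\<lambda>x. f n x - g x) - 0) < e"
        using \<open>0 < e\<close> by simp
    qed
  qed
  ultimately show ?thesis by (rule that)
qed

subsection \<open>Integrals of continuous paths\<close>

definition l2_continuous :: "(real^3) measure \<Rightarrow> real set \<Rightarrow> (real \<Rightarrow> field3) \<Rightarrow> bool" where
  "l2_continuous M I f \<longleftrightarrow> (\<forall>t\<in>I. f t \<in> L2 M) \<and>
     (\<forall>t\<in>I. ((\<lambda>\<tau>. l2sq M (\<lambda>x. f \<tau> x - f t x)) \<longlongrightarrow> 0) (at t within I))"

lemma l2_continuous_L2: "l2_continuous M I f \<Longrightarrow> t \<in> I \<Longrightarrow> f t \<in> L2 M"
  by (simp add: l2_continuous_def)

lemma l2_continuous_l2ip:
  assumes "l2_continuous M I f" "v \<in> L2 M"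
  shows "continuous_on I (\<lambda>t. l2ip M (f t) v)"
  unfolding continuous_on_def
proof
  fix t
  assume t: "t \<in> I"
  have "((\<lambda>\<tau>. l2ip M (f \<tau>) v - l2ip M (f t) v) \<longlongrightarrow> 0) (at t within I)"
  proof (rule Lim_null_comparison)
    show "\<forall>\<^sub>F \<tau> in at t within I. norm (l2ip M (f \<tau>) v - l2ip M (f t) v)
        \<le> sqrt (l2sq M (\<lambda>x. f \<tau> x - f t x)) * sqrt (l2sq M v)"
      unfolding eventually_at_filter
    proof (rule eventuallyI, intro impI)
      fix \<tau>
      assume "\<tau> \<in> I"
      then have L: "f \<tau> \<in> L2 M" "f t \<in> L2 M"
        using l2_continuous_L2[OF assms(1)] t by auto
      show "norm (l2ip M (f \<tau>) v - l2ip M (f t) v)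
          \<le> sqrt (l2sq M (\<lambda>x. f \<tau> x - f t x)) * sqrt (l2sq M v)"
        using cmod_l2ip_le[OF L2_diff(1)[OF L] assms(2)] by (simp only: l2ip_diff_left[OF L assms(2)])
    qed
    have "((\<lambda>\<tau>. sqrt (l2sq M (\<lambda>x. f \<tau> x - f t x)) * sqrt (l2sq M v)) \<longlongrightarrow> sqrt 0 * sqrt (l2sq M v))
        (at t within I)"
      using assms(1) t by (intro tendsto_intros) (simp add: l2_continuous_def)
    then show "((\<lambda>\<tau>. sqrt (l2sq M (\<lambda>x. f \<tau> x - f t x)) * sqrt (l2sq M v)) \<longlongrightarrow> 0) (at t within I)"
      by simp
  qed
  then show "((\<lambda>t. l2ip M (f t) v) \<longlongrightarrow> l2ip M (f t) v) (at t within I)"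
    by (simp add: LIM_zero_iff)
qed

lemma l2_continuous_scale:
  assumes "continuous_on I c" "l2_continuous M I f"
  shows "l2_continuous M I (\<lambda>t x. c t *s f t x)"
  unfolding l2_continuous_def
proof (intro conjI ballI)
  fix t
  assume t: "t \<in> I"
  show "(\<lambda>x. c t *s f t x) \<in> L2 M"
    by (intro L2_scale l2_continuous_L2[OF assms(2) t])
  have ct: "(c \<longlongrightarrow> c t) (at t within I)"
    using assms(1) t by (simp add: continuous_on_def)
  show "((\<lambda>\<tau>. l2sq M (\<lambda>x. c \<tau> *s f \<tau> x - c t *s f t x)) \<longlongrightarrow> 0) (at t within I)"
  proof (rule Lim_null_comparison)
    show "\<forall>\<^sub>F \<tau> in at t within I. norm (l2sq M (\<lambda>x. c \<tau> *s f \<tau> x - c t *s f t x))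
        \<le> 2 * ((cmod (c \<tau>))\<^sup>2 * l2sq M (\<lambda>x. f \<tau> x - f t x)) + 2 * ((cmod (c \<tau> - c t))\<^sup>2 * l2sq M (f t))"
      unfolding eventually_at_filter
    proof (rule eventuallyI, intro impI)
      fix \<tau>
      assume "\<tau> \<in> I"
      have eq: "c \<tau> *s f \<tau> x - c t *s f t x = c \<tau> *s (f \<tau> x - f t x) + (c \<tau> - c t) *s f t x" for x
        by (simp add: vec_eq_iff algebra_simps)
      have L: "f t \<in> L2 M" "(\<lambda>x. f \<tau> x - f t x) \<in> L2 M"
        using l2_continuous_L2[OF assms(2)] t \<open>\<tau> \<in> I\<close> by (auto intro: L2_diff)
      show "norm (l2sq M (\<lambda>x. c \<tau> *s f \<tau> x - c t *s f t x))
        \<le> 2 * ((cmod (c \<tau>))\<^sup>2 * l2sq M (\<lambda>x. f \<tau> x - f t x)) + 2 * ((cmod (c \<tau> - c t))\<^sup>2 * l2sq M (f t))"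
        unfolding eq L2_scale(2)[OF L(1), symmetric] L2_scale(2)[OF L(2), symmetric]
          real_norm_def abs_of_nonneg[OF l2sq_nonneg]
        by (rule L2_add(2)[OF L2_scale(1)[OF L(2)] L2_scale(1)[OF L(1)]])
    qed
    have "((\<lambda>\<tau>. 2 * ((cmod (c \<tau>))\<^sup>2 * l2sq M (\<lambda>x. f \<tau> x - f t x)) + 2 * ((cmod (c \<tau> - c t))\<^sup>2 * l2sq M (f t)))
       \<longlongrightarrow> 2 * ((cmod (c t))\<^sup>2 * 0) + 2 * ((cmod (c t - c t))\<^sup>2 * l2sq M (f t))) (at t within I)"
      using assms(2) t by (intro tendsto_intros ct) (simp add: l2_continuous_def)
    then show "((\<lambda>\<tau>. 2 * ((cmod (c \<tau>))\<^sup>2 * l2sq M (\<lambda>x. f \<tau> x - f t x)) + 2 * ((cmod (c \<tau> - c t))\<^sup>2 * l2sq M (f t)))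
       \<longlongrightarrow> 0) (at t within I)"
      by simp
  qed
qed

text \<open>Curls and traces of a path multiplied by a scalar function are chosen anew at each time,
  so they agree with the multiplied curls and traces only almost everywhere; continuity has to
  survive this.\<close>

lemma l2_continuous_cong_AE:
  assumes "l2_continuous M I g" "\<And>t. t \<in> I \<Longrightarrow> f t \<in> L2 M" "\<And>t. t \<in> I \<Longrightarrow> AE x in M. f t x = g t x"
  shows "l2_continuous M I f"
  unfolding l2_continuous_def
proof (intro conjI ballI assms(2))
  fix t assume t: "t \<in> I"
  have "((\<lambda>\<tau>. l2sq M (\<lambda>x. g \<tau> x - g t x)) \<longlongrightarrow> 0) (at t within I)"
    using assms(1) t by (simp add: l2_continuous_def)
  moreover have "\<forall>\<^sub>F \<tau> in at t within I. l2sq M (\<lambda>x. g \<tau> x - g t x) = l2sq M (\<lambda>x. f \<tau> x - f t x)"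
    unfolding eventually_at_filter
  proof (rule eventuallyI, intro impI)
    fix \<tau> assume \<tau>: "\<tau> \<in> I"
    show "l2sq M (\<lambda>x. g \<tau> x - g t x) = l2sq M (\<lambda>x. f \<tau> x - f t x)"
    proof (rule l2sq_cong_AE)
      show "AE x in M. g \<tau> x - g t x = f \<tau> x - f t x"
        using assms(3)[OF t] assms(3)[OF \<tau>] by eventually_elim simp
    qed (use t \<tau> assms(2) l2_continuous_L2[OF assms(1)] in \<open>auto intro: L2_diff\<close>)
  qed
  ultimately show "((\<lambda>\<tau>. l2sq M (\<lambda>x. f \<tau> x - f t x)) \<longlongrightarrow> 0) (at t within I)"
    by (rule Lim_transform_eventually)
qed

definition riemann_sum :: "(real \<Rightarrow> field3) \<Rightarrow> (real \<times> real set) set \<Rightarrow> field3" where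
  "riemann_sum f p = (\<lambda>x. \<Sum>(t, K)\<in>p. of_real (measure lborel K) *s f t x)"

lemma riemann_sum_L2:
  assumes "p tagged_division_of {a..b}" "\<And>t. t \<in> {a..b} \<Longrightarrow> f t \<in> L2 M"
  shows "riemann_sum f p \<in> L2 M"
  unfolding riemann_sum_def case_prod_beta
proof (rule L2_sum)
  show "finite p"
    using assms(1) by blast
  fix i assume "i \<in> p"
  then show "(\<lambda>x. of_real (measure lborel (snd i)) *s f (fst i) x) \<in> L2 M"
    using tagged_division_ofD(2,3)[OF assms(1), of "fst i" "snd i"]
    by (intro L2_scale assms(2)) auto
qed

text \<open>The error against the scalar integrals is controlled by the oscillation on the pieces,
  uniformly in \<open>v\<close>; testing with \<open>v\<close> equal to a difference then gives norm estimates.\<close>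

lemma riemann_sum_close:
  assumes "a \<le> b" and p: "p tagged_division_of {a..b}" and f: "l2_continuous M {a..b} f"
    and osc: "\<And>t K \<tau>. \<lbrakk>(t, K) \<in> p; \<tau> \<in> K\<rbrakk> \<Longrightarrow> l2sq M (\<lambda>x. f \<tau> x - f t x) \<le> e"
    and "0 \<le> e" and v: "v \<in> L2 M"
  shows "cmod (l2ip M (riemann_sum f p) v - integral {a..b} (\<lambda>t. l2ip M (f t) v))
    \<le> (b - a) * (sqrt e * sqrt (l2sq M v))"
proof -
  define \<phi> where "\<phi> t = l2ip M (f t) v" for t
  have fL: "f t \<in> L2 M" if "t \<in> {a..b}" for t
    using l2_continuous_L2[OF f that] .
  have cont: "continuous_on {a..b} \<phi>"
    unfolding \<phi>_def by (rule l2_continuous_l2ip[OF f v])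
  have p': "p tagged_division_of cbox a b"
    using p by simp
  have fin: "finite p"
    using p by blast
  have "l2ip M (riemann_sum f p) v = (\<Sum>i\<in>p. l2ip M (\<lambda>x. of_real (measure lborel (snd i)) *s f (fst i) x) v)"
    unfolding riemann_sum_def case_prod_beta
  proof (rule l2ip_sum_left[OF fin _ v])
    fix i assume "i \<in> p"
    then show "(\<lambda>x. of_real (measure lborel (snd i)) *s f (fst i) x) \<in> L2 M"
      using tagged_division_ofD(2,3)[OF p, of "fst i" "snd i"] by (intro L2_scale fL) auto
  qed
  then have S: "l2ip M (riemann_sum f p) v = (\<Sum>(t, K)\<in>p. measure lborel K *\<^sub>R \<phi> t)"
    by (simp add: l2ip_scale_left \<phi>_def case_prod_beta scaleR_conv_of_real)
  \<comment> \<open>Splitting the integral along the division reduces the claim to single pieces,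
    each bounded by its length times the oscillation.\<close>
  have I: "integral {a..b} \<phi> = (\<Sum>(t, K)\<in>p. integral K \<phi>)"
    using integral_combine_tagged_division_topdown[OF _ p', of \<phi>] cont
    by (simp add: integrable_continuous_interval)
  have piece: "norm (measure lborel K *\<^sub>R \<phi> t - integral K \<phi>)
      \<le> measure lborel K * (sqrt e * sqrt (l2sq M v))" if tK: "(t, K) \<in> p" for t K
  proof -
    obtain c d where K: "K = cbox c d" and sub: "K \<subseteq> {a..b}" and "t \<in> K"
      using tagged_division_ofD(2,3,4)[OF p tK] by auto
    have int: "(\<lambda>\<tau>. \<phi> t - \<phi> \<tau>) integrable_on cbox c d"
      using cont sub K
      by (intro integrable_continuous continuous_intros) (auto intro: continuous_on_subset)
    have bound: "norm (\<phi> t - \<phi> \<tau>) \<le> sqrt e * sqrt (l2sq M v)" if "\<tau> \<in> cbox c d" for \<tau>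
    proof -
      have "\<tau> \<in> {a..b}" "t \<in> {a..b}"
        using that K sub \<open>t \<in> K\<close> by auto
      then have "\<phi> \<tau> - \<phi> t = l2ip M (\<lambda>x. f \<tau> x - f t x) v"
        and "cmod (l2ip M (\<lambda>x. f \<tau> x - f t x) v) \<le> sqrt (l2sq M (\<lambda>x. f \<tau> x - f t x)) * sqrt (l2sq M v)"
        using cmod_l2ip_le[OF L2_diff(1)[OF fL[of \<tau>] fL[of t]] v]
        by (simp_all add: \<phi>_def l2ip_diff_left fL v)
      moreover have "sqrt (l2sq M (\<lambda>x. f \<tau> x - f t x)) * sqrt (l2sq M v) \<le> sqrt e * sqrt (l2sq M v)"
        using osc[OF tK, of \<tau>] that K by (intro mult_right_mono) auto
      ultimately show ?thesis
        by (metis norm_minus_commute order_trans)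
    qed
    have "integral (cbox c d) (\<lambda>\<tau>. \<phi> t - \<phi> \<tau>) = measure lborel K *\<^sub>R \<phi> t - integral K \<phi>"
      using cont sub K
      by (subst Henstock_Kurzweil_Integration.integral_diff)
        (auto intro!: integrable_continuous_interval continuous_on_subset[OF cont])
    then show ?thesis
      using integrable_bound[OF _ int bound] \<open>0 \<le> e\<close>
      by (simp add: K mult.commute del: content_cbox_if content_real_if)
  qed
  have "cmod (l2ip M (riemann_sum f p) v - integral {a..b} \<phi>)
      = norm (\<Sum>(t, K)\<in>p. measure lborel K *\<^sub>R \<phi> t - integral K \<phi>)"
    unfolding S I by (simp add: sum_subtractf case_prod_beta)
  also have "\<dots> \<le> (\<Sum>(t, K)\<in>p. measure lborel K * (sqrt e * sqrt (l2sq M v)))"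
    by (rule sum_norm_le) (use piece in auto)
  also have "\<dots> = (\<Sum>(t, K)\<in>p. measure lborel K) * (sqrt e * sqrt (l2sq M v))"
    by (simp add: sum_distrib_right case_prod_beta)
  also have "(\<Sum>(t, K)\<in>p. measure lborel K) = b - a"
    using additive_content_tagged_division[OF p'] \<open>a \<le> b\<close> by (simp add: case_prod_beta)
  finally show ?thesis
    unfolding \<phi>_def .
qed

text \<open>Testing with a difference w yields |w|^2 \<le> C |w|; here \<open>w\<close> stands for
  the squared norm, and one factor is cancelled.\<close>

lemma sqrt_bound_aux:
  fixes w :: real
  assumes "0 \<le> w" "w \<le> C * sqrt w" "0 \<le> C"
  shows "w \<le> C\<^sup>2"
proof (cases "w = 0")
  case False
  then have "sqrt w * sqrt w \<le> C * sqrt w"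
    using assms by simp
  then have "sqrt w \<le> C"
    using False assms(1) by (intro mult_right_le_imp_le[of "sqrt w" "sqrt w" C]) auto
  then show ?thesis
    using assms(1) sqrt_le_D by blast
qed (use assms in simp)

text \<open>Riemann sums differ from the scalar integrals by an error proportional to the norm of
  the test field. Inserting the difference of two sums as the test field makes them Cauchy, and
  inserting their difference from the limit \<open>G\<close> gives convergence in norm. The weak
  conclusion carries linear identities through the integral, while the norm conclusion matches
  \<open>has_em_integral\<close>.\<close>

theorem l2_path_integral:
  assumes "a \<le> b" and f: "l2_continuous M {a..b} f"
  obtains G where "G \<in> L2 M"
    "\<And>v. v \<in> L2 M \<Longrightarrow> ((\<lambda>t. l2ip M (f t) v) has_integral l2ip M G v) {a..b}"
    "\<And>e. e > 0 \<Longrightarrow> \<exists>\<gamma>. gauge \<gamma> \<and> (\<forall>p. p tagged_division_of {a..b} \<and> \<gamma> fine p \<longrightarrow>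
        l2sq M (\<lambda>x. riemann_sum f p x - G x) \<le> e)"
proof -
  have fL: "f t \<in> L2 M" if "t \<in> {a..b}" for t
    using l2_continuous_L2[OF f that] .
  have "\<exists>d>0. \<forall>\<tau>\<in>{a..b} \<inter> ball t d. l2sq M (\<lambda>x. f \<tau> x - f t x) \<le> e"
    if "e > 0" "t \<in> {a..b}" for e t
  proof -
    have "\<forall>\<^sub>F \<tau> in at t within {a..b}. l2sq M (\<lambda>x. f \<tau> x - f t x) < e"
      using f that unfolding l2_continuous_def by (intro order_tendstoD(2)[where y = 0]) auto
    then obtain d where "d > 0" and d: "\<And>\<tau>. \<lbrakk>\<tau> \<in> {a..b}; \<tau> \<noteq> t; dist \<tau> t < d\<rbrakk> \<Longrightarrow> l2sq M (\<lambda>x. f \<tau> x - f t x) < e"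
      unfolding eventually_at by auto
    show ?thesis
    proof (intro exI[of _ d] conjI ballI)
      fix \<tau> assume \<tau>: "\<tau> \<in> {a..b} \<inter> ball t d"
      show "l2sq M (\<lambda>x. f \<tau> x - f t x) \<le> e"
      proof (cases "\<tau> = t")
        case True
        then show ?thesis using \<open>e > 0\<close> by (simp add: l2sq_def)
      next
        case False
        then show ?thesis
          using d[of \<tau>] \<tau> by (simp add: dist_commute)
      qed
    qed fact
  qed
  \<comment> \<open>The guarded predicate is satisfiable for all arguments, so one choice function
    \<delta> serves every tolerance and every tag.\<close>
  moreover define Q where "Q e t d \<longleftrightarrow> (e > 0 \<and> t \<in> {a..b} \<longrightarrow>
      d > 0 \<and> (\<forall>\<tau>\<in>{a..b} \<inter> ball t d. l2sq M (\<lambda>x. f \<tau> x - f t x) \<le> e))" for e t d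
  ultimately have "\<exists>d. Q e t d" for e t
    by blast
  then obtain \<delta> where "\<And>e t. Q e t (\<delta> e t)"
    by metis
  then have \<delta>: "\<And>e t. \<lbrakk>e > 0; t \<in> {a..b}\<rbrakk> \<Longrightarrow> \<delta> e t > 0"
    "\<And>e t \<tau>. \<lbrakk>e > 0; t \<in> {a..b}; \<tau> \<in> {a..b} \<inter> ball t (\<delta> e t)\<rbrakk> \<Longrightarrow> l2sq M (\<lambda>x. f \<tau> x - f t x) \<le> e"
    unfolding Q_def by blast+
  define \<gamma> where "\<gamma> e t = (if t \<in> {a..b} then ball t (\<delta> e t) else UNIV)" for e t
  have gauge: "gauge (\<gamma> e)" if "e > 0" for e
    unfolding gauge_def \<gamma>_def using \<delta>(1) that by auto
  have osc: "l2sq M (\<lambda>x. f \<tau> x - f t x) \<le> e"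
    if "e > 0" "p tagged_division_of {a..b}" "\<gamma> e fine p" "(t, K) \<in> p" "\<tau> \<in> K" for e p t K \<tau>
  proof -
    have "t \<in> {a..b}" "\<tau> \<in> {a..b}"
      using tagged_division_ofD(2,3)[OF that(2,4)] that(5) by auto
    moreover have "K \<subseteq> \<gamma> e t"
      using fineD[OF that(3,4)] .
    ultimately show ?thesis
      using \<delta>(2)[OF \<open>e > 0\<close>, of t \<tau>] that(5) by (auto simp: \<gamma>_def)
  qed
  define I where "I v = integral {a..b} (\<lambda>t. l2ip M (f t) v)" for v
  have close: "cmod (l2ip M (riemann_sum f p) v - I v) \<le> (b - a) * (sqrt e * sqrt (l2sq M v))"
    if "e > 0" "p tagged_division_of {a..b}" "\<gamma> e fine p" "v \<in> L2 M" for e p v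
    unfolding I_def using \<open>a \<le> b\<close> that osc by (intro riemann_sum_close f) auto
  define \<epsilon> where "\<epsilon> k = 1 / real (Suc k)" for k
  have \<epsilon>_pos: "\<epsilon> k > 0" for k
    by (simp add: \<epsilon>_def)
  have \<epsilon>_lim: "\<epsilon> \<longlonglongrightarrow> 0"
    using LIMSEQ_Suc[OF lim_1_over_n[where 'a = real]] by (simp only: \<epsilon>_def[abs_def])
  have "\<exists>p. p tagged_division_of {a..b} \<and> \<gamma> (\<epsilon> k) fine p" for k
    by (rule fine_division_exists_real[OF gauge[OF \<epsilon>_pos[of k]], of a b]) (rule exI, rule conjI)
  then obtain P where P: "\<And>k. P k tagged_division_of {a..b}" "\<And>k. \<gamma> (\<epsilon> k) fine P k"
    by metis
  define S where "S k = riemann_sum f (P k)" for k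
  have SL: "S k \<in> L2 M" for k
    unfolding S_def by (rule riemann_sum_L2[OF P(1) fL])
  have S_close: "cmod (l2ip M (S k) v - I v) \<le> (b - a) * (sqrt (\<epsilon> k) * sqrt (l2sq M v))" if "v \<in> L2 M" for k v
    unfolding S_def by (rule close[OF \<epsilon>_pos P that])
  have diff: "l2sq M (\<lambda>x. S m x - S n x) \<le> ((b - a) * (sqrt (\<epsilon> m) + sqrt (\<epsilon> n)))\<^sup>2" for m n
  proof -
    \<comment> \<open>Testing with the difference itself turns the uniform weak estimate into a
      bound of its squared norm by a multiple of its norm.\<close>
    define w where "w = (\<lambda>x. S m x - S n x)"
    have w: "w \<in> L2 M"
      unfolding w_def by (rule L2_diff(1)[OF SL SL])
    have "of_real (l2sq M w) = l2ip M (S m) w - l2ip M (S n) w"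
      unfolding l2ip_self[symmetric] using l2ip_diff_left[OF SL SL w, of m n] by (simp add: w_def)
    then have "l2sq M w = cmod ((l2ip M (S m) w - I w) - (l2ip M (S n) w - I w))"
      by (metis abs_of_nonneg diff_diff_eq2 diff_add_cancel l2sq_nonneg norm_of_real)
    also have "\<dots> \<le> cmod (l2ip M (S m) w - I w) + cmod (l2ip M (S n) w - I w)"
      by (rule norm_triangle_ineq4)
    also have "\<dots> \<le> (b - a) * (sqrt (\<epsilon> m) * sqrt (l2sq M w)) + (b - a) * (sqrt (\<epsilon> n) * sqrt (l2sq M w))"
      by (intro add_mono S_close w)
    also have "\<dots> = (b - a) * (sqrt (\<epsilon> m) + sqrt (\<epsilon> n)) * sqrt (l2sq M w)"
      by (simp add: algebra_simps)
    finally have "l2sq M w \<le> ((b - a) * (sqrt (\<epsilon> m) + sqrt (\<epsilon> n)))\<^sup>2"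
      using \<open>a \<le> b\<close> \<epsilon>_pos by (intro sqrt_bound_aux) (auto intro!: mult_nonneg_nonneg add_nonneg_nonneg simp: less_imp_le)
    then show ?thesis
      by (simp add: w_def)
  qed
  obtain G where G: "G \<in> L2 M" and lim: "(\<lambda>k. l2sq M (\<lambda>x. S k x - G x)) \<longlonglongrightarrow> 0"
  proof (rule L2_complete[OF SL])
    fix e :: real
    assume "e > 0"
    have "(\<lambda>k. ((b - a) * (2 * sqrt (\<epsilon> k)))\<^sup>2) \<longlonglongrightarrow> ((b - a) * (2 * sqrt 0))\<^sup>2"
      by (intro tendsto_intros \<epsilon>_lim)
    then have "\<forall>\<^sub>F k in sequentially. ((b - a) * (2 * sqrt (\<epsilon> k)))\<^sup>2 < e"
      using \<open>e > 0\<close> by (intro order_tendstoD(2)) auto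
    then obtain N where N: "((b - a) * (2 * sqrt (\<epsilon> N)))\<^sup>2 < e"
      by (meson eventually_sequentially order_refl)
    have mono: "sqrt (\<epsilon> m) \<le> sqrt (\<epsilon> N)" if "m \<ge> N" for m
      using that by (simp add: \<epsilon>_def field_simps)
    show "\<exists>N. \<forall>m\<ge>N. \<forall>n\<ge>N. l2sq M (\<lambda>x. S m x - S n x) \<le> e"
    proof (intro exI[of _ N] allI impI)
      fix m n assume mn: "N \<le> m" "N \<le> n"
      have "l2sq M (\<lambda>x. S m x - S n x) \<le> ((b - a) * (sqrt (\<epsilon> m) + sqrt (\<epsilon> n)))\<^sup>2"
        by (rule diff)
      also have "\<dots> \<le> ((b - a) * (2 * sqrt (\<epsilon> N)))\<^sup>2"
      proof (intro power_mono mult_left_mono mult_nonneg_nonneg add_nonneg_nonneg)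
        show "sqrt (\<epsilon> m) + sqrt (\<epsilon> n) \<le> 2 * sqrt (\<epsilon> N)"
          using mono[OF mn(1)] mono[OF mn(2)] by linarith
      qed (use \<open>a \<le> b\<close> \<epsilon>_pos[of m] \<epsilon>_pos[of n] in auto)
      finally show "l2sq M (\<lambda>x. S m x - S n x) \<le> e"
        using N by simp
    qed
  qed blast
  have GI: "l2ip M G v = I v" if v: "v \<in> L2 M" for v
  proof -
    have "(\<lambda>k. l2ip M (S k) v) \<longlonglongrightarrow> I v"
    proof (rule LIM_zero_cancel, rule Lim_null_comparison)
      show "\<forall>\<^sub>F k in sequentially. norm (l2ip M (S k) v - I v) \<le> (b - a) * (sqrt (\<epsilon> k) * sqrt (l2sq M v))"
        using S_close[OF v] by simp
      have "(\<lambda>k. (b - a) * (sqrt (\<epsilon> k) * sqrt (l2sq M v))) \<longlonglongrightarrow> (b - a) * (sqrt 0 * sqrt (l2sq M v))"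
        by (intro tendsto_intros \<epsilon>_lim)
      then show "(\<lambda>k. (b - a) * (sqrt (\<epsilon> k) * sqrt (l2sq M v))) \<longlonglongrightarrow> 0"
        by simp
    qed
    moreover have "(\<lambda>k. l2ip M (S k) v) \<longlonglongrightarrow> l2ip M G v"
    proof (rule LIM_zero_cancel, rule Lim_null_comparison)
      show "\<forall>\<^sub>F k in sequentially. norm (l2ip M (S k) v - l2ip M G v) \<le> sqrt (l2sq M (\<lambda>x. S k x - G x)) * sqrt (l2sq M v)"
        using cmod_l2ip_le[OF L2_diff(1)[OF SL G] v] by (simp add: l2ip_diff_left SL G v)
      have "(\<lambda>k. sqrt (l2sq M (\<lambda>x. S k x - G x)) * sqrt (l2sq M v)) \<longlonglongrightarrow> sqrt 0 * sqrt (l2sq M v)"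
        by (intro tendsto_intros lim)
      then show "(\<lambda>k. sqrt (l2sq M (\<lambda>x. S k x - G x)) * sqrt (l2sq M v)) \<longlonglongrightarrow> 0"
        by simp
    qed
    ultimately show ?thesis
      by (rule LIMSEQ_unique[symmetric])
  qed
  show ?thesis
  proof (rule that[OF G])
    fix v assume v: "v \<in> L2 M"
    show "((\<lambda>t. l2ip M (f t) v) has_integral l2ip M G v) {a..b}"
      unfolding GI[OF v] I_def
      by (intro integrable_integral integrable_continuous_interval l2_continuous_l2ip f v)
  next
    fix e :: real
    assume "e > 0"
    \<comment> \<open>The summand 1 keeps the denominator positive when a = b.\<close>
    define e' where "e' = e / (b - a + 1)\<^sup>2"
    have "e' > 0"
      using \<open>e > 0\<close> \<open>a \<le> b\<close> by (simp add: e'_def)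
    show "\<exists>\<gamma>. gauge \<gamma> \<and> (\<forall>p. p tagged_division_of {a..b} \<and> \<gamma> fine p \<longrightarrow>
        l2sq M (\<lambda>x. riemann_sum f p x - G x) \<le> e)"
    proof (intro exI[of _ "\<gamma> e'"] conjI allI impI)
      show "gauge (\<gamma> e')"
        by (rule gauge) fact
      fix p
      assume p: "p tagged_division_of {a..b} \<and> \<gamma> e' fine p"
      define w where "w = (\<lambda>x. riemann_sum f p x - G x)"
      have R: "riemann_sum f p \<in> L2 M"
        using p fL by (intro riemann_sum_L2) auto
      have w: "w \<in> L2 M"
        unfolding w_def by (rule L2_diff(1)[OF R G])
      have "of_real (l2sq M w) = l2ip M (riemann_sum f p) w - l2ip M G w"
        unfolding l2ip_self[symmetric] using l2ip_diff_left[OF R G w] by (simp add: w_def)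
      then have "l2sq M w = cmod (l2ip M (riemann_sum f p) w - I w)"
        unfolding GI[OF w] by (metis abs_of_nonneg l2sq_nonneg norm_of_real)
      also have "\<dots> \<le> ((b - a) * sqrt e') * sqrt (l2sq M w)"
        using close[OF \<open>e' > 0\<close> _ _ w] p by (simp add: mult.assoc)
      finally have "l2sq M w \<le> ((b - a) * sqrt e')\<^sup>2"
        using \<open>a \<le> b\<close> \<open>e' > 0\<close> by (intro sqrt_bound_aux) auto
      also have "\<dots> = (b - a)\<^sup>2 * e'"
        using \<open>e' > 0\<close> by (simp add: power_mult_distrib)
      also have "\<dots> \<le> (b - a + 1)\<^sup>2 * e'"
        using \<open>a \<le> b\<close> \<open>e' > 0\<close> by (intro mult_right_mono power_mono) auto
      also have "\<dots> = e"
        using \<open>a \<le> b\<close> by (simp add: e'_def)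
      finally show "l2sq M (\<lambda>x. riemann_sum f p x - G x) \<le> e"
        by (simp add: w_def)
    qed
  qed
qed

section \<open>Smooth bump functions\<close>

text \<open>The derivatives of e^(-1/t) are combinations of the quotients e^(-1/t)/t^m, so the
  exponent m makes the family closed under differentiation up to linear combinations.\<close>

definition exp_cutoff :: "nat \<Rightarrow> real \<Rightarrow> real" where
  "exp_cutoff m t = (if 0 < t then exp (- (1 / t)) / t ^ m else 0)"

text \<open>The substitution s = 1/t turns the limit from the right into that of s^m / e^s at
  infinity.\<close>

lemma exp_cutoff_tendsto_0: "(exp_cutoff m \<longlongrightarrow> 0) (at 0)"
proof (rule filterlim_split_at)
  show "(exp_cutoff m \<longlongrightarrow> 0) (at_left 0)"
    by (rule tendsto_eventually) (auto simp: exp_cutoff_def eventually_at_filter)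
  have "((\<lambda>t. inverse t ^ m / exp (inverse t)) \<longlongrightarrow> (0::real)) (at_right 0)"
    by (rule filterlim_compose[OF tendsto_power_div_exp_0 filterlim_inverse_at_top_right])
  moreover have "\<forall>\<^sub>F t in at_right 0. inverse t ^ m / exp (inverse t) = exp_cutoff m t"
    by (auto simp: eventually_at_filter exp_cutoff_def exp_minus field_simps)
  ultimately show "(exp_cutoff m \<longlongrightarrow> 0) (at_right 0)"
    by (rule Lim_transform_eventually)
qed

lemma exp_cutoff_deriv:
  "(exp_cutoff m has_real_derivative (exp_cutoff (m + 2) t - real m * exp_cutoff (Suc m) t)) (at t)"
proof -
  consider "t < 0" | "t = 0" | "0 < t" by linarith
  then show ?thesis
  proof cases
    case 1
    have "((\<lambda>_. 0) has_real_derivative 0) (at t)"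
      by simp
    then have "(exp_cutoff m has_real_derivative 0) (at t)"
      by (rule has_field_derivative_transform_within_open[where S = "{..<0}"])
        (use 1 in \<open>auto simp: exp_cutoff_def\<close>)
    with 1 show ?thesis by (simp add: exp_cutoff_def)
  next
    case 2
    \<comment> \<open>At the origin the difference quotient is literally the next member of the
      family, so differentiability reduces to the limit at 0.\<close>
    have "(\<lambda>h. (exp_cutoff m (0 + h) - exp_cutoff m 0) / h) = exp_cutoff (Suc m)"
      by (auto simp: exp_cutoff_def fun_eq_iff)
    then have "(exp_cutoff m has_real_derivative 0) (at 0)"
      unfolding has_field_derivative_def DERIV_def using exp_cutoff_tendsto_0[of "Suc m"]
      by (simp add: DERIV_def flip: has_field_derivative_def)
    with 2 show ?thesis by (simp add: exp_cutoff_def)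
  next
    case 3
    have eq: "(exp (- (1 / t)) * (1 / t\<^sup>2) * t ^ m - exp (- (1 / t)) * (real m * t ^ (m - 1))) / (t ^ m * t ^ m)
        = exp (- (1 / t)) / t ^ (m + 2) - real m * (exp (- (1 / t)) / t ^ Suc m)"
      using 3 by (cases m) (auto simp: field_simps power2_eq_square)
    have "((\<lambda>t. exp (- (1 / t)) / t ^ m) has_real_derivative
        (exp (- (1 / t)) * (1 / t\<^sup>2) * t ^ m - exp (- (1 / t)) * (real m * t ^ (m - 1))) / (t ^ m * t ^ m)) (at t)"
      using 3 by (auto intro!: derivative_eq_intros simp: power2_eq_square)
    then have "(exp_cutoff m has_real_derivative
        (exp (- (1 / t)) / t ^ (m + 2) - real m * (exp (- (1 / t)) / t ^ Suc m))) (at t)"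
      unfolding eq
      by (rule has_field_derivative_transform_within_open[where S = "{0<..}"])
        (use 3 in \<open>auto simp: exp_cutoff_def\<close>)
    with 3 show ?thesis by (simp add: exp_cutoff_def)
  qed
qed

lemma exp_cutoff_0_bounds: "0 \<le> exp_cutoff 0 t" "exp_cutoff 0 t \<le> 1"
  by (simp_all add: exp_cutoff_def)

text \<open>An algebra of functions closed under directional derivatives, hence consisting of smooth
  functions.\<close>

inductive smooth_fun :: "(real^3 \<Rightarrow> real) \<Rightarrow> bool" where
  const: "smooth_fun (\<lambda>x. c)"
| cutoff: "smooth_fun (\<lambda>x. exp_cutoff m (x \<bullet> u + c))"
| add: "smooth_fun f \<Longrightarrow> smooth_fun g \<Longrightarrow> smooth_fun (\<lambda>x. f x + g x)"
| mult: "smooth_fun f \<Longrightarrow> smooth_fun g \<Longrightarrow> smooth_fun (\<lambda>x. f x * g x)"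

lemma smooth_fun_prod:
  "finite I \<Longrightarrow> (\<And>i. i \<in> I \<Longrightarrow> smooth_fun (f i)) \<Longrightarrow> smooth_fun (\<lambda>x. \<Prod>i\<in>I. f i x)"
  by (induction I rule: finite_induct) (auto intro: smooth_fun.intros)

lemma smooth_fun_derivative:
  assumes "smooth_fun f"
  shows "\<exists>f'. (\<forall>x. (f has_derivative f' x) (at x)) \<and> (\<forall>h. smooth_fun (\<lambda>x. f' x h))"
  using assms
proof induction
  case (const c)
  show ?case
    by (rule exI[of _ "\<lambda>_ _. 0"]) (auto intro: smooth_fun.intros)
next
  case (cutoff m u c)
  define f' where "f' x h = (exp_cutoff (m + 2) (x \<bullet> u + c) + (- real m) * exp_cutoff (Suc m) (x \<bullet> u + c)) * (h \<bullet> u)" for x h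
  have "((\<lambda>x. exp_cutoff m (x \<bullet> u + c)) has_derivative f' x) (at x)" for x
  proof -
    have "((\<lambda>x. x \<bullet> u + c) has_derivative (\<lambda>h. h \<bullet> u)) (at x)"
      by (auto intro!: derivative_eq_intros)
    from DERIV_compose_FDERIV[OF exp_cutoff_deriv this] show ?thesis
      by (simp add: f'_def[abs_def] mult.commute)
  qed
  moreover have "smooth_fun (\<lambda>x. f' x h)" for h
    unfolding f'_def by (intro smooth_fun.intros)
  ultimately show ?case by blast
next
  case (add f g)
  then obtain f' g' where d: "\<And>x. (f has_derivative f' x) (at x)" "\<And>h. smooth_fun (\<lambda>x. f' x h)"
    "\<And>x. (g has_derivative g' x) (at x)" "\<And>h. smooth_fun (\<lambda>x. g' x h)"
    by blast
  show ?case
    by (rule exI[of _ "\<lambda>x h. f' x h + g' x h"]) (auto intro: d smooth_fun.intros has_derivative_add)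
next
  case (mult f g)
  then obtain f' g' where d: "\<And>x. (f has_derivative f' x) (at x)" "\<And>h. smooth_fun (\<lambda>x. f' x h)"
    "\<And>x. (g has_derivative g' x) (at x)" "\<And>h. smooth_fun (\<lambda>x. g' x h)"
    by blast
  show ?case
    by (rule exI[of _ "\<lambda>x h. f x * g' x h + f' x h * g x"])
      (intro conjI allI smooth_fun.intros has_derivative_mult d mult.hyps)
qed

lemma smooth_fun_continuous:
  assumes "smooth_fun f"
  shows "continuous_on UNIV f"
proof -
  obtain f' where "\<And>x. (f has_derivative f' x) (at x)"
    using smooth_fun_derivative[OF assms] by blast
  then show ?thesis
    by (intro continuous_at_imp_continuous_on ballI has_derivative_continuous)
qed

lemma smooth_fun_Ck: "smooth_fun f \<Longrightarrow> Ck k (\<lambda>x. f x *\<^sub>R e)"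
proof (induction k arbitrary: f)
  case 0
  then show ?case
    by (auto intro!: continuous_intros smooth_fun_continuous)
next
  case (Suc k)
  obtain f' where f': "\<And>x. (f has_derivative f' x) (at x)" "\<And>h. smooth_fun (\<lambda>x. f' x h)"
    using smooth_fun_derivative[OF Suc.prems] by blast
  have "((\<lambda>x. f x *\<^sub>R e) has_derivative (\<lambda>h. f' x h *\<^sub>R e)) (at x)" for x
    by (rule has_derivative_scaleR_left[OF f'(1)])
  then show ?case
    using Suc.IH[OF f'(2)] by (auto intro!: exI[of _ "\<lambda>x h. f' x h *\<^sub>R e"])
qed

text \<open>For positive n the shift by 1 keeps the support at distance 1/n from the faces of the
  box. The factor n drives every cutoff argument to infinity inside the box, so the products tend to
  its indicator.\<close>

definition box_bump :: "nat \<Rightarrow> real^3 \<Rightarrow> real^3 \<Rightarrow> real^3 \<Rightarrow> real" where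
  "box_bump n a b x = (\<Prod>i\<in>UNIV. exp_cutoff 0 (real n * (x $ i - a $ i) - 1) * exp_cutoff 0 (real n * (b $ i - x $ i) - 1))"

lemma smooth_box_bump: "smooth_fun (box_bump n a b)"
proof -
  have 1: "smooth_fun (\<lambda>x. exp_cutoff 0 (real n * (x $ i - a $ i) - 1))" for i
    using smooth_fun.cutoff[of 0 "real n *\<^sub>R axis i 1" "- real n * a $ i - 1"]
    by (simp add: inner_axis algebra_simps)
  have 2: "smooth_fun (\<lambda>x. exp_cutoff 0 (real n * (b $ i - x $ i) - 1))" for i
    using smooth_fun.cutoff[of 0 "- real n *\<^sub>R axis i 1" "real n * b $ i - 1"]
    by (simp add: inner_axis algebra_simps)
  show ?thesis
    unfolding box_bump_def by (intro smooth_fun_prod smooth_fun.mult 1 2) simp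
qed

lemma box_bump_bounds: "0 \<le> box_bump n a b x" "box_bump n a b x \<le> 1"
  unfolding box_bump_def
  by (auto intro!: prod_nonneg prod_le_1 mult_nonneg_nonneg mult_le_one exp_cutoff_0_bounds)

lemma box_bump_support: "closure {x. box_bump (Suc n) a b x \<noteq> 0} \<subseteq> box a b"
proof -
  define S where "S = cbox (\<chi> i. a $ i + 1 / real (Suc n)) (\<chi> i. b $ i - 1 / real (Suc n))"
  have "x \<in> S" if "box_bump (Suc n) a b x \<noteq> 0" for x
  proof -
    have "1 < real (Suc n) * (x $ i - a $ i)" "1 < real (Suc n) * (b $ i - x $ i)" for i
      using that by (auto simp: box_bump_def exp_cutoff_def split: if_splits)
    then show ?thesis
      unfolding S_def mem_box_cart
      by (auto simp: divide_simps algebra_simps less_imp_le)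
  qed
  then have "closure {x. box_bump (Suc n) a b x \<noteq> 0} \<subseteq> S"
    by (intro closure_minimal) (auto simp: S_def)
  moreover have "S \<subseteq> box a b"
  proof
    fix x assume "x \<in> S"
    then have *: "a $ i + 1 / real (Suc n) \<le> x $ i" "x $ i \<le> b $ i - 1 / real (Suc n)" for i
      by (auto simp: S_def mem_box_cart)
    have "0 < 1 / real (Suc n)" by simp
    then show "x \<in> box a b"
      unfolding mem_box_cart using * by (smt (verit))
  qed
  ultimately show ?thesis by blast
qed

lemma box_bump_tendsto: "(\<lambda>n. box_bump (Suc n) a b x) \<longlonglongrightarrow> indicator (box a b) x"
proof (cases "x \<in> box a b")
  case False
  have "box_bump (Suc n) a b x = 0" for n
  proof (rule ccontr)
    assume "box_bump (Suc n) a b x \<noteq> 0"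
    then have "x \<in> closure {x. box_bump (Suc n) a b x \<noteq> 0}"
      by (intro subsetD[OF closure_subset]) simp
    then show False
      using False box_bump_support[of n a b] by blast
  qed
  then show ?thesis
    using False by simp
next
  case True
  have lim: "(\<lambda>n. exp_cutoff 0 (real (Suc n) * d - 1)) \<longlonglongrightarrow> 1" if "d > 0" for d
  proof -
    have top: "filterlim (\<lambda>n. real (Suc n) * d - 1) at_top sequentially"
    proof -
      have "filterlim (\<lambda>n. d * real (Suc n)) at_top sequentially"
        by (rule filterlim_tendsto_pos_mult_at_top[OF tendsto_const \<open>d > 0\<close>])
          (rule filterlim_compose[OF filterlim_real_sequentially filterlim_Suc])
      then show ?thesis
        using filterlim_tendsto_add_at_top[OF tendsto_const[of "-1"]]
        by (simp add: mult.commute)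
    qed
    have "(\<lambda>n. exp (- (1 / (real (Suc n) * d - 1)))) \<longlonglongrightarrow> exp (- 0)"
      by (intro tendsto_intros tendsto_divide_0[OF tendsto_const]
          filterlim_at_top_imp_at_infinity top)
    moreover have "\<forall>\<^sub>F n in sequentially. exp (- (1 / (real (Suc n) * d - 1))) = exp_cutoff 0 (real (Suc n) * d - 1)"
      using filterlim_at_top_dense[THEN iffD1, OF top, rule_format, of 0]
      by eventually_elim (simp add: exp_cutoff_def)
    ultimately show ?thesis
      using Lim_transform_eventually by fastforce
  qed
  have "(\<lambda>n. box_bump (Suc n) a b x) \<longlonglongrightarrow> (\<Prod>i\<in>(UNIV::3 set). 1 * 1)"
    unfolding box_bump_def
    using True by (intro tendsto_prod tendsto_mult lim) (auto simp: mem_box_cart)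
  then show ?thesis
    using True by simp
qed

section \<open>The fundamental lemma of the calculus of variations\<close>

text \<open>Covers both Lebesgue measure and Borel surface measures.\<close>

definition radon_like :: "(real^3) measure \<Rightarrow> bool" where
  "radon_like M \<longleftrightarrow> space M = UNIV \<and> sets borel \<subseteq> sets M \<and>
     (\<forall>A\<in>sets M. \<exists>B\<in>sets borel. AE x in M. x \<in> A \<longleftrightarrow> x \<in> B) \<and>
     (\<forall>K. compact K \<longrightarrow> emeasure M K < \<infinity>)"

lemma radon_like_lebesgue: "radon_like lebesgue"
  unfolding radon_like_def
proof (intro conjI ballI allI impI)
  fix A :: "(real^3) set"
  assume "A \<in> sets lebesgue"
  then obtain S N N' where "A = S \<union> N" "N \<subseteq> N'" "N' \<in> null_sets lborel" "S \<in> sets (lborel :: (real^3) measure)"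
    by (rule sets_completionE)
  moreover from this have "AE x in lebesgue. x \<notin> N'"
    by (intro AE_not_in null_sets_completionI)
  ultimately show "\<exists>B\<in>sets borel. AE x in lebesgue. x \<in> A \<longleftrightarrow> x \<in> B"
    by (intro bexI[of _ S]) (auto elim!: eventually_mono)
next
  fix K :: "(real^3) set"
  assume "compact K"
  then show "emeasure lebesgue K < \<infinity>"
    using emeasure_compact_finite[of K] by (simp add: borel_compact)
qed auto

lemma radon_like_measurable:
  assumes "radon_like M" "f \<in> borel_measurable borel"
  shows "f \<in> borel_measurable M"
  using assms unfolding radon_like_def
  by (intro measurableI) (auto dest: measurable_sets)

lemma radon_like_borel: "radon_like M \<Longrightarrow> A \<in> sets borel \<Longrightarrow> A \<in> sets M"
  unfolding radon_like_def by blast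

lemma bounded_compact_support_L2:
  assumes M: "radon_like M" and f: "continuous_on UNIV f" and K: "compact K" "\<And>x. x \<notin> K \<Longrightarrow> f x = 0"
  shows "f \<in> L2 M"
proof -
  obtain B where B: "\<And>x. x \<in> K \<Longrightarrow> norm (f x) \<le> B"
    using compact_imp_bounded[OF compact_continuous_image[OF continuous_on_subset[OF f] K(1)]]
    unfolding bounded_iff by auto
  have KM: "K \<in> sets M" "emeasure M K < \<infinity>"
    using M K(1) unfolding radon_like_def by (auto intro: borel_compact)
  have [measurable]: "f \<in> borel_measurable M"
    by (rule radon_like_measurable[OF M borel_measurable_continuous_onI[OF f]])
  have "integrable M (\<lambda>x. (norm (f x))\<^sup>2)"
  proof (rule Bochner_Integration.integrable_bound)
    show "integrable M (\<lambda>x. B\<^sup>2 * indicat_real K x)"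
      using KM by simp
    have "(norm (f x))\<^sup>2 \<le> B\<^sup>2 * indicat_real K x" for x
      using B[of x] K(2)[of x] by (cases "x \<in> K") (auto intro: power_mono)
    then show "AE x in M. norm ((norm (f x))\<^sup>2) \<le> norm (B\<^sup>2 * indicat_real K x)"
      by simp
  qed measurable
  then show ?thesis by (simp add: L2_def)
qed

text \<open>The bumps of the inner box are admissible tests and converge to its indicator. Their
  supports allow the indicator of \<open>box a b\<close> to be inserted, which provides the
  integrable majorant for dominated convergence.\<close>

lemma integral_box_zero:
  fixes g :: "real^3 \<Rightarrow> complex"
  assumes M: "radon_like M" and int: "integrable M (\<lambda>x. indicator (box a b) x *\<^sub>R g x)"
    and zero: "\<And>\<phi>. \<lbrakk>smooth_fun \<phi>; closure {x. \<phi> x \<noteq> 0} \<subseteq> box a b\<rbrakk> \<Longrightarrow> (LINT x|M. \<phi> x *\<^sub>R g x) = 0"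
    and sub: "box c d \<subseteq> box a b"
  shows "(LINT x|M. indicator (box c d) x *\<^sub>R g x) = 0"
proof -
  have cd: "box c d \<in> sets M"
    by (rule radon_like_borel[OF M]) simp
  have eq: "box_bump (Suc n) c d x *\<^sub>R g x = box_bump (Suc n) c d x *\<^sub>R (indicator (box a b) x *\<^sub>R g x)" for n x
    using box_bump_support[of n c d] closure_subset[of "{x. box_bump (Suc n) c d x \<noteq> 0}"] sub
    by (cases "box_bump (Suc n) c d x = 0") (auto simp: subset_eq)
  have eq2: "indicator (box c d) x *\<^sub>R g x = indicator (box c d) x *\<^sub>R (indicator (box a b) x *\<^sub>R g x)" for x
    using sub by (auto simp: indicator_def)
  have [measurable]: "box_bump n c d \<in> borel_measurable M" for n
    by (intro radon_like_measurable[OF M] borel_measurable_continuous_onI smooth_fun_continuous smooth_box_bump)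
  have [measurable]: "(\<lambda>x. indicator (box a b) x *\<^sub>R g x) \<in> borel_measurable M"
    using int by (rule borel_measurable_integrable)
  have "(\<lambda>n. LINT x|M. box_bump (Suc n) c d x *\<^sub>R g x) \<longlonglongrightarrow> (LINT x|M. indicator (box c d) x *\<^sub>R g x)"
  proof (rule integral_dominated_convergence)
    show "(\<lambda>x. box_bump (Suc n) c d x *\<^sub>R g x) \<in> borel_measurable M" for n
      unfolding eq by measurable
    show "(\<lambda>x. indicator (box c d) x *\<^sub>R g x) \<in> borel_measurable M"
      unfolding eq2 using cd by measurable
    show "integrable M (\<lambda>x. norm (indicator (box a b) x *\<^sub>R g x))"
      using int by (rule integrable_norm)
    show "AE x in M. (\<lambda>n. box_bump (Suc n) c d x *\<^sub>R g x) \<longlonglongrightarrow> indicator (box c d) x *\<^sub>R g x"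
      by (intro AE_I2 tendsto_intros box_bump_tendsto)
    show "AE x in M. norm (box_bump (Suc n) c d x *\<^sub>R g x) \<le> norm (indicator (box a b) x *\<^sub>R g x)" for n
      unfolding eq using box_bump_bounds[of "Suc n" c d]
      by (intro AE_I2) (auto simp: mult.assoc intro!: mult_left_le_one_le)
  qed
  moreover have "(LINT x|M. box_bump (Suc n) c d x *\<^sub>R g x) = 0" for n
    using box_bump_support[of n c d] sub by (intro zero smooth_box_bump) auto
  ultimately show ?thesis
    by (simp add: LIMSEQ_const_iff)
qed

text \<open>A \<pi>-\<lambda> argument over the boxes, an intersection-stable generator of the Borel
  sets. Cutting with \<open>box a b\<close> makes the integrand integrable on the whole space, so
  complements are handled by subtraction.\<close>

lemma integral_borel_zero:
  fixes g :: "real^3 \<Rightarrow> complex"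
  assumes M: "radon_like M" and int: "integrable M (\<lambda>x. indicator (box a b) x *\<^sub>R g x)"
    and zero: "\<And>\<phi>. \<lbrakk>smooth_fun \<phi>; closure {x. \<phi> x \<noteq> 0} \<subseteq> box a b\<rbrakk> \<Longrightarrow> (LINT x|M. \<phi> x *\<^sub>R g x) = 0"
    and A: "A \<in> sets borel"
  shows "(LINT x:A|M. indicator (box a b) x *\<^sub>R g x) = 0"
proof -
  define f where "f x = indicator (box a b) x *\<^sub>R g x" for x
  have intA: "set_integrable M A f" if "A \<in> sets borel" for A
    using int radon_like_borel[OF M that] unfolding set_integrable_def f_def
    by (rule integrable_mult_indicator[rotated])
  let ?G = "range (\<lambda>(a, b). box a b) :: (real^3) set set"
  have borel_G: "sigma_sets UNIV ?G = sets borel"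
    unfolding borel_eq_box by simp
  have "Int_stable ?G"
    by (auto simp: Int_stable_def box_Int_box)
  moreover have "?G \<subseteq> Pow UNIV"
    by simp
  moreover have "A \<in> sigma_sets UNIV ?G"
    using A unfolding borel_G .
  ultimately have "(LINT x:A|M. f x) = 0"
  proof (induction rule: sigma_sets_induct_disjoint)
    case (basic A)
    then obtain c d where A: "A = box c d" by auto
    obtain c' d' where cd: "box c d \<inter> box a b = box c' d'"
      by (auto simp: box_Int_box)
    have "(LINT x:A|M. f x) = (LINT x|M. indicator (box c' d') x *\<^sub>R g x)"
      unfolding set_lebesgue_integral_def f_def A cd[symmetric]
      by (rule Bochner_Integration.integral_cong) (auto simp: indicator_def)
    also have "\<dots> = 0"
      by (rule integral_box_zero[OF M int zero]) (use cd in auto)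
    finally show ?case .
  next
    case empty
    show ?case by (simp add: set_lebesgue_integral_def)
  next
    case (compl A)
    have "(LINT x:UNIV - A|M. f x)
        = (LINT x|M. indicat_real UNIV x *\<^sub>R f x - indicat_real A x *\<^sub>R f x)"
      unfolding set_lebesgue_integral_def
      by (rule Bochner_Integration.integral_cong) (auto simp: indicator_def)
    also have "\<dots> = (LINT x:UNIV|M. f x) - (LINT x:A|M. f x)"
      using intA[of UNIV] intA[of A] compl(1) borel_G
      unfolding set_lebesgue_integral_def set_integrable_def
      by (intro Bochner_Integration.integral_diff) auto
    also have "(LINT x:UNIV|M. f x) = (LINT x|M. indicator (box a b) x *\<^sub>R g x)"
      by (simp add: set_lebesgue_integral_def f_def)
    also have "\<dots> = 0"
      by (rule integral_box_zero[OF M int zero]) auto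
    finally show ?case using compl by simp
  next
    case (union A)
    then have Ab: "A i \<in> sets borel" for i
      using borel_G by auto
    have "(LINT x:(\<Union>i. A i)|M. f x) = (\<Sum>i. (LINT x:(A i)|M. f x))"
    proof (rule lebesgue_integral_countable_add)
      show "A i \<in> sets M" for i
        by (rule radon_like_borel[OF M Ab])
      show "A i \<inter> A j = {}" if "i \<noteq> j" for i j
        using union(1) that by (auto simp: disjoint_family_on_def)
      show "set_integrable M (\<Union>i. A i) f"
        by (intro intA sets.countable_UN) (use Ab in auto)
    qed
    then show ?case using union by simp
  qed
  then show ?thesis by (simp add: f_def)
qed

text \<open>An integrable function with zero integral over every measurable set vanishes almost
  everywhere; this is applied to real and imaginary parts. Testing on Borel sets is enough because
  \<open>radon_like\<close> matches measurable sets with Borel sets up to null sets.\<close>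

lemma AE_zero_on_box:
  fixes g :: "real^3 \<Rightarrow> complex"
  assumes M: "radon_like M" and int: "integrable M (\<lambda>x. indicator (box a b) x *\<^sub>R g x)"
    and zero: "\<And>\<phi>. \<lbrakk>smooth_fun \<phi>; closure {x. \<phi> x \<noteq> 0} \<subseteq> box a b\<rbrakk> \<Longrightarrow> (LINT x|M. \<phi> x *\<^sub>R g x) = 0"
  shows "AE x in M. x \<in> box a b \<longrightarrow> g x = 0"
proof -
  have [measurable]: "(\<lambda>x. indicator (box a b) x *\<^sub>R g x) \<in> borel_measurable M"
    using int by (rule borel_measurable_integrable)
  define f where "f x = indicator (box a b) x *\<^sub>R g x" for x
  have zero_int: "(LINT x:A|M. f x) = 0" and f_int: "integrable M f" "set_integrable M A f"
    if A: "A \<in> sets M" for A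
  proof -
    obtain B where B: "B \<in> sets borel" and AB: "AE x in M. x \<in> A \<longleftrightarrow> x \<in> B"
      using M A unfolding radon_like_def by blast
    have [measurable]: "B \<in> sets M"
      by (rule radon_like_borel[OF M B])
    have "(LINT x:A|M. indicator (box a b) x *\<^sub>R g x) = (LINT x:B|M. indicator (box a b) x *\<^sub>R g x)"
      unfolding set_lebesgue_integral_def
    proof (rule integral_cong_AE)
      show "AE x in M. indicat_real A x *\<^sub>R indicat_real (box a b) x *\<^sub>R g x
          = indicat_real B x *\<^sub>R indicat_real (box a b) x *\<^sub>R g x"
        using AB by eventually_elim (simp add: indicator_def)
    qed (use A in measurable)
    also have "\<dots> = 0"
      by (rule integral_borel_zero[OF M int zero B])
    finally show "(LINT x:A|M. f x) = 0"
      unfolding f_def .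
    show "integrable M f" "set_integrable M A f"
      using int integrable_mult_indicator[OF A int] by (simp_all add: f_def[abs_def] set_integrable_def)
  qed
  have "AE x in M. Re (f x) = 0"
  proof (rule density_unique_real)
    fix A assume "A \<in> sets M"
    then show "(LINT x:A|M. Re (f x)) = (LINT x:A|M. 0)"
      using integral_Re[OF f_int(2)[unfolded set_integrable_def]] zero_int
      by (simp add: set_lebesgue_integral_def)
  qed (use f_int(1) in auto)
  moreover have "AE x in M. Im (f x) = 0"
  proof (rule density_unique_real)
    fix A assume "A \<in> sets M"
    then show "(LINT x:A|M. Im (f x)) = (LINT x:A|M. 0)"
      using integral_Im[OF f_int(2)[unfolded set_integrable_def]] zero_int
      by (simp add: set_lebesgue_integral_def)
  qed (use f_int(1) in auto)
  ultimately show ?thesis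
    by eventually_elim (auto simp: f_def indicator_def complex_eq_iff)
qed

section \<open>Test fields and the vanishing of square-integrable fields\<close>

lemma test_field_smooth_fun:
  assumes "smooth_fun \<phi>" "closure {x. \<phi> x \<noteq> 0} \<subseteq> box a b"
  shows "test_field (\<lambda>x. \<phi> x *\<^sub>R e)" and "fsupp (\<lambda>x. \<phi> x *\<^sub>R e) \<subseteq> box a b"
proof -
  have "fsupp (\<lambda>x. \<phi> x *\<^sub>R e) \<subseteq> closure {x. \<phi> x \<noteq> 0}"
    unfolding fsupp_def by (rule closure_mono) auto
  then show "fsupp (\<lambda>x. \<phi> x *\<^sub>R e) \<subseteq> box a b"
    using assms(2) by blast
  then have "bounded (fsupp (\<lambda>x. \<phi> x *\<^sub>R e))"
    using bounded_box bounded_subset by blast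
  then have "compact (fsupp (\<lambda>x. \<phi> x *\<^sub>R e))"
    by (simp add: compact_eq_bounded_closed fsupp_def)
  then show "test_field (\<lambda>x. \<phi> x *\<^sub>R e)"
    using smooth_fun_Ck[OF assms(1)] by (simp add: test_field_def)
qed

text \<open>The open set is a countable union of open boxes, so the exceptional null sets add up to
  a null set. A scalar bump times a unit coordinate vector isolates one component at a time.\<close>

theorem L2_zero_of_test_fields:
  assumes M: "radon_like M" and U: "open U" and G: "G \<in> L2 M"
    and zero: "\<And>w. \<lbrakk>test_field w; fsupp w \<subseteq> U\<rbrakk> \<Longrightarrow> l2ip M G (\<lambda>x. cvec (w x)) = 0"
  shows "AE x in M. x \<in> U \<longrightarrow> G x = 0"
proof -
  have [measurable]: "G \<in> borel_measurable M"
    using G by (rule L2_measurable)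
  obtain \<D> where D: "countable \<D>" "\<D> \<subseteq> Pow U" "\<And>X. X \<in> \<D> \<Longrightarrow> \<exists>a b. X = box a b" "\<Union>\<D> = U"
    using open_countable_Union_open_box[OF U] by metis
  have box: "AE x in M. x \<in> box a b \<longrightarrow> G x $ i = 0" if sub: "box a b \<subseteq> U" for a b and i :: 3
  proof (rule AE_zero_on_box[OF M])
    have [measurable]: "box a b \<in> sets M"
      by (rule radon_like_borel[OF M]) simp
    have "emeasure M (box a b) \<le> emeasure M (cbox a b)"
      by (intro emeasure_mono box_subset_cbox radon_like_borel[OF M]) simp
    also have "\<dots> < \<infinity>"
      using M compact_cbox[of a b] unfolding radon_like_def by simp
    finally have fin: "emeasure M (box a b) < \<infinity>" .
    show "integrable M (\<lambda>x. indicator (box a b) x *\<^sub>R G x $ i)"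
    proof (rule Bochner_Integration.integrable_bound)
      show "integrable M (\<lambda>x. indicator (box a b) x + (norm (G x))\<^sup>2)"
        using L2_integrable[OF G] fin by simp
      \<comment> \<open>The box has finite measure, so this bound turns square integrability into
        integrability on the box.\<close>
      have "norm (G x $ i) \<le> 1 + (norm (G x))\<^sup>2" for x
      proof -
        have "norm (G x $ i) \<le> norm (G x)"
          by (rule Finite_Cartesian_Product.norm_nth_le)
        also have "\<dots> \<le> 1 + (norm (G x))\<^sup>2"
          using sum_squares_bound[of "norm (G x)" 1] norm_ge_zero[of "G x"]
          unfolding mult_1_right power_one by linarith
        finally show ?thesis .
      qed
      then have "norm (indicator (box a b) x *\<^sub>R G x $ i) \<le> norm (indicator (box a b) x + (norm (G x))\<^sup>2)" for x
        by (cases "x \<in> box a b") simp_all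
      then show "AE x in M. norm (indicator (box a b) x *\<^sub>R G x $ i) \<le> norm (indicator (box a b) x + (norm (G x))\<^sup>2)"
        by (intro AE_I2)
      show "(\<lambda>x. indicator (box a b) x *\<^sub>R G x $ i) \<in> borel_measurable M"
        by (intro borel_measurable_scaleR borel_measurable_indicator measurable_vec_nth) fact+
    qed
    fix \<phi>
    assume \<phi>: "smooth_fun \<phi>" "closure {x. \<phi> x \<noteq> 0} \<subseteq> box a b"
    have "cinner (G x) (cvec (\<phi> x *\<^sub>R axis i 1)) = \<phi> x *\<^sub>R G x $ i" for x
    proof -
      have "cinner (G x) (cvec (\<phi> x *\<^sub>R axis i 1)) = (\<Sum>j\<in>UNIV. if j = i then \<phi> x *\<^sub>R G x $ j else 0)"
        unfolding cinner_def
        by (rule sum.cong) (simp_all add: cvec_def axis_def scaleR_conv_of_real[where 'a = complex] mult.commute)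
      then show ?thesis by simp
    qed
    then have "(LINT x|M. \<phi> x *\<^sub>R G x $ i) = l2ip M G (\<lambda>x. cvec (\<phi> x *\<^sub>R axis i 1))"
      by (simp add: l2ip_def)
    also have "\<dots> = 0"
      by (rule zero[OF test_field_smooth_fun(1)[OF \<phi>] order_trans[OF test_field_smooth_fun(2)[OF \<phi>] sub]])
    finally show "(LINT x|M. \<phi> x *\<^sub>R G x $ i) = 0" .
  qed
  have "AE x in M. \<forall>X\<in>\<D>. x \<in> X \<longrightarrow> (\<forall>i. G x $ i = 0)"
  proof (subst AE_ball_countable[OF D(1)], intro ballI)
    fix X assume X: "X \<in> \<D>"
    then obtain a b where "X = box a b" "box a b \<subseteq> U"
      using D(2,3) by blast
    then have "AE x in M. x \<in> X \<longrightarrow> G x $ i = 0" for i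
      using box by simp
    then have "AE x in M. \<forall>i. x \<in> X \<longrightarrow> G x $ i = 0"
      unfolding AE_all_countable by blast
    then show "AE x in M. x \<in> X \<longrightarrow> (\<forall>i. G x $ i = 0)"
      by eventually_elim auto
  qed
  then show ?thesis
    by eventually_elim (use D(4) in \<open>auto simp: vec_eq_iff\<close>)
qed

lemma test_field_partial_deriv:
  assumes "test_field w"
  shows "continuous_on UNIV (\<lambda>x. partial_deriv j i w x)"
    and "x \<notin> fsupp w \<Longrightarrow> partial_deriv j i w x = 0"
proof -
  obtain f' where f': "\<And>x. (w has_derivative f' x) (at x)" "\<And>h. continuous_on UNIV (\<lambda>x. f' x h)"
    using assms[unfolded test_field_def, THEN conjunct1, rule_format, of 1] by auto
  have fd: "frechet_derivative w (at x) = f' x" for x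
    using frechet_derivative_at[OF f'(1)] by simp
  show "continuous_on UNIV (\<lambda>x. partial_deriv j i w x)"
    unfolding partial_deriv_def fd by (intro continuous_intros f')
  assume x: "x \<notin> fsupp w"
  have "((\<lambda>_. 0) has_derivative (\<lambda>_. 0)) (at x)"
    by simp
  then have "(w has_derivative (\<lambda>_. 0)) (at x)"
  proof (rule has_derivative_transform_within_open)
    show "open (- fsupp w)"
      unfolding fsupp_def by (intro open_Compl closed_closure)
    show "0 = w y" if "y \<in> - fsupp w" for y
      using that closure_subset[of "{x. w x \<noteq> 0}"] by (auto simp: fsupp_def)
  qed (use x in \<open>auto simp: fsupp_def\<close>)
  then have "f' x = (\<lambda>_. 0)"
    using f'(1) has_derivative_unique by blast
  then show "partial_deriv j i w x = 0"
    by (simp add: partial_deriv_def fd)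
qed

lemma continuous_on_cvec:
  assumes "\<And>i. continuous_on S (\<lambda>x. f x $ i)"
  shows "continuous_on S (\<lambda>x. cvec (f x))"
  unfolding cvec_def by (rule continuous_on_vec_lambda, rule continuous_on_of_real, rule assms)

lemma test_field_L2:
  assumes M: "radon_like M" and w: "test_field w"
  shows "(\<lambda>x. cvec (w x)) \<in> L2 M" and "(\<lambda>x. cvec (classical_curl w x)) \<in> L2 M"
proof -
  have K: "compact (fsupp w)"
    using w by (simp add: test_field_def)
  have "continuous_on UNIV w"
    using w[unfolded test_field_def, THEN conjunct1, rule_format, of 0] by simp
  then show "(\<lambda>x. cvec (w x)) \<in> L2 M"
  proof (intro bounded_compact_support_L2[OF M _ K] continuous_on_cvec continuous_intros)
    show "cvec (w x) = 0" if "x \<notin> fsupp w" for x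
      using that closure_subset[of "{x. w x \<noteq> 0}"] by (auto simp: fsupp_def cvec_def vec_eq_iff)
  qed
  show "(\<lambda>x. cvec (classical_curl w x)) \<in> L2 M"
  proof (intro bounded_compact_support_L2[OF M _ K] continuous_on_cvec)
    have "continuous_on UNIV (\<lambda>x. classical_curl w x $ 1)"
      "continuous_on UNIV (\<lambda>x. classical_curl w x $ 2)"
      "continuous_on UNIV (\<lambda>x. classical_curl w x $ 3)"
      unfolding classical_curl_def vector_3
      by (rule continuous_on_diff; rule test_field_partial_deriv(1)[OF w])+
    then show "continuous_on UNIV (\<lambda>x. classical_curl w x $ i)" for i
      using exhaust_3[of i] by auto
    show "cvec (classical_curl w x) = 0" if "x \<notin> fsupp w" for x
      using test_field_partial_deriv(2)[OF w that]
      by (simp add: classical_curl_def cvec_def vec_eq_iff forall_3)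
  qed
qed

lemma L2_lebesgue_on:
  assumes "f \<in> L2 lebesgue" "S \<in> sets lebesgue"
  shows "f \<in> L2 (lebesgue_on S)"
proof -
  have "integrable (lebesgue_on S) (\<lambda>x. (norm (f x))\<^sup>2)"
    using integrable_mult_indicator[OF assms(2) L2_integrable[OF assms(1)]] assms(2)
    by (simp add: integrable_restrict_space)
  moreover have "f \<in> borel_measurable (lebesgue_on S)"
    using assms by (intro measurable_restrict_space1) (simp add: L2_def)
  ultimately show ?thesis by (simp add: L2_def)
qed

lemma test_field_L2_lebesgue_on:
  assumes "test_field w" "S \<in> sets lebesgue"
  shows "(\<lambda>x. cvec (w x)) \<in> L2 (lebesgue_on S)"
    and "(\<lambda>x. cvec (classical_curl w x)) \<in> L2 (lebesgue_on S)"
  using test_field_L2[OF radon_like_lebesgue assms(1)] assms(2) by (auto intro: L2_lebesgue_on)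

text \<open>Extension by zero moves the claim from \<open>lebesgue_on S\<close> to
  \<open>lebesgue\<close>, as \<open>radon_like\<close> asks for a measure on the whole space; the
  pairings with test fields are unchanged.\<close>

lemma L2_zero_of_test_fields_lebesgue:
  assumes S: "open S" and c: "c \<in> L2 (lebesgue_on S)"
    and zero: "\<And>w. \<lbrakk>test_field w; fsupp w \<subseteq> S\<rbrakk> \<Longrightarrow> l2ip (lebesgue_on S) c (\<lambda>x. cvec (w x)) = 0"
  shows "AE x in lebesgue_on S. c x = 0"
proof -
  have [measurable]: "S \<in> sets lebesgue"
    using S by (simp add: borel_open)
  define c' where "c' x = (if x \<in> S then c x else 0)" for x
  have "c' \<in> borel_measurable lebesgue"
    unfolding c'_def using c by (intro borel_measurable_if_I) (auto simp: L2_def)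
  moreover have "integrable lebesgue (\<lambda>x. (norm (c' x))\<^sup>2)"
  proof -
    have "integrable lebesgue (\<lambda>x. indicator S x *\<^sub>R (norm (c x))\<^sup>2)"
      using c by (simp add: L2_def integrable_restrict_space)
    moreover have "indicator S x *\<^sub>R (norm (c x))\<^sup>2 = (norm (c' x))\<^sup>2" for x
      by (simp add: c'_def)
    ultimately show ?thesis by simp
  qed
  ultimately have c': "c' \<in> L2 lebesgue"
    by (simp add: L2_def)
  have "AE x in lebesgue. x \<in> S \<longrightarrow> c' x = 0"
  proof (rule L2_zero_of_test_fields[OF radon_like_lebesgue S c'])
    fix w assume w: "test_field w" "fsupp w \<subseteq> S"
    have "l2ip lebesgue c' (\<lambda>x. cvec (w x)) = l2ip (lebesgue_on S) c (\<lambda>x. cvec (w x))"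
      unfolding l2ip_def
      by (subst integral_restrict_space)
        (auto intro!: Bochner_Integration.integral_cong simp: c'_def cinner_zero_left)
    then show "l2ip lebesgue c' (\<lambda>x. cvec (w x)) = 0"
      using zero[OF w] by simp
  qed
  then show ?thesis
    by (subst AE_restrict_space_iff) (auto simp: c'_def elim!: eventually_mono)
qed

section \<open>Surface measures are finite on compact sets\<close>

lemma sets_surface_measure [simp]: "sets (surface_measure S) = sets borel"
  and space_surface_measure [simp]: "space (surface_measure S) = UNIV"
  by (simp_all add: surface_measure_def sets.sigma_sets_eq[of borel, simplified])

text \<open>\<open>measure_of\<close> gives the value zero when its set function is not a measure,
  so the inequality holds in every case. Finiteness on compact sets and concentration on
  \<open>S\<close> both follow from upper bounds.\<close>

lemma emeasure_surface_measure_le: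
  "emeasure (surface_measure S) A \<le> hausdorff2 (A \<inter> S)"
  unfolding surface_measure_def by (subst emeasure_measure_of_conv) auto

text \<open>The pair (p, q) acts as a chart into the square of half-side R, with an inverse of
  Lipschitz constant L for the sum norm. Cells of side h = 2R/N give at most (N+1)^2 sets of
  diameter at most d = 2Lh = 4LR/N, and (N+1)^2 \<le> 4 N^2 makes the total independent of
  N.\<close>

lemma hausdorff2_le:
  fixes p q :: "real^3 \<Rightarrow> real"
  assumes "R > 0" "L \<ge> 0"
    and p: "\<And>x. x \<in> A \<Longrightarrow> \<bar>p x\<bar> \<le> R" and q: "\<And>x. x \<in> A \<Longrightarrow> \<bar>q x\<bar> \<le> R"
    and L: "\<And>x y. \<lbrakk>x \<in> A; y \<in> A\<rbrakk> \<Longrightarrow> dist x y \<le> L * (\<bar>p x - p y\<bar> + \<bar>q x - q y\<bar>)"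
  shows "hausdorff2 A \<le> ennreal (16 * pi * L\<^sup>2 * R\<^sup>2)"
  unfolding hausdorff2_def
proof (rule SUP_least)
  fix \<delta> :: real
  assume "\<delta> \<in> {0<..}"
  then have "\<delta> > 0" by simp
  \<comment> \<open>N is chosen so large that the cell diameter falls below \<delta>.\<close>
  obtain N :: nat where N: "4 * L * R / \<delta> < real N"
    using reals_Archimedean2 by blast
  have "0 \<le> 4 * L * R / \<delta>"
    using assms(1,2) \<open>\<delta> > 0\<close> by simp
  with N have N0: "0 < real N" by linarith
  define h where "h = 2 * R / real N"
  have h: "h > 0"
    using \<open>R > 0\<close> N0 by (simp add: h_def)
  define d where "d = 4 * L * R / real N"
  have d: "d = L * (h + h)" "0 \<le> d" "d \<le> \<delta>"
    using assms(1,2) N N0 \<open>\<delta> > 0\<close> by (auto simp: d_def h_def field_simps)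
  define c where "c s = nat \<lfloor>(s + R) / h\<rfloor>" for s
  have c_le: "c s \<le> N" if "\<bar>s\<bar> \<le> R" for s
  proof -
    have "(s + R) / h \<le> (R + R) / h"
      using that h by (intro divide_right_mono) auto
    also have "\<dots> = real N"
      using \<open>R > 0\<close> N0 by (simp add: h_def field_simps)
    finally have "\<lfloor>(s + R) / h\<rfloor> \<le> int N"
      by (simp add: floor_le_iff)
    then show ?thesis by (simp add: c_def)
  qed
  have c_eq: "\<bar>s - t\<bar> \<le> h" if "\<bar>s\<bar> \<le> R" "\<bar>t\<bar> \<le> R" "c s = c t" for s t
  proof -
    have "0 \<le> (s + R) / h" "0 \<le> (t + R) / h"
      using that(1,2) h by auto
    then have "\<lfloor>(s + R) / h\<rfloor> = \<lfloor>(t + R) / h\<rfloor>"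
      using that(3) by (simp add: c_def eq_nat_nat_iff)
    then have "\<bar>(s + R) / h - (t + R) / h\<bar> \<le> 1"
      by linarith
    also have "(s + R) / h - (t + R) / h = (s - t) / h"
      by (simp add: diff_divide_distrib[symmetric])
    finally show ?thesis
      using h by (simp add: abs_divide divide_le_eq)
  qed
  \<comment> \<open>The covering must be a sequence, so pairs of indices are coded by natural
    numbers; cells outside the finite set \<open>F\<close> below are empty and contribute
    zero.\<close>
  define C where "C n = {x \<in> A. c (p x) = fst (prod_decode n) \<and> c (q x) = snd (prod_decode n)}" for n
  define F where "F = prod_encode ` ({..N} \<times> {..N})"
  have close: "dist x y \<le> d" if "x \<in> C n" "y \<in> C n" for x y n
  proof -
    have "dist x y \<le> L * (\<bar>p x - p y\<bar> + \<bar>q x - q y\<bar>)"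
      using that by (intro L) (auto simp: C_def)
    also have "\<dots> \<le> L * (h + h)"
      using that p q \<open>L \<ge> 0\<close> by (intro mult_left_mono add_mono c_eq) (auto simp: C_def)
    finally show ?thesis using d by simp
  qed
  have bdd: "bounded (C n)" for n
  proof (cases "C n = {}")
    case False
    then obtain x where "x \<in> C n" by blast
    then have "C n \<subseteq> cball x d"
      using close by auto
    then show ?thesis
      using bounded_cball bounded_subset by blast
  qed simp
  have diam: "diameter (C n) \<le> d" for n
    using close d(2) by (intro diameter_le) (auto simp: dist_norm)
  have outside: "C n = {}" if "n \<notin> F" for n
  proof (rule ccontr)
    assume "C n \<noteq> {}"
    then obtain x where "x \<in> A" "c (p x) = fst (prod_decode n)" "c (q x) = snd (prod_decode n)"
      unfolding C_def by blast
    then have "prod_decode n \<in> {..N} \<times> {..N}"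
      using c_le[OF p] c_le[OF q] by (metis SigmaI atMost_iff prod.collapse)
    then have "prod_encode (prod_decode n) \<in> F"
      unfolding F_def by (rule imageI)
    with that show False by simp
  qed
  have cardF: "card F = (N + 1)\<^sup>2"
    unfolding F_def by (subst card_image[OF inj_prod_encode]) (simp add: card_cartesian_product power2_eq_square)
  have "hausdorff2_pre \<delta> A \<le> (\<Sum>n. ennreal (pi / 4 * (diameter (C n))\<^sup>2))"
    unfolding hausdorff2_pre_def
  proof (rule INF_lower)
    have "x \<in> C (prod_encode (c (p x), c (q x)))" if "x \<in> A" for x
      using that by (simp add: C_def)
    then show "C \<in> {C. A \<subseteq> (\<Union>i. C i) \<and> (\<forall>i. bounded (C i) \<and> diameter (C i) \<le> \<delta>)}"
      using bdd order_trans[OF diam d(3)] by blast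
  qed
  also have "\<dots> = (\<Sum>n\<in>F. ennreal (pi / 4 * (diameter (C n))\<^sup>2))"
    by (rule suminf_finite) (auto simp: F_def outside[unfolded F_def])
  also have "\<dots> \<le> (\<Sum>n\<in>F. ennreal (pi / 4 * d\<^sup>2))"
    using diam diameter_ge_0[OF bdd] by (intro sum_mono ennreal_leI mult_left_mono power_mono) auto
  also have "\<dots> = ennreal (real ((N + 1)\<^sup>2) * (pi / 4 * d\<^sup>2))"
    by (simp add: cardF ennreal_of_nat_eq_real_of_nat flip: ennreal_mult)
  also have "\<dots> \<le> ennreal (16 * pi * L\<^sup>2 * R\<^sup>2)"
  proof (rule ennreal_leI)
    have "1 \<le> real N"
      using N0 by simp
    then have "(real (N + 1))\<^sup>2 \<le> (2 * real N)\<^sup>2"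
      by (intro power_mono) auto
    then have "real ((N + 1)\<^sup>2) * (pi / 4 * d\<^sup>2) \<le> (2 * real N)\<^sup>2 * (pi / 4 * d\<^sup>2)"
      unfolding of_nat_power by (intro mult_right_mono) auto
    also have "\<dots> = 16 * pi * L\<^sup>2 * R\<^sup>2"
      using N0 by (simp add: d_def field_simps power2_eq_square)
    finally show "real ((N + 1)\<^sup>2) * (pi / 4 * d\<^sup>2) \<le> 16 * pi * L\<^sup>2 * R\<^sup>2" .
  qed
  finally show "hausdorff2_pre \<delta> A \<le> ennreal (16 * pi * L\<^sup>2 * R\<^sup>2)" .
qed

lemma hausdorff2_empty [simp]: "hausdorff2 {} = 0"
  using hausdorff2_le[of 1 0 "{}" "\<lambda>_. 0" "\<lambda>_. 0"] by simp

section \<open>Area of Lipschitz graphs\<close>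

lemma dominant_coordinate_bound:
  fixes x y z a b c :: real
  assumes "x * a + y * b + z * c = 0" "\<bar>a\<bar> \<le> \<bar>c\<bar>" "\<bar>b\<bar> \<le> \<bar>c\<bar>" "c \<noteq> 0"
  shows "\<bar>z\<bar> \<le> \<bar>x\<bar> + \<bar>y\<bar>"
proof -
  have "\<bar>z\<bar> * \<bar>c\<bar> = \<bar>x * a + y * b\<bar>"
    using assms(1) by (simp add: abs_mult[symmetric])
  also have "\<dots> \<le> \<bar>x\<bar> * \<bar>a\<bar> + \<bar>y\<bar> * \<bar>b\<bar>"
    by (metis abs_mult abs_triangle_ineq)
  also have "\<dots> \<le> \<bar>x\<bar> * \<bar>c\<bar> + \<bar>y\<bar> * \<bar>c\<bar>"
    using assms(2,3) by (intro add_mono mult_left_mono) auto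
  finally have "\<bar>z\<bar> * \<bar>c\<bar> \<le> (\<bar>x\<bar> + \<bar>y\<bar>) * \<bar>c\<bar>"
    by (simp add: algebra_simps)
  then show ?thesis
    using assms(4) by simp
qed

text \<open>The coordinate in which \<open>a\<close> is largest is bounded, on the plane orthogonal
  to \<open>a\<close>, by the sum of the other two, and is dropped. The factor 2 comes from bounding
  the norm by the sum of all three coordinates.\<close>

lemma plane_coordinates:
  fixes a :: "real^3"
  assumes "a \<noteq> 0"
  obtains i j where "\<And>z. z \<bullet> a = 0 \<Longrightarrow> norm z \<le> 2 * (\<bar>z $ i\<bar> + \<bar>z $ j\<bar>)"
proof -
  have n: "norm z \<le> \<bar>z $ 1\<bar> + \<bar>z $ 2\<bar> + \<bar>z $ 3\<bar>" for z :: "real^3"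
    using norm_le_l1_cart[of z] by (simp add: sum_3)
  have dot: "z \<bullet> a = z $ 1 * a $ 1 + z $ 2 * a $ 2 + z $ 3 * a $ 3" for z
    by (simp add: inner_vec_def sum_3)
  have nz: "a $ 1 \<noteq> 0 \<or> a $ 2 \<noteq> 0 \<or> a $ 3 \<noteq> 0"
    using assms by (auto simp: vec_eq_iff forall_3)
  consider "\<bar>a $ 2\<bar> \<le> \<bar>a $ 1\<bar>" "\<bar>a $ 3\<bar> \<le> \<bar>a $ 1\<bar>" | "\<bar>a $ 1\<bar> \<le> \<bar>a $ 2\<bar>" "\<bar>a $ 3\<bar> \<le> \<bar>a $ 2\<bar>"
    | "\<bar>a $ 1\<bar> \<le> \<bar>a $ 3\<bar>" "\<bar>a $ 2\<bar> \<le> \<bar>a $ 3\<bar>"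
    by linarith
  then show thesis
  proof cases
    case 1
    show thesis
    proof (rule that[of 2 3])
      fix z assume "z \<bullet> a = 0"
      then have "z $ 2 * a $ 2 + z $ 3 * a $ 3 + z $ 1 * a $ 1 = 0"
        by (simp add: dot)
      then have "\<bar>z $ 1\<bar> \<le> \<bar>z $ 2\<bar> + \<bar>z $ 3\<bar>"
        by (rule dominant_coordinate_bound) (use 1 nz in auto)
      then show "norm z \<le> 2 * (\<bar>z $ 2\<bar> + \<bar>z $ 3\<bar>)"
        using n[of z] by simp
    qed
  next
    case 2
    show thesis
    proof (rule that[of 1 3])
      fix z assume "z \<bullet> a = 0"
      then have "z $ 1 * a $ 1 + z $ 3 * a $ 3 + z $ 2 * a $ 2 = 0"
        by (simp add: dot)
      then have "\<bar>z $ 2\<bar> \<le> \<bar>z $ 1\<bar> + \<bar>z $ 3\<bar>"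
        by (rule dominant_coordinate_bound) (use 2 nz in auto)
      then show "norm z \<le> 2 * (\<bar>z $ 1\<bar> + \<bar>z $ 3\<bar>)"
        using n[of z] by simp
    qed
  next
    case 3
    show thesis
    proof (rule that[of 1 2])
      fix z assume "z \<bullet> a = 0"
      then have "z $ 1 * a $ 1 + z $ 2 * a $ 2 + z $ 3 * a $ 3 = 0"
        by (simp add: dot)
      then have "\<bar>z $ 3\<bar> \<le> \<bar>z $ 1\<bar> + \<bar>z $ 2\<bar>"
        by (rule dominant_coordinate_bound) (use 3 nz in auto)
      then show "norm z \<le> 2 * (\<bar>z $ 1\<bar> + \<bar>z $ 2\<bar>)"
        using n[of z] by simp
    qed
  qed
qed

text \<open>Both strict sides of the graph are open in the ball. A point above has a neighbourhood
  inside \<open>S\<close> and a point below has one missing \<open>S\<close>, so neither is a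
  frontier point.\<close>

lemma frontier_on_graph:
  assumes "norm (a :: real^3) = 1" "continuous_on UNIV \<gamma>"
    and side: "\<And>x. x \<in> ball p r \<Longrightarrow>
      (x \<bullet> a > \<gamma> (x - (x \<bullet> a) *\<^sub>R a) \<longrightarrow> x \<in> S) \<and> (x \<bullet> a < \<gamma> (x - (x \<bullet> a) *\<^sub>R a) \<longrightarrow> x \<notin> S)"
    and x: "x \<in> frontier S" "x \<in> ball p r"
  shows "x \<bullet> a = \<gamma> (x - (x \<bullet> a) *\<^sub>R a)"
proof (rule ccontr)
  have cont: "continuous_on UNIV (\<lambda>x. \<gamma> (x - (x \<bullet> a) *\<^sub>R a))"
    by (rule continuous_on_compose2[OF assms(2)]) (auto intro!: continuous_intros)
  have cont2: "continuous_on UNIV (\<lambda>x. x \<bullet> a)"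
    by (intro continuous_intros)
  have up: "open ({y. y \<bullet> a > \<gamma> (y - (y \<bullet> a) *\<^sub>R a)} \<inter> ball p r)"
    by (intro open_Int open_Collect_less cont cont2) simp
  have down: "open ({y. y \<bullet> a < \<gamma> (y - (y \<bullet> a) *\<^sub>R a)} \<inter> ball p r)"
    by (intro open_Int open_Collect_less cont cont2) simp
  assume "x \<bullet> a \<noteq> \<gamma> (x - (x \<bullet> a) *\<^sub>R a)"
  then consider "x \<bullet> a > \<gamma> (x - (x \<bullet> a) *\<^sub>R a)" | "x \<bullet> a < \<gamma> (x - (x \<bullet> a) *\<^sub>R a)"
    by linarith
  then show False
  proof cases
    case 1
    then have "x \<in> interior S"
      using x(2) side by (intro interiorI[OF up]) auto
    then show False
      using x(1) by (simp add: frontier_def)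
  next
    case 2
    let ?D = "{y. y \<bullet> a < \<gamma> (y - (y \<bullet> a) *\<^sub>R a)} \<inter> ball p r"
    have "?D \<inter> S = {}"
      using side by auto
    then have "?D \<inter> closure S = {}"
      using open_Int_closure_eq_empty[OF down] by blast
    then show False
      using x 2 by (auto simp: frontier_def)
  qed
qed

text \<open>Near \<open>p\<close> the frontier lies on a Lipschitz graph over a plane. Two
  coordinates of the projection onto this plane serve as chart, and heights differ by at most K
  times the distance in the plane, which gives the constant 2(1 + K).\<close>

lemma hausdorff2_frontier_finite:
  assumes "has_lipschitz_boundary S" "p \<in> frontier S" "G \<subseteq> frontier S"
  shows "\<exists>r>0. hausdorff2 (ball p r \<inter> G) < \<infinity>"
proof -
  obtain r a \<gamma> K where r: "r > 0" and a: "norm a = 1" and lip: "K-lipschitz_on UNIV (\<gamma> :: real^3 \<Rightarrow> real)"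
    and side: "\<forall>x \<in> ball p r. (x \<bullet> a > \<gamma> (x - (x \<bullet> a) *\<^sub>R a) \<longrightarrow> x \<in> S) \<and>
           (x \<bullet> a < \<gamma> (x - (x \<bullet> a) *\<^sub>R a) \<longrightarrow> x \<notin> S)"
    using assms(1,2) unfolding has_lipschitz_boundary_def by metis
  define pr where "pr x = x - (x \<bullet> a) *\<^sub>R a" for x
  have graph: "x \<bullet> a = \<gamma> (pr x)" if "x \<in> ball p r \<inter> G" for x
    unfolding pr_def
    using that assms(3) side by (intro frontier_on_graph[OF a lipschitz_on_continuous_on[OF lip], of p r S]) auto
  have K: "0 \<le> K"
    using lip by (rule lipschitz_on_nonneg)
  have "a \<noteq> 0"
    using a by auto
  then obtain i j where ij: "\<And>z. z \<bullet> a = 0 \<Longrightarrow> norm z \<le> 2 * (\<bar>z $ i\<bar> + \<bar>z $ j\<bar>)"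
    using plane_coordinates by blast
  \<comment> \<open>Removing the component along the unit vector \<open>a\<close> is bounded crudely
    by 2 |x|, hence the factor 2.\<close>
  define R where "R = 2 * (norm p + r)"
  have pr_le: "norm (pr x) \<le> R" if "x \<in> ball p r" for x
  proof -
    have "norm (pr x) \<le> norm x + norm ((x \<bullet> a) *\<^sub>R a)"
      unfolding pr_def by (rule norm_triangle_ineq4)
    also have "\<dots> \<le> 2 * norm x"
      using Cauchy_Schwarz_ineq2[of x a] a by simp
    also have "norm x \<le> norm p + r"
      using that norm_triangle_ineq2[of x p] by (simp add: dist_norm norm_minus_commute)
    finally show ?thesis by (simp add: R_def)
  qed
  have "hausdorff2 (ball p r \<inter> G) \<le> ennreal (16 * pi * (2 * (1 + K))\<^sup>2 * R\<^sup>2)"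
  proof (rule hausdorff2_le)
    show "R > 0"
      using r by (simp add: R_def add_nonneg_pos)
    show "2 * (1 + K) \<ge> 0"
      using K by simp
    show "\<bar>pr x $ i\<bar> \<le> R" "\<bar>pr x $ j\<bar> \<le> R" if "x \<in> ball p r \<inter> G" for x
      using component_le_norm_cart[of "pr x"] pr_le[of x] that by (auto intro: order_trans)
    fix x y assume x: "x \<in> ball p r \<inter> G" and y: "y \<in> ball p r \<inter> G"
    define z where "z = pr x - pr y"
    have "a \<bullet> a = 1"
      using a by (simp add: norm_eq_1)
    then have za: "z \<bullet> a = 0"
      by (simp add: z_def pr_def inner_diff_left)
    have "x - y = z + (\<gamma> (pr x) - \<gamma> (pr y)) *\<^sub>R a"
      unfolding graph[OF x, symmetric] graph[OF y, symmetric]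
      by (simp add: z_def pr_def algebra_simps)
    then have "dist x y \<le> norm z + norm ((\<gamma> (pr x) - \<gamma> (pr y)) *\<^sub>R a)"
      unfolding dist_norm by (metis norm_triangle_ineq)
    also have "\<dots> \<le> norm z + K * norm z"
      using lipschitz_onD[OF lip, of "pr x" "pr y"] a by (simp add: z_def dist_norm)
    also have "\<dots> = (1 + K) * norm z"
      by (simp add: algebra_simps)
    also have "\<dots> \<le> (1 + K) * (2 * (\<bar>z $ i\<bar> + \<bar>z $ j\<bar>))"
      using ij[OF za] K by (intro mult_left_mono) auto
    finally show "dist x y \<le> 2 * (1 + K) * (\<bar>pr x $ i - pr y $ i\<bar> + \<bar>pr x $ j - pr y $ j\<bar>)"
      by (simp add: z_def algebra_simps)
  qed
  also have "\<dots> < \<infinity>"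
    by simp
  finally show ?thesis
    using r by blast
qed

lemma surface_measure_locally_finite:
  assumes "has_lipschitz_boundary S" "G \<subseteq> frontier S"
  shows "\<exists>r>0. emeasure (surface_measure G) (ball p r) < \<infinity>"
proof (cases "p \<in> frontier S")
  case True
  then show ?thesis
    using hausdorff2_frontier_finite[OF assms(1) True assms(2)] emeasure_surface_measure_le
    by (meson le_less_trans)
next
  case False
  then obtain r where "r > 0" "ball p r \<subseteq> - frontier S"
    using open_contains_ball[of "- frontier S"] frontier_closed[of S] by (auto simp: open_Compl)
  moreover from this have "ball p r \<inter> G = {}"
    using assms(2) by auto
  then have "emeasure (surface_measure G) (ball p r) \<le> 0"
    using emeasure_surface_measure_le[of G "ball p r"] by simp
  ultimately show ?thesis
    by (intro exI[of _ r]) auto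
qed

lemma radon_like_surface_measure:
  assumes "has_lipschitz_boundary S" "G \<subseteq> frontier S"
  shows "radon_like (surface_measure G)"
  unfolding radon_like_def
proof (intro conjI ballI allI impI)
  fix A assume "A \<in> sets (surface_measure G)"
  then show "\<exists>B\<in>sets borel. AE x in surface_measure G. x \<in> A \<longleftrightarrow> x \<in> B"
    by (intro bexI[of _ A]) auto
next
  fix K :: "(real^3) set"
  assume K: "compact K"
  obtain r where r: "\<And>p. r p > 0" "\<And>p. emeasure (surface_measure G) (ball p (r p)) < \<infinity>"
    using surface_measure_locally_finite[OF assms] by metis
  have "K \<subseteq> (\<Union>p\<in>K. ball p (r p))"
    using r(1) by auto
  then obtain F where F: "F \<subseteq> K" "finite F" "K \<subseteq> (\<Union>p\<in>F. ball p (r p))"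
    using compactE_image[OF K, of K "\<lambda>p. ball p (r p)"] by auto
  have "(\<Union>p\<in>F. ball p (r p)) \<in> sets borel"
    by (intro borel_open open_UN) simp
  then have "emeasure (surface_measure G) K \<le> emeasure (surface_measure G) (\<Union>p\<in>F. ball p (r p))"
    by (intro emeasure_mono F) auto
  also have "\<dots> \<le> (\<Sum>p\<in>F. emeasure (surface_measure G) (ball p (r p)))"
    by (intro emeasure_subadditive_finite F) auto
  also have "\<dots> < \<infinity>"
    using r(2) F(2) by (simp add: less_top)
  finally show "emeasure (surface_measure G) K < \<infinity>" .
qed auto

lemma AE_surface_measure_mem:
  assumes "G \<in> sets borel"
  shows "AE x in surface_measure G. x \<in> G"
proof (rule AE_I')
  have "emeasure (surface_measure G) (- G) \<le> 0"
    using emeasure_surface_measure_le[of G "- G"] by simp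
  then show "- G \<in> null_sets (surface_measure G)"
    using assms by (simp add: null_sets_def borel_comp)
qed auto

section \<open>Weak curls\<close>

text \<open>The real part is kept in the complex space, so the same spaces and forms apply to it.
  Test fields are real, hence pairing with them commutes with taking real parts, and weak curls and
  traces inherit this.\<close>

definition vec_Re :: "complex^3 \<Rightarrow> complex^3" where
  "vec_Re u = (\<chi> i. complex_of_real (Re (u $ i)))"

lemma cinner_vec_Re_cvec: "cinner (vec_Re u) (cvec w) = of_real (Re (cinner u (cvec w)))"
  by (simp add: cinner_def vec_Re_def cvec_def)

lemma norm_vec_Re_le: "norm (vec_Re u) \<le> norm u"
  unfolding norm_vec_def by (intro L2_set_mono) (simp_all add: vec_Re_def abs_Re_le_cmod)

lemma measurable_vec_Re [measurable (raw)]: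
  assumes "f \<in> borel_measurable M"
  shows "(\<lambda>x. vec_Re (f x)) \<in> borel_measurable M"
  unfolding vec_Re_def
  by (rule borel_measurable_vecI) (use assms in \<open>simp add: borel_measurable_Re measurable_vec_nth\<close>)

lemma L2_vec_Re: "f \<in> L2 M \<Longrightarrow> (\<lambda>x. vec_Re (f x)) \<in> L2 M"
  by (rule L2_bound(1)[of _ _ f 1]) (auto simp: norm_vec_Re_le L2_def)

lemma l2ip_vec_Re_cvec:
  assumes "f \<in> L2 M" "(\<lambda>x. cvec (w x)) \<in> L2 M"
  shows "l2ip M (\<lambda>x. vec_Re (f x)) (\<lambda>x. cvec (w x)) = of_real (Re (l2ip M f (\<lambda>x. cvec (w x))))"
  using l2ip_integrable[OF assms] by (simp add: l2ip_def cinner_vec_Re_cvec)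

lemma weak_curlI: "has_weak_curl S v c \<Longrightarrow> has_weak_curl S v (weak_curl S v)"
  unfolding weak_curl_def by (rule someI[where P = "has_weak_curl S v"])

lemma has_weak_curl_L2: "has_weak_curl S v c \<Longrightarrow> c \<in> L2 (lebesgue_on S)"
  by (simp add: has_weak_curl_def)

lemma open_sets_lebesgue: "open S \<Longrightarrow> S \<in> sets lebesgue"
  by (simp add: borel_open)

lemma has_weak_curl_unique:
  assumes S: "open S" and c: "has_weak_curl S v c" "has_weak_curl S v c'"
  shows "AE x in lebesgue_on S. c x = c' x"
proof -
  have L: "c \<in> L2 (lebesgue_on S)" "c' \<in> L2 (lebesgue_on S)"
    using c by (auto intro: has_weak_curl_L2)
  have "AE x in lebesgue_on S. c x - c' x = 0"
  proof (rule L2_zero_of_test_fields_lebesgue[OF S L2_diff(1)[OF L]])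
    fix w assume w: "test_field w" "fsupp w \<subseteq> S"
    then show "l2ip (lebesgue_on S) (\<lambda>x. c x - c' x) (\<lambda>x. cvec (w x)) = 0"
      using c l2ip_diff_left[OF L test_field_L2_lebesgue_on(1)[OF w(1) open_sets_lebesgue[OF S]]]
      by (simp add: has_weak_curl_def)
  qed
  then show ?thesis by simp
qed

lemma weak_curl_AE:
  assumes "open S" "has_weak_curl S v c"
  shows "AE x in lebesgue_on S. weak_curl S v x = c x"
  by (rule has_weak_curl_unique[OF assms(1) weak_curlI[OF assms(2)] assms(2)])

lemma has_weak_curl_diff:
  assumes "open S" "f \<in> L2 (lebesgue_on S)" "g \<in> L2 (lebesgue_on S)" "has_weak_curl S f c" "has_weak_curl S g d"
  shows "has_weak_curl S (\<lambda>x. f x - g x) (\<lambda>x. c x - d x)"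
  using assms test_field_L2_lebesgue_on[OF _ open_sets_lebesgue[OF assms(1)]]
  by (simp add: has_weak_curl_def L2_diff l2ip_diff_left)

lemma has_weak_curl_scale:
  assumes "has_weak_curl S f c"
  shows "has_weak_curl S (\<lambda>x. k *s f x) (\<lambda>x. k *s c x)"
  using assms by (simp add: has_weak_curl_def L2_scale l2ip_scale_left)

lemma has_weak_curl_vec_Re:
  assumes "open S" "f \<in> L2 (lebesgue_on S)" "has_weak_curl S f c"
  shows "has_weak_curl S (\<lambda>x. vec_Re (f x)) (\<lambda>x. vec_Re (c x))"
  using assms test_field_L2_lebesgue_on[OF _ open_sets_lebesgue[OF assms(1)]]
  by (simp add: has_weak_curl_def L2_vec_Re l2ip_vec_Re_cvec)

text \<open>Equal predicates make \<open>SOME\<close> choose literally the same curl for fields that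
  agree almost everywhere.\<close>

lemma has_weak_curl_cong:
  assumes "open S" "f \<in> L2 (lebesgue_on S)" "g \<in> L2 (lebesgue_on S)" "AE x in lebesgue_on S. f x = g x"
  shows "has_weak_curl S f = has_weak_curl S g"
proof (rule ext)
  fix c
  have "l2ip (lebesgue_on S) f (\<lambda>x. cvec (classical_curl w x)) = l2ip (lebesgue_on S) g (\<lambda>x. cvec (classical_curl w x))"
    if "test_field w" for w
    using L2_measurable[OF test_field_L2_lebesgue_on(2)[OF that open_sets_lebesgue[OF assms(1)]]]
    by (rule l2ip_cong_AE_left[OF assms(2,3,4)])
  then show "has_weak_curl S f c = has_weak_curl S g c"
    by (auto simp: has_weak_curl_def)
qed

section \<open>Tangential traces\<close>

lemma norm_cvec [simp]: "norm (cvec a) = norm a"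
  by (simp add: norm_vec_def cvec_def)

text \<open>Cyclic permutation of the triple product. It moves the normal onto the test field, so
  the boundary term of Green's formula becomes an ordinary pairing that is linear in
  \<open>g\<close>.\<close>

lemma cinner_ccross_cvec: "cinner (ccross (cvec n) g) (cvec w) = cinner g (cvec (cross3 w n))"
  by (simp add: cinner_def ccross_def cross3_def cvec_def sum_3 algebra_simps)

text \<open>The underlying identity g = (n . g) n - n \<times> (n \<times> g) for a unit vector n is
  left to polynomial algebra on the components.\<close>

lemma ccross_zero_tangential:
  assumes "norm n = 1" "cinner g (cvec n) = 0" "ccross (cvec n) g = 0"
  shows "g = 0"
proof -
  define a b c where "a = complex_of_real (n $ 1)" "b = complex_of_real (n $ 2)" "c = complex_of_real (n $ 3)"
  have "(n $ 1)\<^sup>2 + (n $ 2)\<^sup>2 + (n $ 3)\<^sup>2 = 1"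
    using assms(1) by (simp add: norm_eq_1 inner_vec_def sum_3 power2_eq_square)
  then have "complex_of_real ((n $ 1)\<^sup>2 + (n $ 2)\<^sup>2 + (n $ 3)\<^sup>2) = 1"
    by simp
  then have n: "a * a + b * b + c * c = 1"
    by (simp add: a_b_c_def power2_eq_square)
  have d: "g $ 1 * a + g $ 2 * b + g $ 3 * c = 0"
    using assms(2) by (simp add: cinner_def cvec_def sum_3 a_b_c_def)
  have x: "b * g $ 3 = c * g $ 2" "c * g $ 1 = a * g $ 3" "a * g $ 2 = b * g $ 1"
    using assms(3) by (simp_all add: ccross_def cvec_def vec_eq_iff forall_3 a_b_c_def)
  have "g $ 1 = 0" "g $ 2 = 0" "g $ 3 = 0"
    using n d x by algebra+
  then show ?thesis
    by (simp add: vec_eq_iff forall_3)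
qed

lemma measurable_cvec [measurable (raw)]:
  assumes "f \<in> borel_measurable M"
  shows "(\<lambda>x. cvec (f x)) \<in> borel_measurable M"
  unfolding cvec_def
  by (rule borel_measurable_vecI) (use assms in \<open>simp add: borel_measurable_of_real measurable_vec_nth\<close>)

lemma norm_cross3_le: "norm (cross3 a b) \<le> norm a * norm b"
proof -
  have "(norm (cross3 a b))\<^sup>2 \<le> (norm a * norm b)\<^sup>2"
    unfolding norm_cross by (simp add: power_mult_distrib)
  then show ?thesis
    by (meson mult_nonneg_nonneg norm_ge_zero power2_le_imp_le)
qed

section \<open>Uniqueness of traces and the spaces \<open>Xspace\<close> and
  \<open>XPspace\<close>\<close>

locale maxwell_data =
  fixes D :: maxwell
  assumes setting: "maxwell_setting D"
begin

lemma open_Omega: "open (Omega D)"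
  using setting by (simp add: maxwell_setting_def lipschitz_domain_def)

lemma Omega_sets: "Omega D \<in> sets lebesgue"
  by (rule open_sets_lebesgue[OF open_Omega])

text \<open>The closure of each part stays in the frontier, which is the union of both parts, and
  cannot meet the other part, so it stays in its own.\<close>

lemma closed_Gamma: "closed (GammaP D)" "closed (GammaI D)"
proof -
  have *: "GammaP D \<union> GammaI D = frontier (Omega D)" "closure (GammaP D) \<inter> closure (GammaI D) = {}"
    using setting by (auto simp: maxwell_setting_def)
  then have "closure (GammaP D) \<subseteq> frontier (Omega D)" "closure (GammaI D) \<subseteq> frontier (Omega D)"
    using frontier_closed[of "Omega D"] by (metis Un_upper1 Un_upper2 closure_minimal)+
  then have "closure (GammaP D) \<subseteq> GammaP D" "closure (GammaI D) \<subseteq> GammaI D"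
    using * closure_subset[of "GammaP D"] closure_subset[of "GammaI D"] by blast+
  then show "closed (GammaP D)" "closed (GammaI D)"
    by (simp_all add: closure_subset_eq)
qed

lemma radon_like_surf: "radon_like (surf D)"
  using setting by (intro radon_like_surface_measure[of "Omega D"]) (auto simp: maxwell_setting_def lipschitz_domain_def)

lemma measurable_nu [measurable]: "nu D \<in> borel_measurable (surf D)"
  using setting by (simp add: maxwell_setting_def cong: measurable_cong_sets)

lemma AE_norm_nu: "AE x in surf D. norm (nu D x) = 1"
proof -
  have "AE x in surf D. is_outward_normal (Omega D) x (nu D x)"
    using setting by (simp add: maxwell_setting_def)
  then show ?thesis
    by eventually_elim (simp add: is_outward_normal_def)
qed

text \<open>Traces are tested only with fields supported away from \<open>GammaP\<close>; this makes
  such tests sufficient for uniqueness almost everywhere.\<close>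

lemma AE_not_GammaP: "AE x in surf D. x \<notin> GammaP D"
proof -
  have "AE x in surf D. x \<in> GammaI D"
    using closed_Gamma(2) by (intro AE_surface_measure_mem) (simp add: borel_closed)
  then show ?thesis
    using setting by (auto simp: maxwell_setting_def elim!: eventually_mono)
qed

lemma cross_nu_L2:
  assumes "test_field w"
  shows "(\<lambda>x. cvec (cross3 (w x) (nu D x))) \<in> L2 (surf D)"
proof (rule L2_bound(1))
  show L: "(\<lambda>x. cvec (w x)) \<in> L2 (surf D)"
    by (rule test_field_L2(1)[OF radon_like_surf assms])
  have "continuous_on UNIV w"
    using assms[unfolded test_field_def, THEN conjunct1, rule_format, of 0] by simp
  then have [measurable]: "w \<in> borel_measurable (surf D)"
    by (intro radon_like_measurable[OF radon_like_surf] borel_measurable_continuous_onI)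
  have "(\<lambda>x. cross3 (w x) (nu D x)) \<in> borel_measurable (surf D)"
    unfolding cross3_def
  proof (rule borel_measurable_vecI)
    fix i :: 3
    show "(\<lambda>x. vector [w x $ 2 * nu D x $ 3 - w x $ 3 * nu D x $ 2, w x $ 3 * nu D x $ 1 - w x $ 1 * nu D x $ 3,
        w x $ 1 * nu D x $ 2 - w x $ 2 * nu D x $ 1] $ i) \<in> borel_measurable (surf D)"
      using exhaust_3[of i] by auto
  qed
  then show "(\<lambda>x. cvec (cross3 (w x) (nu D x))) \<in> borel_measurable (surf D)"
    by measurable
  show "AE x in surf D. norm (cvec (cross3 (w x) (nu D x))) \<le> 1 * norm (cvec (w x))"
    using AE_norm_nu
  proof eventually_elim
    case (elim x)
    then show ?case using norm_cross3_le[of "w x" "nu D x"] by simp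
  qed
qed

lemma l2ip_cross_nu:
  "l2ip (surf D) (\<lambda>x. ccross (cvec (nu D x)) (g x)) (\<lambda>x. cvec (w x)) = l2ip (surf D) g (\<lambda>x. cvec (cross3 (w x) (nu D x)))"
  by (simp add: l2ip_def cinner_ccross_cvec)

lemma has_tangential_trace_L2: "has_tangential_trace D v g \<Longrightarrow> g \<in> L2 (surf D)"
  by (simp add: has_tangential_trace_def)

text \<open>Test fields avoiding \<open>GammaP\<close> determine n \<times> (g - g') on the open
  complement of \<open>GammaP\<close>, which carries the surface measure. Both candidates are
  tangential, and a tangential vector with zero cross product against a unit normal is zero.\<close>

lemma has_tangential_trace_unique:
  assumes "has_tangential_trace D v g" "has_tangential_trace D v g'"
  shows "AE x in surf D. g x = g' x"
proof -
  define h where "h x = g x - g' x" for x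
  have L: "g \<in> L2 (surf D)" "g' \<in> L2 (surf D)"
    using assms by (auto intro: has_tangential_trace_L2)
  have h: "h \<in> L2 (surf D)"
    unfolding h_def by (rule L2_diff(1)[OF L])
  have [measurable]: "h \<in> borel_measurable (surf D)"
    by (rule L2_measurable[OF h])
  have nuh: "(\<lambda>x. ccross (cvec (nu D x)) (h x)) \<in> L2 (surf D)"
  proof (rule L2_bound(1)[OF _ h])
    show "(\<lambda>x. ccross (cvec (nu D x)) (h x)) \<in> borel_measurable (surf D)"
      unfolding ccross_def
    proof (rule borel_measurable_vecI)
      fix i :: 3
      show "(\<lambda>x. vector [cvec (nu D x) $ 2 * h x $ 3 - cvec (nu D x) $ 3 * h x $ 2,
          cvec (nu D x) $ 3 * h x $ 1 - cvec (nu D x) $ 1 * h x $ 3,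
          cvec (nu D x) $ 1 * h x $ 2 - cvec (nu D x) $ 2 * h x $ 1] $ i) \<in> borel_measurable (surf D)"
        using exhaust_3[of i] by auto
    qed
    \<comment> \<open>A crude constant: each of the three components of the cross product is at most
      2 |h|.\<close>
    show "AE x in surf D. norm (ccross (cvec (nu D x)) (h x)) \<le> 6 * norm (h x)"
      using AE_norm_nu
    proof eventually_elim
      case (elim x)
      have n: "norm (cvec (nu D x) $ i) \<le> 1" for i
        using Finite_Cartesian_Product.norm_nth_le[of "cvec (nu D x)" i] elim by simp
      have c: "norm (cvec (nu D x) $ i * h x $ j - cvec (nu D x) $ k * h x $ l) \<le> 2 * norm (h x)" for i j k l
      proof -
        have "norm (cvec (nu D x) $ i * h x $ j - cvec (nu D x) $ k * h x $ l)
            \<le> norm (cvec (nu D x) $ i) * norm (h x $ j) + norm (cvec (nu D x) $ k) * norm (h x $ l)"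
          by (metis norm_mult norm_triangle_ineq4)
        also have "\<dots> \<le> 1 * norm (h x) + 1 * norm (h x)"
          by (intro add_mono mult_mono n Finite_Cartesian_Product.norm_nth_le) auto
        finally show ?thesis by simp
      qed
      have "norm (ccross (cvec (nu D x)) (h x)) \<le> (\<Sum>i\<in>UNIV. norm (ccross (cvec (nu D x)) (h x) $ i))"
        unfolding norm_vec_def by (rule L2_set_le_sum) simp
      also have "\<dots> \<le> (\<Sum>i\<in>(UNIV::3 set). 2 * norm (h x))"
      proof (rule sum_mono)
        fix i :: 3
        show "norm (ccross (cvec (nu D x)) (h x) $ i) \<le> 2 * norm (h x)"
          using exhaust_3[of i] c by (auto simp: ccross_def)
      qed
      finally show ?case by simp
    qed
  qed
  have "AE x in surf D. x \<in> - GammaP D \<longrightarrow> ccross (cvec (nu D x)) (h x) = 0"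
  proof (rule L2_zero_of_test_fields[OF radon_like_surf _ nuh])
    show "open (- GammaP D)"
      using closed_Gamma(1) by (rule open_Compl)
    fix w assume w: "test_field w" "fsupp w \<subseteq> - GammaP D"
    then have "fsupp w \<inter> GammaP D = {}" by blast
    then have "l2ip (surf D) g (\<lambda>x. cvec (cross3 (w x) (nu D x))) = l2ip (surf D) g' (\<lambda>x. cvec (cross3 (w x) (nu D x)))"
      using assms w(1) by (simp add: has_tangential_trace_def l2ip_cross_nu)
    then show "l2ip (surf D) (\<lambda>x. ccross (cvec (nu D x)) (h x)) (\<lambda>x. cvec (w x)) = 0"
      unfolding l2ip_cross_nu unfolding h_def by (simp add: l2ip_diff_left L cross_nu_L2[OF w(1)])
  qed
  moreover have "AE x in surf D. cinner (g x) (cvec (nu D x)) = 0" "AE x in surf D. cinner (g' x) (cvec (nu D x)) = 0"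
    using assms by (simp_all add: has_tangential_trace_def)
  ultimately show ?thesis
    using AE_not_GammaP AE_norm_nu
  proof eventually_elim
    case (elim x)
    then have "h x = 0"
      by (rule_tac ccross_zero_tangential[of "nu D x"]) (simp_all add: h_def cinner_diff_left)
    then show ?case by (simp add: h_def)
  qed
qed

lemma tangential_traceI: "has_tangential_trace D v g \<Longrightarrow> has_tangential_trace D v (tangential_trace D v)"
  unfolding tangential_trace_def by (rule someI[where P = "has_tangential_trace D v"])

lemma tangential_trace_AE:
  "has_tangential_trace D v g \<Longrightarrow> AE x in surf D. tangential_trace D v x = g x"
  by (rule has_tangential_trace_unique[OF tangential_traceI])

lemma XspaceD:
  assumes "v \<in> Xspace D"
  shows "v \<in> L2 (vol D)" "has_weak_curl (Omega D) v (weak_curl (Omega D) v)"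
    "weak_curl (Omega D) v \<in> L2 (vol D)" "has_tangential_trace D v (tangential_trace D v)"
    "tangential_trace D v \<in> L2 (surf D)"
  using assms by (auto simp: Xspace_def intro: weak_curlI tangential_traceI has_tangential_trace_L2 has_weak_curl_L2)

text \<open>\<open>green\<close> refers to the chosen curl. By uniqueness any weak curl may take its
  place, which allows \<open>green\<close> to be evaluated on differences, multiples, real parts and
  time integrals of fields.\<close>

lemma green_eqI:
  assumes "has_weak_curl (Omega D) v c" "test_field w"
  shows "green D v w = l2ip (vol D) c (\<lambda>x. cvec (w x)) - l2ip (vol D) v (\<lambda>x. cvec (classical_curl w x))"
  unfolding green_def
  using l2ip_cong_AE_left[OF _ _ weak_curl_AE[OF open_Omega assms(1)] L2_measurable[OF test_field_L2_lebesgue_on(1)[OF assms(2) Omega_sets]]]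
    has_weak_curl_L2[OF assms(1)] has_weak_curl_L2[OF weak_curlI[OF assms(1)]]
  by simp

lemma test_field_vol:
  "test_field w \<Longrightarrow> (\<lambda>x. cvec (w x)) \<in> L2 (vol D)"
  "test_field w \<Longrightarrow> (\<lambda>x. cvec (classical_curl w x)) \<in> L2 (vol D)"
  using test_field_L2_lebesgue_on[OF _ Omega_sets] by auto

lemma green_diff:
  assumes "f \<in> Xspace D" "g \<in> Xspace D" "test_field w"
  shows "green D (\<lambda>x. f x - g x) w = green D f w - green D g w"
proof -
  note f = XspaceD[OF assms(1)] and g = XspaceD[OF assms(2)]
  show ?thesis
    unfolding green_eqI[OF has_weak_curl_diff[OF open_Omega f(1) g(1) f(2) g(2)] assms(3)]
    using test_field_vol[OF assms(3)] f g by (simp add: green_def l2ip_diff_left)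
qed

lemma green_scale:
  assumes "f \<in> Xspace D" "test_field w"
  shows "green D (\<lambda>x. k *s f x) w = k * green D f w"
  unfolding green_eqI[OF has_weak_curl_scale[OF XspaceD(2)[OF assms(1)]] assms(2)]
  by (simp add: green_def l2ip_scale_left algebra_simps)

lemma green_vec_Re:
  assumes "f \<in> Xspace D" "test_field w"
  shows "green D (\<lambda>x. vec_Re (f x)) w = of_real (Re (green D f w))"
  unfolding green_eqI[OF has_weak_curl_vec_Re[OF open_Omega XspaceD(1,2)[OF assms(1)]] assms(2)]
  using XspaceD[OF assms(1)] test_field_vol[OF assms(2)] by (simp add: green_def l2ip_vec_Re_cvec)

lemma has_tangential_trace_diff:
  assumes "f \<in> Xspace D" "g \<in> Xspace D"
  shows "has_tangential_trace D (\<lambda>x. f x - g x) (\<lambda>x. tangential_trace D f x - tangential_trace D g x)"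
  unfolding has_tangential_trace_def l2ip_cross_nu
proof (intro conjI allI impI)
  note f = XspaceD(4,5)[OF assms(1)] and g = XspaceD(4,5)[OF assms(2)]
  show "(\<lambda>x. tangential_trace D f x - tangential_trace D g x) \<in> L2 (surf D)"
    by (rule L2_diff(1)[OF f(2) g(2)])
  have "AE x in surf D. cinner (tangential_trace D f x) (cvec (nu D x)) = 0"
    "AE x in surf D. cinner (tangential_trace D g x) (cvec (nu D x)) = 0"
    using f(1) g(1) by (simp_all add: has_tangential_trace_def)
  then show "AE x in surf D. cinner (tangential_trace D f x - tangential_trace D g x) (cvec (nu D x)) = 0"
    by eventually_elim (simp add: cinner_diff_left)
  fix w assume w: "test_field w \<and> fsupp w \<inter> GammaP D = {}"
  then show "green D (\<lambda>x. f x - g x) w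
      = l2ip (surf D) (\<lambda>x. tangential_trace D f x - tangential_trace D g x) (\<lambda>x. cvec (cross3 (w x) (nu D x)))"
    using f(1) g(1) unfolding has_tangential_trace_def l2ip_cross_nu
    by (simp add: green_diff[OF assms] l2ip_diff_left[OF f(2) g(2)] cross_nu_L2)
qed

lemma has_tangential_trace_scale:
  assumes "f \<in> Xspace D"
  shows "has_tangential_trace D (\<lambda>x. k *s f x) (\<lambda>x. k *s tangential_trace D f x)"
  using XspaceD(4,5)[OF assms] green_scale[OF assms]
  by (simp add: has_tangential_trace_def l2ip_cross_nu L2_scale l2ip_scale_left cinner_scale_left)

lemma has_tangential_trace_vec_Re:
  assumes "f \<in> Xspace D"
  shows "has_tangential_trace D (\<lambda>x. vec_Re (f x)) (\<lambda>x. vec_Re (tangential_trace D f x))"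
proof -
  note t = XspaceD(4,5)[OF assms]
  have "AE x in surf D. cinner (tangential_trace D f x) (cvec (nu D x)) = 0"
    using t(1) by (simp add: has_tangential_trace_def)
  then have "AE x in surf D. cinner (vec_Re (tangential_trace D f x)) (cvec (nu D x)) = 0"
    by eventually_elim (simp add: cinner_vec_Re_cvec)
  then show ?thesis
    using t green_vec_Re[OF assms] cross_nu_L2
    by (simp add: has_tangential_trace_def l2ip_cross_nu L2_vec_Re l2ip_vec_Re_cvec)
qed

lemma Xspace_diff:
  assumes "f \<in> Xspace D" "g \<in> Xspace D"
  shows "(\<lambda>x. f x - g x) \<in> Xspace D"
    and "AE x in vol D. weak_curl (Omega D) (\<lambda>x. f x - g x) x = weak_curl (Omega D) f x - weak_curl (Omega D) g x"
    and "AE x in surf D. tangential_trace D (\<lambda>x. f x - g x) x = tangential_trace D f x - tangential_trace D g x"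
proof -
  note f = XspaceD[OF assms(1)] and g = XspaceD[OF assms(2)]
  note c = has_weak_curl_diff[OF open_Omega f(1) g(1) f(2) g(2)] and t = has_tangential_trace_diff[OF assms]
  show "(\<lambda>x. f x - g x) \<in> Xspace D"
    using L2_diff(1)[OF f(1) g(1)] c t by (auto simp: Xspace_def)
  show "AE x in vol D. weak_curl (Omega D) (\<lambda>x. f x - g x) x = weak_curl (Omega D) f x - weak_curl (Omega D) g x"
    by (rule weak_curl_AE[OF open_Omega c])
  show "AE x in surf D. tangential_trace D (\<lambda>x. f x - g x) x = tangential_trace D f x - tangential_trace D g x"
    by (rule tangential_trace_AE[OF t])
qed

lemma Xspace_scale:
  assumes "f \<in> Xspace D"
  shows "(\<lambda>x. k *s f x) \<in> Xspace D"
    and "AE x in vol D. weak_curl (Omega D) (\<lambda>x. k *s f x) x = k *s weak_curl (Omega D) f x"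
    and "AE x in surf D. tangential_trace D (\<lambda>x. k *s f x) x = k *s tangential_trace D f x"
proof -
  note f = XspaceD[OF assms]
  note c = has_weak_curl_scale[OF f(2)] and t = has_tangential_trace_scale[OF assms]
  show "(\<lambda>x. k *s f x) \<in> Xspace D"
    using L2_scale(1)[OF f(1)] c t by (auto simp: Xspace_def)
  show "AE x in vol D. weak_curl (Omega D) (\<lambda>x. k *s f x) x = k *s weak_curl (Omega D) f x"
    by (rule weak_curl_AE[OF open_Omega c])
  show "AE x in surf D. tangential_trace D (\<lambda>x. k *s f x) x = k *s tangential_trace D f x"
    by (rule tangential_trace_AE[OF t])
qed

lemma Xspace_vec_Re:
  assumes "f \<in> Xspace D"
  shows "(\<lambda>x. vec_Re (f x)) \<in> Xspace D"
  using L2_vec_Re[OF XspaceD(1)[OF assms]] has_weak_curl_vec_Re[OF open_Omega XspaceD(1,2)[OF assms]]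
    has_tangential_trace_vec_Re[OF assms] by (auto simp: Xspace_def)

lemma XPspace_Xspace: "f \<in> XPspace D \<Longrightarrow> f \<in> Xspace D"
  by (simp add: XPspace_def)

lemma XPspace_diff: "f \<in> XPspace D \<Longrightarrow> g \<in> XPspace D \<Longrightarrow> (\<lambda>x. f x - g x) \<in> XPspace D"
  by (simp add: XPspace_def zero_trace_GammaP_def green_diff Xspace_diff(1))

lemma XPspace_scale: "f \<in> XPspace D \<Longrightarrow> (\<lambda>x. k *s f x) \<in> XPspace D"
  by (simp add: XPspace_def zero_trace_GammaP_def green_scale Xspace_scale(1))

lemma XPspace_vec_Re: "f \<in> XPspace D \<Longrightarrow> (\<lambda>x. vec_Re (f x)) \<in> XPspace D"
  by (simp add: XPspace_def zero_trace_GammaP_def green_vec_Re Xspace_vec_Re)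

text \<open>The defining predicates of the two representatives coincide, so the chosen curls and
  traces are equal as functions, not merely almost everywhere.\<close>

lemma Xspace_cong:
  assumes "f \<in> L2 (vol D)" "g \<in> Xspace D" "AE x in vol D. f x = g x"
  shows "weak_curl (Omega D) f = weak_curl (Omega D) g" "tangential_trace D f = tangential_trace D g"
    "f \<in> Xspace D" "g \<in> XPspace D \<Longrightarrow> f \<in> XPspace D"
proof -
  have hc: "has_weak_curl (Omega D) f = has_weak_curl (Omega D) g"
    by (rule has_weak_curl_cong[OF open_Omega assms(1) XspaceD(1)[OF assms(2)] assms(3)])
  then show c: "weak_curl (Omega D) f = weak_curl (Omega D) g"
    by (simp add: weak_curl_def)
  have gr: "green D f w = green D g w" if "test_field w" for w
    unfolding green_def c
    using l2ip_cong_AE_left[OF assms(1) XspaceD(1)[OF assms(2)] assms(3) L2_measurable[OF test_field_vol(2)[OF that]]]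
    by simp
  then have ht: "has_tangential_trace D f = has_tangential_trace D g"
    by (auto simp: has_tangential_trace_def fun_eq_iff)
  then show "tangential_trace D f = tangential_trace D g"
    by (simp add: tangential_trace_def)
  show "f \<in> Xspace D"
    using assms(1,2) hc ht by (simp add: Xspace_def)
  then show "f \<in> XPspace D" if "g \<in> XPspace D"
    using that gr by (simp add: XPspace_def zero_trace_GammaP_def)
qed

text \<open>The curl path and the trace path have integrals of their own. Weak curl, trace and
  vanishing trace are all linear identities against fixed tests; integrating these in time and using
  uniqueness of scalar integrals identifies the two integrals as curl and trace of
  \<open>G\<close>.\<close>

lemma Xspace_path_integral:
  assumes "a \<le> b" and X: "\<And>t. t \<in> {a..b} \<Longrightarrow> f t \<in> Xspace D"
    and curl: "l2_continuous (vol D) {a..b} (\<lambda>t. weak_curl (Omega D) (f t))"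
    and trace: "l2_continuous (surf D) {a..b} (\<lambda>t. tangential_trace D (f t))"
    and G: "G \<in> L2 (vol D)" "\<And>v. v \<in> L2 (vol D) \<Longrightarrow> ((\<lambda>t. l2ip (vol D) (f t) v) has_integral l2ip (vol D) G v) {a..b}"
  shows "G \<in> Xspace D"
    and "v \<in> L2 (vol D) \<Longrightarrow> ((\<lambda>t. l2ip (vol D) (weak_curl (Omega D) (f t)) v) has_integral l2ip (vol D) (weak_curl (Omega D) G) v) {a..b}"
    and "u \<in> L2 (surf D) \<Longrightarrow> ((\<lambda>t. l2ip (surf D) (tangential_trace D (f t)) u) has_integral l2ip (surf D) (tangential_trace D G) u) {a..b}"
    and "(\<And>t. t \<in> {a..b} \<Longrightarrow> f t \<in> XPspace D) \<Longrightarrow> G \<in> XPspace D"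
proof -
  obtain c where c: "c \<in> L2 (vol D)" "\<And>v. v \<in> L2 (vol D) \<Longrightarrow> ((\<lambda>t. l2ip (vol D) (weak_curl (Omega D) (f t)) v) has_integral l2ip (vol D) c v) {a..b}"
  proof (rule l2_path_integral[OF \<open>a \<le> b\<close> curl])
    fix c
    assume "c \<in> L2 (vol D)"
      and "\<And>v. v \<in> L2 (vol D) \<Longrightarrow> ((\<lambda>t. l2ip (vol D) (weak_curl (Omega D) (f t)) v) has_integral l2ip (vol D) c v) {a..b}"
    then show thesis by (rule that)
  qed
  obtain g where g: "g \<in> L2 (surf D)" "\<And>v. v \<in> L2 (surf D) \<Longrightarrow> ((\<lambda>t. l2ip (surf D) (tangential_trace D (f t)) v) has_integral l2ip (surf D) g v) {a..b}"
  proof (rule l2_path_integral[OF \<open>a \<le> b\<close> trace])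
    fix g
    assume "g \<in> L2 (surf D)"
      and "\<And>v. v \<in> L2 (surf D) \<Longrightarrow> ((\<lambda>t. l2ip (surf D) (tangential_trace D (f t)) v) has_integral l2ip (surf D) g v) {a..b}"
    then show thesis by (rule that)
  qed
  have hc: "has_weak_curl (Omega D) G c"
    unfolding has_weak_curl_def
  proof (intro conjI allI impI c(1))
    fix w assume w: "test_field w \<and> fsupp w \<subseteq> Omega D"
    have "l2ip (vol D) (f t) (\<lambda>x. cvec (classical_curl w x)) = l2ip (vol D) (weak_curl (Omega D) (f t)) (\<lambda>x. cvec (w x))"
      if "t \<in> {a..b}" for t
      using XspaceD(2)[OF X[OF that]] w by (simp add: has_weak_curl_def)
    then have "((\<lambda>t. l2ip (vol D) (weak_curl (Omega D) (f t)) (\<lambda>x. cvec (w x))) has_integral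
        l2ip (vol D) G (\<lambda>x. cvec (classical_curl w x))) {a..b}"
      using w by (intro has_integral_eq[OF _ G(2)[OF test_field_vol(2)]]) auto
    then show "l2ip (vol D) G (\<lambda>x. cvec (classical_curl w x)) = l2ip (vol D) c (\<lambda>x. cvec (w x))"
      using c(2)[OF test_field_vol(1)] w by (blast intro: has_integral_unique)
  qed
  have gr: "((\<lambda>t. green D (f t) w) has_integral green D G w) {a..b}" if "test_field w" for w
    unfolding green_eqI[OF hc that] unfolding green_def
    by (intro has_integral_diff c G test_field_vol that)
  have nut: "AE x in surf D. cinner (g x) (cvec (nu D x)) = 0"
  proof -
    \<comment> \<open>The normal component of \<open>g\<close>, as a vector field. It is orthogonal
      to every trace of the path and hence to their integral \<open>g\<close>, while its pairing
      with \<open>g\<close> equals its own squared norm.\<close>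
    define k where "k x = cinner (g x) (cvec (nu D x)) *s cvec (nu D x)" for x
    have [measurable]: "g \<in> borel_measurable (surf D)"
      using g(1) by (rule L2_measurable)
    have k: "k \<in> L2 (surf D)"
    proof (rule L2_bound(1)[OF _ g(1)])
      show "k \<in> borel_measurable (surf D)"
        unfolding k_def by measurable
      show "AE x in surf D. norm (k x) \<le> 1 * norm (g x)"
        using AE_norm_nu
      proof eventually_elim
        case (elim x)
        then show ?case
          using cmod_cinner_le[of "g x" "cvec (nu D x)"] by (simp add: k_def norm_scale)
      qed
    qed
    have "l2ip (surf D) (tangential_trace D (f t)) k = 0" if "t \<in> {a..b}" for t
    proof -
      have "AE x in surf D. cinner (tangential_trace D (f t) x) (cvec (nu D x)) = 0"
        using XspaceD(4)[OF X[OF that]] by (simp add: has_tangential_trace_def)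
      then have "AE x in surf D. cinner (tangential_trace D (f t) x) (k x) = 0"
        by eventually_elim (simp add: k_def cinner_scale_right)
      then show ?thesis
        unfolding l2ip_def by (rule integral_eq_zero_AE)
    qed
    then have "((\<lambda>t. 0) has_integral l2ip (surf D) g k) {a..b}"
      by (intro has_integral_eq[OF _ g(2)[OF k]]) auto
    then have "l2ip (surf D) g k = 0"
      using has_integral_0 has_integral_unique by blast
    moreover have "l2ip (surf D) g k = l2ip (surf D) k k"
      unfolding l2ip_def
    proof (rule integral_cong_AE)
      show "AE x in surf D. cinner (g x) (k x) = cinner (k x) (k x)"
        using AE_norm_nu
      proof eventually_elim
        case (elim x)
        then have "cinner (cvec (nu D x)) (cvec (nu D x)) = 1"
          by (simp add: cinner_self)
        then show ?case
          by (simp add: k_def cinner_scale_right cinner_scale_left)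
      qed
    qed (use L2_measurable[OF k] in measurable)
    ultimately have "l2sq (surf D) k = 0"
      by (simp add: l2ip_self)
    then have "AE x in surf D. k x = 0"
      using l2sq_zero_iff[OF k] by simp
    then show ?thesis
      using AE_norm_nu
    proof eventually_elim
      case (elim x)
      then have "norm (k x) = cmod (cinner (g x) (cvec (nu D x)))"
        unfolding k_def norm_scale by simp
      then show ?case
        using elim by simp
    qed
  qed
  have ht: "has_tangential_trace D G g"
    unfolding has_tangential_trace_def l2ip_cross_nu
  proof (intro conjI allI impI g(1) nut)
    fix w assume w: "test_field w \<and> fsupp w \<inter> GammaP D = {}"
    have "green D (f t) w = l2ip (surf D) (tangential_trace D (f t)) (\<lambda>x. cvec (cross3 (w x) (nu D x)))"
      if "t \<in> {a..b}" for t
      using XspaceD(4)[OF X[OF that]] w by (simp add: has_tangential_trace_def l2ip_cross_nu)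
    then have "((\<lambda>t. l2ip (surf D) (tangential_trace D (f t)) (\<lambda>x. cvec (cross3 (w x) (nu D x)))) has_integral green D G w) {a..b}"
      using w by (intro has_integral_eq[OF _ gr]) auto
    then show "green D G w = l2ip (surf D) g (\<lambda>x. cvec (cross3 (w x) (nu D x)))"
      using g(2)[OF cross_nu_L2] w by (blast intro: has_integral_unique)
  qed
  show X': "G \<in> Xspace D"
    using G(1) hc ht by (auto simp: Xspace_def)
  show "((\<lambda>t. l2ip (vol D) (weak_curl (Omega D) (f t)) v) has_integral l2ip (vol D) (weak_curl (Omega D) G) v) {a..b}"
    if "v \<in> L2 (vol D)"
    using c(2)[OF that] l2ip_cong_AE_left[OF XspaceD(3)[OF X'] c(1) weak_curl_AE[OF open_Omega hc] L2_measurable[OF that]]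
    by simp
  show "((\<lambda>t. l2ip (surf D) (tangential_trace D (f t)) u) has_integral l2ip (surf D) (tangential_trace D G) u) {a..b}"
    if "u \<in> L2 (surf D)"
    using g(2)[OF that] l2ip_cong_AE_left[OF XspaceD(5)[OF X'] g(1) tangential_trace_AE[OF ht] L2_measurable[OF that]]
    by simp
  show "G \<in> XPspace D" if XP: "\<And>t. t \<in> {a..b} \<Longrightarrow> f t \<in> XPspace D"
    unfolding XPspace_def zero_trace_GammaP_def
  proof (intro CollectI conjI X' allI impI)
    fix w assume w: "test_field w \<and> fsupp w \<inter> GammaI D = {}"
    then have "green D (f t) w = 0" if "t \<in> {a..b}" for t
      using XP[OF that] by (simp add: XPspace_def zero_trace_GammaP_def)
    then have "((\<lambda>t. 0) has_integral green D G w) {a..b}"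
      using w by (intro has_integral_eq[OF _ gr]) auto
    then show "green D G w = 0"
      using has_integral_0 has_integral_unique by blast
  qed
qed

end

section \<open>Matrix-valued coefficients\<close>

lemma measurable_matrixI:
  fixes A :: "'b \<Rightarrow> real^3^3"
  assumes "\<And>i j. (\<lambda>x. A x $ i $ j) \<in> borel_measurable M"
  shows "A \<in> borel_measurable M"
  by (rule borel_measurable_vecI, rule borel_measurable_vecI, rule assms)

lemma cinner_cmat: "cinner (cmat A *v u) v = cinner u (cmat (transpose A) *v v)"
  by (simp add: cinner_def cmat_def matrix_vector_mult_def transpose_def sum_3 algebra_simps)

lemma norm_le_sum_components: "norm (u :: 'a::real_normed_vector^3) \<le> (\<Sum>i\<in>UNIV. norm (u $ i))"
  unfolding norm_vec_def by (rule L2_set_le_sum) simp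

lemma norm_cmat_mult_le: "norm (cmat A *v u) \<le> 9 * norm A * norm u"
proof -
  have "norm ((cmat A *v u) $ i) \<le> 3 * (norm A * norm u)" for i
  proof -
    have "norm ((cmat A *v u) $ i) \<le> (\<Sum>j\<in>UNIV. norm (complex_of_real (A $ i $ j) * u $ j))"
      unfolding matrix_vector_mult_def cmat_def by (simp add: norm_sum)
    also have "\<dots> \<le> (\<Sum>j\<in>(UNIV::3 set). norm A * norm u)"
    proof (rule sum_mono)
      fix j
      have "\<bar>A $ i $ j\<bar> \<le> norm A"
        using Finite_Cartesian_Product.norm_nth_le[of "A $ i" j] Finite_Cartesian_Product.norm_nth_le[of A i] by simp
      then show "norm (complex_of_real (A $ i $ j) * u $ j) \<le> norm A * norm u"
        unfolding norm_mult norm_of_real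
        by (intro mult_mono Finite_Cartesian_Product.norm_nth_le) auto
    qed
    finally show ?thesis by simp
  qed
  then have "(\<Sum>i\<in>UNIV. norm ((cmat A *v u) $ i)) \<le> (\<Sum>i\<in>(UNIV::3 set). 3 * (norm A * norm u))"
    by (rule sum_mono)
  then show ?thesis
    using norm_le_sum_components[of "cmat A *v u"] by simp
qed

lemma cmat_mult_cvec: "cmat A *v cvec u = cvec (A *v u)"
  by (simp add: cmat_def cvec_def matrix_vector_mult_def vec_eq_iff)

lemma norm_matrix_mult_le: "norm (A *v u) \<le> 9 * norm A * norm u" for A :: "real^3^3"
  using norm_cmat_mult_le[of A "cvec u"] by (simp add: cmat_mult_cvec)

text \<open>Each entry is a component of the image of a unit coordinate vector, and the factor 9
  counts the entries.\<close>

lemma norm_matrix_le: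
  fixes A :: "real^3^3"
  assumes "\<And>u. norm (A *v u) \<le> K * norm u"
  shows "norm A \<le> 9 * K"
proof -
  have "\<bar>A $ i $ j\<bar> \<le> K" for i j
  proof -
    have "A $ i $ j = (A *v axis j 1) $ i"
      by (simp add: matrix_vector_mult_basis column_def)
    then have "\<bar>A $ i $ j\<bar> \<le> norm (A *v axis j 1)"
      by (metis component_le_norm_cart)
    also have "\<dots> \<le> K"
      using assms[of "axis j 1"] by (simp add: norm_axis_1)
    finally show ?thesis .
  qed
  then have row: "norm (A $ i) \<le> 3 * K" for i
    using norm_le_l1_cart[of "A $ i"] sum_mono[of UNIV "\<lambda>j. \<bar>A $ i $ j\<bar>" "\<lambda>_. K"] by simp
  have "(\<Sum>i\<in>UNIV. norm (A $ i)) \<le> (\<Sum>i\<in>(UNIV::3 set). 3 * K)"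
    by (rule sum_mono) (rule row)
  then show ?thesis
    using norm_le_sum_components[of A] by simp
qed

text \<open>For u = a + i b and a real matrix the mixed terms in a and b are purely imaginary. This
  is how ellipticity, stated for real vectors, reaches complex fields.\<close>

lemma Re_cinner_cmat:
  "Re (cinner (cmat A *v u) u) = (\<chi> i. Re (u $ i)) \<bullet> (A *v (\<chi> i. Re (u $ i))) + (\<chi> i. Im (u $ i)) \<bullet> (A *v (\<chi> i. Im (u $ i)))"
  by (simp add: cinner_def cmat_def matrix_vector_mult_def inner_vec_def sum_3 algebra_simps)

lemma norm_sq_Re_Im: "(norm u)\<^sup>2 = (norm (\<chi> i. Re (u $ i)))\<^sup>2 + (norm (\<chi> i. Im (u $ i)))\<^sup>2"
  for u :: "complex^3"
  by (simp add: power2_norm_eq_inner inner_vec_def inner_complex_def sum_3)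

text \<open>P selects the vectors on which ellipticity holds: all of them in the volume, the
  tangential ones on the boundary.\<close>

lemma Re_cinner_cmat_ge:
  assumes "\<And>\<xi>. P \<xi> \<Longrightarrow> c * (norm \<xi>)\<^sup>2 \<le> \<xi> \<bullet> (A *v \<xi>)"
    and "P (\<chi> i. Re (u $ i))" "P (\<chi> i. Im (u $ i))"
  shows "c * (norm u)\<^sup>2 \<le> Re (cinner (cmat A *v u) u)"
  unfolding Re_cinner_cmat norm_sq_Re_Im[of u] distrib_left
  by (intro add_mono assms)

text \<open>A bound almost everywhere covers the volume coefficients, which are bounded at every
  point, as well as the boundary coefficients, which are controlled only up to null sets.\<close>

definition bounded_coeff :: "(real^3) measure \<Rightarrow> (real^3 \<Rightarrow> real^3^3) \<Rightarrow> bool" where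
  "bounded_coeff M A \<longleftrightarrow> A \<in> borel_measurable M \<and> (\<exists>B. AE x in M. norm (A x) \<le> B)"

lemma bounded_coeff_transpose:
  assumes "bounded_coeff M A"
  shows "bounded_coeff M (\<lambda>x. transpose (A x))"
proof -
  have [measurable]: "A \<in> borel_measurable M"
    using assms by (simp add: bounded_coeff_def)
  obtain B where B: "AE x in M. norm (A x) \<le> B"
    using assms by (auto simp: bounded_coeff_def)
  have "(\<lambda>x. transpose (A x)) \<in> borel_measurable M"
    unfolding transpose_def by (rule measurable_matrixI) simp
  moreover have "norm (transpose X) = norm X" for X :: "real^3^3"
    by (simp add: norm_eq_sqrt_inner inner_vec_def transpose_def sum_3 algebra_simps)
  ultimately show ?thesis
    using B by (auto simp: bounded_coeff_def)
qed

lemma measurable_cmat_mult: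
  assumes [measurable]: "A \<in> borel_measurable M" "f \<in> borel_measurable M"
  shows "(\<lambda>x. cmat (A x) *v f x) \<in> borel_measurable M"
proof (rule borel_measurable_vecI)
  fix i
  have "(\<lambda>x. \<Sum>j\<in>UNIV. complex_of_real (A x $ i $ j) * f x $ j) \<in> borel_measurable M"
    by measurable
  then show "(\<lambda>x. (cmat (A x) *v f x) $ i) \<in> borel_measurable M"
    by (simp add: matrix_vector_mult_def cmat_def)
qed

lemma bounded_coeff_L2:
  assumes "bounded_coeff M A"
  obtains C where "\<And>f. f \<in> L2 M \<Longrightarrow> (\<lambda>x. cmat (A x) *v f x) \<in> L2 M"
    "\<And>f. f \<in> L2 M \<Longrightarrow> l2sq M (\<lambda>x. cmat (A x) *v f x) \<le> C * l2sq M f" "0 \<le> C"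
proof -
  have A: "A \<in> borel_measurable M"
    using assms by (simp add: bounded_coeff_def)
  obtain B where B: "AE x in M. norm (A x) \<le> B"
    using assms by (auto simp: bounded_coeff_def)
  have *: "(\<lambda>x. cmat (A x) *v f x) \<in> L2 M" "l2sq M (\<lambda>x. cmat (A x) *v f x) \<le> (9 * B)\<^sup>2 * l2sq M f"
    if f: "f \<in> L2 M" for f
  proof -
    have m: "(\<lambda>x. cmat (A x) *v f x) \<in> borel_measurable M"
      by (intro measurable_cmat_mult A L2_measurable[OF f])
    have b: "AE x in M. norm (cmat (A x) *v f x) \<le> (9 * B) * norm (f x)"
      using B
    proof eventually_elim
      case (elim x)
      have "norm (cmat (A x) *v f x) \<le> 9 * norm (A x) * norm (f x)"
        by (rule norm_cmat_mult_le)
      also have "\<dots> \<le> 9 * B * norm (f x)"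
        using elim by (intro mult_right_mono) auto
      finally show ?case .
    qed
    show "(\<lambda>x. cmat (A x) *v f x) \<in> L2 M" "l2sq M (\<lambda>x. cmat (A x) *v f x) \<le> (9 * B)\<^sup>2 * l2sq M f"
      by (rule L2_bound[OF m f b])+
  qed
  show thesis
    by (rule that[of "(9 * B)\<^sup>2"]) (use * in auto)
qed

lemma coeff_mult_L2:
  assumes "bounded_coeff M A" "f \<in> L2 M"
  shows "(\<lambda>x. cmat (A x) *v f x) \<in> L2 M"
  by (rule bounded_coeff_L2[OF assms(1)]) (use assms(2) in blast)

text \<open>With the coefficient moved to the second slot, the first argument occurs in a plain
  pairing with a fixed square-integrable field. Linearity and integration in time of the weighted
  forms then reduce to those of \<open>l2ip\<close>.\<close>

lemma wip_transpose: "wip M A f g = l2ip M f (\<lambda>x. cmat (transpose (A x)) *v g x)"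
  by (simp add: wip_def l2ip_def cinner_cmat)

lemma wnorm2_ge:
  assumes "bounded_coeff M A" "f \<in> L2 M" "AE x in M. c * (norm (f x))\<^sup>2 \<le> Re (cinner (cmat (A x) *v f x) (f x))"
  shows "c * l2sq M f \<le> wnorm2 M A f"
proof -
  have int: "integrable M (\<lambda>x. cinner (cmat (A x) *v f x) (f x))"
    by (rule l2ip_integrable[OF coeff_mult_L2[OF assms(1,2)] assms(2)])
  have "c * l2sq M f = (LINT x|M. c * (norm (f x))\<^sup>2)"
    by (simp add: l2sq_def)
  also have "\<dots> \<le> (LINT x|M. Re (cinner (cmat (A x) *v f x) (f x)))"
    using int L2_integrable[OF assms(2)] assms(3) by (intro integral_mono_AE) auto
  also have "\<dots> = wnorm2 M A f"
    using int by (simp add: wnorm2_def wip_def l2ip_def)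
  finally show ?thesis .
qed

lemma wnorm2_le:
  assumes "bounded_coeff M A"
  shows "\<exists>C. 0 \<le> C \<and> (\<forall>f\<in>L2 M. wnorm2 M A f \<le> C * l2sq M f)"
proof (rule bounded_coeff_L2[OF assms])
  fix C
  assume C: "\<And>f. f \<in> L2 M \<Longrightarrow> (\<lambda>x. cmat (A x) *v f x) \<in> L2 M"
    "\<And>f. f \<in> L2 M \<Longrightarrow> l2sq M (\<lambda>x. cmat (A x) *v f x) \<le> C * l2sq M f" "0 \<le> C"
  have "wnorm2 M A f \<le> sqrt C * l2sq M f" if f: "f \<in> L2 M" for f
  proof -
    have "wnorm2 M A f \<le> sqrt (l2sq M (\<lambda>x. cmat (A x) *v f x)) * sqrt (l2sq M f)"
      unfolding wnorm2_def wip_def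
      by (rule order_trans[OF complex_Re_le_cmod cmod_l2ip_le[OF C(1)[OF f] f]])
    also have "\<dots> \<le> sqrt (C * l2sq M f) * sqrt (l2sq M f)"
      using C(2)[OF f] by (intro mult_right_mono) auto
    also have "\<dots> = sqrt C * l2sq M f"
      by (simp add: real_sqrt_mult)
    finally show ?thesis .
  qed
  then show ?thesis
    using C(3) by (intro exI[of _ "sqrt C"]) auto
qed

lemma matrix_inv_inverse:
  assumes "invertible (A :: real^3^3)"
  shows "A ** matrix_inv A = mat 1" "matrix_inv A ** A = mat 1"
  using someI_ex[OF assms[unfolded invertible_def]] by (simp_all add: matrix_inv_def)

text \<open>Cramer's rule gives a formula from which measurability of inverses can be read off.\<close>

definition cramer_inverse :: "real^3^3 \<Rightarrow> real^3^3" where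
  "cramer_inverse A = (\<chi> k j. det (\<chi> i l. if l = k then axis j 1 $ i else A $ i $ l) / det A)"

lemma matrix_inv_eq_cramer_inverse:
  assumes "invertible A"
  shows "matrix_inv A = cramer_inverse A"
proof -
  have "matrix_inv A $ k $ j = cramer_inverse A $ k $ j" for k j
  proof -
    have "A *v (matrix_inv A *v axis j 1) = axis j 1"
      using matrix_inv_inverse(1)[OF assms] by (simp add: matrix_vector_mul_assoc)
    then have "matrix_inv A *v axis j 1
        = (\<chi> k. det (\<chi> i l. if l = k then axis j 1 $ i else A $ i $ l) / det A)"
      using cramer[of A "matrix_inv A *v axis j 1" "axis j 1"] assms by (simp add: invertible_det_nz)
    then have "(matrix_inv A *v axis j 1) $ k = cramer_inverse A $ k $ j"
      by (simp add: cramer_inverse_def)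
    then show ?thesis
      by (simp add: matrix_vector_mult_basis column_def)
  qed
  then show ?thesis
    by (simp add: vec_eq_iff)
qed

lemma measurable_cramer_inverse:
  assumes [measurable]: "A \<in> borel_measurable M"
  shows "(\<lambda>x. cramer_inverse (A x)) \<in> borel_measurable M"
proof (rule measurable_matrixI)
  fix k j :: 3
  have [measurable]: "(\<lambda>x. if l = k then c else A x $ i $ l) \<in> borel_measurable M" for c i l
    by (cases "l = k") simp_all
  show "(\<lambda>x. cramer_inverse (A x) $ k $ j) \<in> borel_measurable M"
    unfolding cramer_inverse_def vec_lambda_beta det_3 by measurable
qed

text \<open>Here \<eta> plays the role of the inverse applied to \<xi>. From \<xi> . \<eta> \<ge> c
  |\<eta>|^2 and |\<xi>| \<le> K |\<eta>| comes the constant c/K^2, and Cauchy-Schwarz gives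
  |\<eta>| \<le> |\<xi>|/c. Being a statement about a single vector, it serves both full inverses
  and inverses on the tangent plane.\<close>

lemma inverse_elliptic:
  fixes \<xi> \<eta> :: "real^3"
  assumes "Z *v \<eta> = \<xi>" "c * (norm \<eta>)\<^sup>2 \<le> \<eta> \<bullet> (Z *v \<eta>)" "0 < c" "norm (Z *v \<eta>) \<le> K * norm \<eta>" "0 < K"
  shows "c / K\<^sup>2 * (norm \<xi>)\<^sup>2 \<le> \<xi> \<bullet> \<eta>" and "norm \<eta> \<le> 1 / c * norm \<xi>"
proof -
  have "(norm \<xi>)\<^sup>2 \<le> (K * norm \<eta>)\<^sup>2"
    using assms(1,4) by (intro power_mono) auto
  then have "c / K\<^sup>2 * (norm \<xi>)\<^sup>2 \<le> c / K\<^sup>2 * (K * norm \<eta>)\<^sup>2"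
    using assms(3) by (intro mult_left_mono) auto
  also have "\<dots> = c * (norm \<eta>)\<^sup>2"
    using assms(5) by (simp add: power_mult_distrib)
  also have "\<dots> \<le> \<xi> \<bullet> \<eta>"
    using assms(1,2) by (simp add: inner_commute)
  finally show "c / K\<^sup>2 * (norm \<xi>)\<^sup>2 \<le> \<xi> \<bullet> \<eta>" .
  have "c * (norm \<eta>)\<^sup>2 \<le> norm \<eta> * norm \<xi>"
    using assms(1,2) norm_cauchy_schwarz[of \<eta> \<xi>] by simp
  then have "c * norm \<eta> \<le> norm \<xi>"
    by (cases "norm \<eta> = 0") (simp_all add: power2_eq_square)
  then show "norm \<eta> \<le> 1 / c * norm \<xi>"
    using assms(3) by (simp add: field_simps)
qed

lemma elliptic_invertible:
  fixes A :: "real^3^3"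
  assumes "\<And>\<xi>. \<xi> \<noteq> 0 \<Longrightarrow> 0 < \<xi> \<bullet> (A *v \<xi>)"
  shows "invertible A"
proof -
  have "\<xi> = 0" if "A *v \<xi> = 0" for \<xi>
    using assms[of \<xi>] that by auto
  then have "\<exists>B. B ** A = mat 1"
    using matrix_left_invertible_ker[of A] by blast
  then show ?thesis
    by (simp add: invertible_left_inverse)
qed

lemma matrix_inv_coeff:
  assumes "bounded_symmetric_on S A" "elliptic_on S A"
  obtains c where "bounded_coeff (lebesgue_on S) (\<lambda>x. matrix_inv (A x))" "0 < c"
    "\<And>x \<xi>. x \<in> S \<Longrightarrow> c * (norm \<xi>)\<^sup>2 \<le> \<xi> \<bullet> (matrix_inv (A x) *v \<xi>)"
proof -
  obtain B where B: "\<And>x. x \<in> S \<Longrightarrow> norm (A x) \<le> B"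
    using assms(1) by (auto simp: bounded_symmetric_on_def)
  obtain c where c: "c > 0" "\<And>x \<xi>. x \<in> S \<Longrightarrow> c * (norm \<xi>)\<^sup>2 \<le> \<xi> \<bullet> (A x *v \<xi>)"
    using assms(2) by (auto simp: elliptic_on_def)
  define K where "K = 9 * (\<bar>B\<bar> + 1)"
  have K: "K > 0" by (simp add: K_def)
  have AK: "norm (A x *v \<eta>) \<le> K * norm \<eta>" if "x \<in> S" for x \<eta>
  proof -
    have "norm (A x *v \<eta>) \<le> 9 * norm (A x) * norm \<eta>"
      by (rule norm_matrix_mult_le)
    also have "\<dots> \<le> K * norm \<eta>"
      using B[OF that] by (intro mult_right_mono) (auto simp: K_def)
    finally show ?thesis .
  qed
  have inv: "invertible (A x)" if "x \<in> S" for x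
  proof (rule elliptic_invertible)
    fix \<xi> :: "real^3"
    assume "\<xi> \<noteq> 0"
    then have "0 < c * (norm \<xi>)\<^sup>2"
      using c(1) by simp
    then show "0 < \<xi> \<bullet> (A x *v \<xi>)"
      using c(2)[OF that, of \<xi>] by linarith
  qed
  have AA: "A x *v (matrix_inv (A x) *v \<xi>) = \<xi>" if "x \<in> S" for x \<xi>
    using matrix_inv_inverse(1)[OF inv[OF that]] by (simp add: matrix_vector_mul_assoc)
  note ell = inverse_elliptic[OF AA c(2) c(1) AK K]
  have "norm (matrix_inv (A x)) \<le> 9 * (1 / c)" if "x \<in> S" for x
    by (rule norm_matrix_le[OF ell(2)[OF that that that]])
  moreover have "(\<lambda>x. matrix_inv (A x)) \<in> borel_measurable (lebesgue_on S)"
  proof -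
    have "(\<lambda>x. cramer_inverse (A x)) \<in> borel_measurable (lebesgue_on S)"
      using assms(1) by (intro measurable_cramer_inverse) (simp add: bounded_symmetric_on_def)
    then show ?thesis
      by (rule measurable_cong[THEN iffD1, rotated])
        (simp add: matrix_inv_eq_cramer_inverse inv)
  qed
  ultimately have "bounded_coeff (lebesgue_on S) (\<lambda>x. matrix_inv (A x))"
    unfolding bounded_coeff_def by (auto intro!: exI[of _ "9 * (1 / c)"] AE_I2)
  then show thesis
    by (rule that[of "c / K\<^sup>2"]) (use ell(1) c(1) K in auto)
qed

section \<open>The admittance\<close>

definition is_tangential_inverse :: "real^3 \<Rightarrow> real^3^3 \<Rightarrow> real^3^3 \<Rightarrow> bool" where
  "is_tangential_inverse n Z Y \<longleftrightarrow> Y *v n = 0 \<and>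
     (\<forall>\<xi>. \<xi> \<bullet> n = 0 \<longrightarrow> (Y *v \<xi>) \<bullet> n = 0 \<and> Z *v (Y *v \<xi>) = \<xi>)"

lemma Yadm_eq: "Yadm D x = (THE Y. is_tangential_inverse (nu D x) (Zimp D x) Y)"
  by (simp add: Yadm_def is_tangential_inverse_def)

definition outer :: "real^3 \<Rightarrow> real^3^3" where
  "outer n = (\<chi> i j. n $ i * n $ j)"

lemma outer_mult: "outer n *v u = (n \<bullet> u) *\<^sub>R n"
  by (simp add: outer_def matrix_vector_mult_def inner_vec_def vec_eq_iff sum_3 algebra_simps)

text \<open>Normalising by \<open>sgn\<close> makes this an orthogonal projection for every
  \<open>n\<close>, including zero, where it is the identity.\<close>

definition tangential_proj :: "real^3 \<Rightarrow> real^3^3" where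
  "tangential_proj n = mat 1 - outer (sgn n)"

text \<open>Z on the tangent plane is completed by the identity on the normal line, inverted by
  Cramer's formula, and the normal part is taken off again.\<close>

definition tangential_inverse :: "real^3 \<Rightarrow> real^3^3 \<Rightarrow> real^3^3" where
  "tangential_inverse n Z = cramer_inverse (Z ** tangential_proj n + outer (sgn n)) - outer (sgn n)"

lemma tangential_proj_mult: "tangential_proj n *v u = u - (sgn n \<bullet> u) *\<^sub>R sgn n"
  by (simp add: tangential_proj_def matrix_vector_mult_diff_rdistrib outer_mult)

lemma sgn_inner_scale: "(sgn n \<bullet> sgn n) *\<^sub>R sgn n = sgn n" for n :: "real^3"
  by (cases "n = 0") (simp_all add: norm_sgn flip: power2_norm_eq_inner)

lemma inner_sgn_eq_0: "u \<bullet> sgn n = 0 \<longleftrightarrow> u \<bullet> n = 0" for n :: "real^3"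
  by (auto simp: sgn_div_norm)

lemma tangential_proj_tangential: "(tangential_proj n *v u) \<bullet> n = 0"
proof -
  have "(sgn n \<bullet> sgn n) * (sgn n \<bullet> u) = sgn n \<bullet> u"
    by (metis inner_scaleR_left sgn_inner_scale)
  then have "(tangential_proj n *v u) \<bullet> sgn n = 0"
    by (simp add: tangential_proj_mult inner_diff_left inner_diff_right inner_commute mult.commute)
  then show ?thesis by (simp add: inner_sgn_eq_0)
qed

lemma tangential_proj_id: "u \<bullet> n = 0 \<Longrightarrow> tangential_proj n *v u = u"
  using inner_sgn_eq_0[of u n] by (simp add: tangential_proj_mult inner_commute)

text \<open>A tangential inverse is unique for arbitrary \<open>n\<close> and \<open>Z\<close>. Hence \<open>Yadm\<close> is Borel measurable
  even on the null set where the impedance is not tangential and elliptic.\<close>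

lemma is_tangential_inverse_unique:
  assumes "is_tangential_inverse n Z Y"
  shows "Y = tangential_inverse n Z"
proof -
  define m where "m = sgn n"
  \<comment> \<open>\<open>W\<close> and \<open>V\<close> extend Z and its tangential inverse by the
    identity along the normal. Once W V = 1 is known, V is the inverse of W, and Y is recovered by
    subtracting the normal part.\<close>
  define W where "W = Z ** tangential_proj n + outer m"
  define V where "V = Y + outer m"
  have Yn: "Y *v m = 0"
    using assms by (simp add: m_def sgn_div_norm is_tangential_inverse_def matrix_vector_mult_scaleR)
  have "W *v (V *v x) = x" for x
  proof -
    let ?q = "tangential_proj n *v x"
    have q: "?q \<bullet> n = 0"
      by (rule tangential_proj_tangential)
    have "Y *v ?q = Y *v x"
      using Yn by (simp add: tangential_proj_mult matrix_vector_mult_diff_distrib matrix_vector_mult_scaleR flip: m_def)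
    then have Yx: "(Y *v x) \<bullet> n = 0" "Z *v (Y *v x) = ?q"
      using assms q unfolding is_tangential_inverse_def by metis+
    have mYx: "m \<bullet> (Y *v x) = 0"
      using Yx(1) inner_sgn_eq_0[of "Y *v x" n] by (simp add: m_def inner_commute)
    have Vx: "V *v x = Y *v x + (m \<bullet> x) *\<^sub>R m"
      by (simp add: V_def matrix_vector_mult_add_rdistrib outer_mult)
    have "tangential_proj n *v m = 0"
      by (simp add: tangential_proj_mult m_def sgn_inner_scale)
    then have "tangential_proj n *v (V *v x) = Y *v x"
      unfolding Vx using tangential_proj_id[OF Yx(1)]
      by (simp add: matrix_vector_right_distrib matrix_vector_mult_scaleR)
    moreover have "(m \<bullet> (V *v x)) *\<^sub>R m = (m \<bullet> x) *\<^sub>R m"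
      unfolding Vx inner_add_right mYx using sgn_inner_scale[of n]
      by (simp add: m_def flip: scaleR_scaleR)
    ultimately have "W *v (V *v x) = ?q + (m \<bullet> x) *\<^sub>R m"
      by (simp add: W_def matrix_vector_mult_add_rdistrib outer_mult Yx(2) flip: matrix_vector_mul_assoc)
    then show ?thesis
      by (simp add: tangential_proj_mult m_def)
  qed
  then have WV: "W ** V = mat 1"
    by (simp add: matrix_eq flip: matrix_vector_mul_assoc)
  then have "V ** W = mat 1"
    by (simp add: matrix_left_right_inverse)
  with WV have inv: "invertible W"
    by (auto simp: invertible_def)
  then have "matrix_inv W = V"
    using WV by (metis matrix_inv_inverse(2) matrix_mul_assoc matrix_mul_lid matrix_mul_rid)
  then show ?thesis
    by (simp add: tangential_inverse_def matrix_inv_eq_cramer_inverse[OF inv, symmetric] V_def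
        flip: m_def W_def)
qed

lemma inner_matrix_mult_left: "(A *v u) \<bullet> v = u \<bullet> (transpose A *v v)" for A :: "real^3^3"
  by (simp add: inner_vec_def matrix_vector_mult_def transpose_def sum_3 algebra_simps)

text \<open>Tangential vectors are exactly the projected ones, so the quantifier over the tangent
  plane becomes a quantifier over all vectors, that is, a matrix identity. What remains are finitely
  many norm equations, whose measurability is routine.\<close>

lemma is_tangential_inverse_iff:
  "is_tangential_inverse n Z Y \<longleftrightarrow> norm (Y *v n) = 0 \<and> norm (transpose (Y ** tangential_proj n) *v n) = 0 \<and>
     norm (Z ** (Y ** tangential_proj n) - tangential_proj n) = 0"
proof -
  have "is_tangential_inverse n Z Y \<longleftrightarrow> Y *v n = 0 \<and>
     (\<forall>u. (Y *v (tangential_proj n *v u)) \<bullet> n = 0 \<and> Z *v (Y *v (tangential_proj n *v u)) = tangential_proj n *v u)"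
    unfolding is_tangential_inverse_def
    by (metis tangential_proj_id tangential_proj_tangential)
  also have "(\<forall>u. (Y *v (tangential_proj n *v u)) \<bullet> n = 0 \<and> Z *v (Y *v (tangential_proj n *v u)) = tangential_proj n *v u)
      \<longleftrightarrow> (\<forall>u. u \<bullet> (transpose (Y ** tangential_proj n) *v n) = 0) \<and> Z ** (Y ** tangential_proj n) = tangential_proj n"
    by (simp only: matrix_vector_mul_assoc inner_matrix_mult_left all_conj_distrib matrix_eq)
  also have "(\<forall>u. u \<bullet> (transpose (Y ** tangential_proj n) *v n) = 0) \<longleftrightarrow> transpose (Y ** tangential_proj n) *v n = 0"
    by (metis inner_eq_zero_iff inner_zero_right)
  finally show ?thesis by simp
qed

text \<open>Where no tangential inverse exists, the definite description is that of an empty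
  predicate, a constant that does not depend on the point; the case split is therefore
  measurable.\<close>

lemma Yadm_cases:
  "Yadm D x = (if is_tangential_inverse (nu D x) (Zimp D x) (tangential_inverse (nu D x) (Zimp D x))
     then tangential_inverse (nu D x) (Zimp D x) else (THE Y. False))"
proof (cases "\<exists>Y. is_tangential_inverse (nu D x) (Zimp D x) Y")
  case True
  then obtain Y where Y: "is_tangential_inverse (nu D x) (Zimp D x) Y" by blast
  then have "Yadm D x = Y"
    unfolding Yadm_eq
    by (rule the_equality) (metis Y is_tangential_inverse_unique)
  then show ?thesis
    using Y is_tangential_inverse_unique[OF Y] by simp
next
  case False
  then have "is_tangential_inverse (nu D x) (Zimp D x) = (\<lambda>Y. False)"
    by blast
  then show ?thesis
    unfolding Yadm_eq by simp
qed

lemma measurable_matrix_mult: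
  fixes A B :: "'b \<Rightarrow> real^3^3"
  assumes [measurable]: "A \<in> borel_measurable M" "B \<in> borel_measurable M"
  shows "(\<lambda>x. A x ** B x) \<in> borel_measurable M"
proof (rule measurable_matrixI)
  fix i j
  have "(\<lambda>x. \<Sum>k\<in>UNIV. A x $ i $ k * B x $ k $ j) \<in> borel_measurable M"
    by measurable
  then show "(\<lambda>x. (A x ** B x) $ i $ j) \<in> borel_measurable M"
    by (simp add: matrix_matrix_mult_def)
qed

lemma measurable_matrix_vector_mult:
  fixes A :: "'b \<Rightarrow> real^3^3"
  assumes [measurable]: "A \<in> borel_measurable M" "u \<in> borel_measurable M"
  shows "(\<lambda>x. A x *v u x) \<in> borel_measurable M"
proof (rule borel_measurable_vecI)
  fix i
  have "(\<lambda>x. \<Sum>k\<in>UNIV. A x $ i $ k * u x $ k) \<in> borel_measurable M"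
    by measurable
  then show "(\<lambda>x. (A x *v u x) $ i) \<in> borel_measurable M"
    by (simp add: matrix_vector_mult_def)
qed

lemma measurable_transpose:
  fixes A :: "'b \<Rightarrow> real^3^3"
  assumes [measurable]: "A \<in> borel_measurable M"
  shows "(\<lambda>x. transpose (A x)) \<in> borel_measurable M"
  unfolding transpose_def by (rule measurable_matrixI) simp

lemma measurable_outer_sgn:
  assumes [measurable]: "n \<in> borel_measurable M"
  shows "(\<lambda>x. outer (sgn (n x))) \<in> borel_measurable M"
  unfolding outer_def
proof (rule measurable_matrixI)
  fix i j
  have "(\<lambda>x. (inverse (norm (n x)) * n x $ i) * (inverse (norm (n x)) * n x $ j)) \<in> borel_measurable M"
    by measurable
  then show "(\<lambda>x. (\<chi> i j. sgn (n x) $ i * sgn (n x) $ j) $ i $ j) \<in> borel_measurable M"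
    by (simp add: sgn_div_norm)
qed

lemma measurable_Yadm:
  assumes [measurable]: "nu D \<in> borel_measurable M" "Zimp D \<in> borel_measurable M"
  shows "Yadm D \<in> borel_measurable M"
proof -
  note [measurable] = measurable_outer_sgn measurable_matrix_mult measurable_matrix_vector_mult
    measurable_transpose measurable_cramer_inverse
  have [measurable]: "(\<lambda>x. tangential_proj (nu D x)) \<in> borel_measurable M"
    unfolding tangential_proj_def by (intro borel_measurable_diff measurable_outer_sgn borel_measurable_const assms)
  have T [measurable]: "(\<lambda>x. tangential_inverse (nu D x) (Zimp D x)) \<in> borel_measurable M"
    unfolding tangential_inverse_def
    by (intro borel_measurable_diff borel_measurable_add measurable_outer_sgn measurable_cramer_inverse
        measurable_matrix_mult assms) measurable
  have "Measurable.pred M (\<lambda>x. is_tangential_inverse (nu D x) (Zimp D x) (tangential_inverse (nu D x) (Zimp D x)))"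
    unfolding is_tangential_inverse_iff
    by (intro pred_intros_logic borel_measurable_eq borel_measurable_norm borel_measurable_diff borel_measurable_const
        measurable_matrix_vector_mult measurable_transpose measurable_matrix_mult assms T) measurable
  then have "(\<lambda>x. if is_tangential_inverse (nu D x) (Zimp D x) (tangential_inverse (nu D x) (Zimp D x))
     then tangential_inverse (nu D x) (Zimp D x) else (THE Y. False)) \<in> borel_measurable M"
    by (intro measurable_If T borel_measurable_const) simp
  then show ?thesis
    by (simp add: Yadm_cases[abs_def])
qed

text \<open>Adding the projection onto the normal makes Z positive definite on the whole space: Z is
  symmetric and annihilates n, so the quadratic form splits into its elliptic tangential part and
  the square of the normal component. Subtracting the projection from the inverse leaves the inverse
  on the tangent plane.\<close>

lemma is_tangential_inverse_exists:
  assumes n: "norm n = 1" and Z: "transpose Z = Z" "Z *v n = 0" and "0 < c"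
    and ell: "\<And>\<xi>. \<xi> \<bullet> n = 0 \<Longrightarrow> c * (norm \<xi>)\<^sup>2 \<le> \<xi> \<bullet> (Z *v \<xi>)"
  shows "\<exists>Y. is_tangential_inverse n Z Y"
proof -
  define W where "W = Z + outer n"
  have nn: "n \<bullet> n = 1"
    using n by (simp add: norm_eq_1)
  have sym: "(Z *v u) \<bullet> v = u \<bullet> (Z *v v)" for u v
    using inner_matrix_mult_left[of Z u v] Z(1) by simp
  have Wx: "W *v x = Z *v x + (n \<bullet> x) *\<^sub>R n" for x
    by (simp add: W_def matrix_vector_mult_add_rdistrib outer_mult)
  have "invertible W"
  proof (rule elliptic_invertible)
    fix x :: "real^3"
    assume "x \<noteq> 0"
    define q where "q = x - (n \<bullet> x) *\<^sub>R n"
    have q: "q \<bullet> n = 0"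
      by (simp add: q_def inner_diff_left inner_diff_right nn inner_commute)
    have "Z *v q = Z *v x"
      by (simp add: q_def matrix_vector_mult_diff_distrib matrix_vector_mult_scaleR Z(2))
    moreover have "n \<bullet> (Z *v x) = 0"
      using sym[of n x] Z(2) by simp
    ultimately have "q \<bullet> (Z *v q) = x \<bullet> (Z *v x)"
      by (simp add: q_def inner_diff_left)
    then have "x \<bullet> (W *v x) = q \<bullet> (Z *v q) + (n \<bullet> x)\<^sup>2"
      by (simp add: Wx inner_add_right power2_eq_square inner_commute)
    moreover have "c * (norm q)\<^sup>2 \<le> q \<bullet> (Z *v q)"
      by (rule ell[OF q])
    moreover have "0 < c * (norm q)\<^sup>2 \<or> 0 < (n \<bullet> x)\<^sup>2"
      using \<open>x \<noteq> 0\<close> \<open>0 < c\<close> by (auto simp: q_def)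
    moreover have "0 \<le> c * (norm q)\<^sup>2" "0 \<le> (n \<bullet> x)\<^sup>2"
      using \<open>0 < c\<close> by simp_all
    ultimately show "0 < x \<bullet> (W *v x)"
      by linarith
  qed
  note inv = matrix_inv_inverse[OF this]
  have W1: "W *v (matrix_inv W *v x) = x" and W2: "matrix_inv W *v (W *v x) = x" for x
    using inv by (simp_all add: matrix_vector_mul_assoc)
  have "matrix_inv W *v n = n"
    using W2[of n] by (simp add: Wx Z(2) nn)
  then have "(matrix_inv W - outer n) *v n = 0"
    by (simp add: matrix_vector_mult_diff_rdistrib outer_mult nn)
  moreover have "((matrix_inv W - outer n) *v \<xi>) \<bullet> n = 0 \<and> Z *v ((matrix_inv W - outer n) *v \<xi>) = \<xi>"
    if \<xi>: "\<xi> \<bullet> n = 0" for \<xi>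
  proof -
    define \<eta> where "\<eta> = matrix_inv W *v \<xi>"
    have eq: "Z *v \<eta> + (n \<bullet> \<eta>) *\<^sub>R n = \<xi>"
      using W1[of \<xi>] by (simp add: \<eta>_def Wx)
    have "n \<bullet> (Z *v \<eta>) = 0"
      using sym[of n \<eta>] Z(2) by simp
    then have "n \<bullet> \<eta> = n \<bullet> \<xi>"
      unfolding eq[symmetric] by (simp add: inner_add_right nn)
    then have "n \<bullet> \<eta> = 0"
      using \<xi> by (simp add: inner_commute)
    moreover have "(matrix_inv W - outer n) *v \<xi> = \<eta>"
      using \<xi> by (simp add: matrix_vector_mult_diff_rdistrib outer_mult \<eta>_def inner_commute)
    ultimately show ?thesis
      using eq by (simp add: inner_commute)
  qed
  ultimately show ?thesis
    unfolding is_tangential_inverse_def by blast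
qed

context maxwell_data
begin

lemma eps_coeff: "bounded_symmetric_on (Omega D) (eps D)" "elliptic_on (Omega D) (eps D)"
  and mu_coeff: "bounded_symmetric_on (Omega D) (mu D)" "elliptic_on (Omega D) (mu D)"
  using setting by (simp_all add: maxwell_setting_def)

lemma bounded_coeff_vol:
  assumes "bounded_symmetric_on (Omega D) A"
  shows "bounded_coeff (vol D) A"
proof -
  obtain B where "\<And>x. x \<in> Omega D \<Longrightarrow> norm (A x) \<le> B"
    using assms by (auto simp: bounded_symmetric_on_def)
  then have "AE x in vol D. norm (A x) \<le> B"
    by (intro AE_I2) simp
  then show ?thesis
    using assms by (auto simp: bounded_symmetric_on_def bounded_coeff_def)
qed

lemma bounded_coeff_eps: "bounded_coeff (vol D) (eps D)"
  and bounded_coeff_mu: "bounded_coeff (vol D) (mu D)"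
  and bounded_coeff_sig: "bounded_coeff (vol D) (sig D)"
  using setting by (auto intro!: bounded_coeff_vol simp: maxwell_setting_def)

lemma bounded_coeff_Zimp: "bounded_coeff (surf D) (Zimp D)"
  using setting by (simp add: maxwell_setting_def bounded_coeff_def cong: measurable_cong_sets)

lemma Zimp_elliptic:
  obtains c where "c > 0" "AE x in surf D. \<forall>\<xi>. \<xi> \<bullet> nu D x = 0 \<longrightarrow> c * (norm \<xi>)\<^sup>2 \<le> \<xi> \<bullet> (Zimp D x *v \<xi>)"
  using setting by (auto simp: maxwell_setting_def)

lemma Yadm_coeff:
  obtains c where "c > 0" "AE x in surf D. \<forall>\<xi>. \<xi> \<bullet> nu D x = 0 \<longrightarrow> c * (norm \<xi>)\<^sup>2 \<le> \<xi> \<bullet> (Yadm D x *v \<xi>)"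
    "bounded_coeff (surf D) (Yadm D)"
proof -
  obtain c where c: "c > 0" "AE x in surf D. \<forall>\<xi>. \<xi> \<bullet> nu D x = 0 \<longrightarrow> c * (norm \<xi>)\<^sup>2 \<le> \<xi> \<bullet> (Zimp D x *v \<xi>)"
    by (rule Zimp_elliptic)
  obtain B where B: "AE x in surf D. norm (Zimp D x) \<le> B"
    using bounded_coeff_Zimp by (auto simp: bounded_coeff_def)
  have Zs: "AE x in surf D. transpose (Zimp D x) = Zimp D x \<and> Zimp D x *v nu D x = 0"
    using setting by (simp add: maxwell_setting_def)
  have Y: "AE x in surf D. is_tangential_inverse (nu D x) (Zimp D x) (Yadm D x)"
    using c(2) Zs AE_norm_nu
  proof eventually_elim
    case (elim x)
    then obtain Y where Y: "is_tangential_inverse (nu D x) (Zimp D x) Y"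
      using is_tangential_inverse_exists[of "nu D x" "Zimp D x" c] c(1) by blast
    have "Yadm D x = Y"
      unfolding Yadm_eq
      by (rule the_equality[where P = "is_tangential_inverse (nu D x) (Zimp D x)", OF Y])
        (metis Y is_tangential_inverse_unique)
    with Y show ?case by simp
  qed
  define K where "K = 9 * (\<bar>B\<bar> + 1)"
  have K: "K > 0" by (simp add: K_def)
  have *: "AE x in surf D. \<forall>\<xi>. \<xi> \<bullet> nu D x = 0 \<longrightarrow> c / K\<^sup>2 * (norm \<xi>)\<^sup>2 \<le> \<xi> \<bullet> (Yadm D x *v \<xi>) \<and>
      norm (Yadm D x *v \<xi>) \<le> 1 / c * norm \<xi>"
    using c(2) B Y
  proof eventually_elim
    case (elim x)
    show ?case
    proof (intro allI impI)
      fix \<xi> assume "\<xi> \<bullet> nu D x = 0"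
      then have t: "(Yadm D x *v \<xi>) \<bullet> nu D x = 0" "Zimp D x *v (Yadm D x *v \<xi>) = \<xi>"
        using elim(3) by (auto simp: is_tangential_inverse_def)
      have "norm (Zimp D x *v (Yadm D x *v \<xi>)) \<le> 9 * norm (Zimp D x) * norm (Yadm D x *v \<xi>)"
        by (rule norm_matrix_mult_le)
      also have "\<dots> \<le> K * norm (Yadm D x *v \<xi>)"
        using elim(2) by (intro mult_right_mono) (auto simp: K_def)
      finally show "c / K\<^sup>2 * (norm \<xi>)\<^sup>2 \<le> \<xi> \<bullet> (Yadm D x *v \<xi>) \<and> norm (Yadm D x *v \<xi>) \<le> 1 / c * norm \<xi>"
        using inverse_elliptic[OF t(2) _ c(1) _ K] elim(1) t(1) by blast
    qed
  qed
  \<comment> \<open>A general vector is first projected to the tangent plane at the crude cost of a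
    factor 2; the 9 is that of \<open>norm_matrix_le\<close>.\<close>
  have "AE x in surf D. norm (Yadm D x) \<le> 9 * (2 / c)"
    using * Y AE_norm_nu
  proof eventually_elim
    case (elim x)
    show ?case
    proof (rule norm_matrix_le)
      fix u
      let ?q = "tangential_proj (nu D x) *v u"
      have "Yadm D x *v sgn (nu D x) = 0"
        using elim(2) by (simp add: is_tangential_inverse_def sgn_div_norm matrix_vector_mult_scaleR)
      then have "Yadm D x *v ?q = Yadm D x *v u"
        by (simp add: tangential_proj_mult matrix_vector_mult_diff_distrib matrix_vector_mult_scaleR)
      then have "norm (Yadm D x *v u) \<le> 1 / c * norm ?q"
        using elim(1) tangential_proj_tangential by metis
      also have "norm ?q \<le> norm u + norm ((sgn (nu D x) \<bullet> u) *\<^sub>R sgn (nu D x))"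
        unfolding tangential_proj_mult by (rule norm_triangle_ineq4)
      also have "\<dots> \<le> 2 * norm u"
        using Cauchy_Schwarz_ineq2[of "sgn (nu D x)" u] elim(3) by (simp add: sgn_div_norm)
      finally show "norm (Yadm D x *v u) \<le> 2 / c * norm u"
        using c(1) by (simp add: divide_right_mono)
    qed
  qed
  moreover have "Yadm D \<in> borel_measurable (surf D)"
    using bounded_coeff_Zimp by (intro measurable_Yadm measurable_nu) (simp add: bounded_coeff_def)
  ultimately have "bounded_coeff (surf D) (Yadm D)"
    by (auto simp: bounded_coeff_def)
  moreover have "AE x in surf D. \<forall>\<xi>. \<xi> \<bullet> nu D x = 0 \<longrightarrow> c / K\<^sup>2 * (norm \<xi>)\<^sup>2 \<le> \<xi> \<bullet> (Yadm D x *v \<xi>)"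
    using * by eventually_elim blast
  ultimately show thesis
    using c(1) K by (intro that[of "c / K\<^sup>2"]) auto
qed

lemma bounded_coeff_Yadm: "bounded_coeff (surf D) (Yadm D)"
  by (rule Yadm_coeff)

end

section \<open>Forms and norms\<close>

lemma em_simps [simp]:
  "fst (em_diff U W) = (\<lambda>x. fst U x - fst W x)" "snd (em_diff U W) = (\<lambda>x. snd U x - snd W x)"
  "fst (em_scale c U) = (\<lambda>x. c *s fst U x)" "snd (em_scale c U) = (\<lambda>x. c *s snd U x)"
  "fst (em_Re U) = (\<lambda>x. vec_Re (fst U x))" "snd (em_Re U) = (\<lambda>x. vec_Re (snd U x))"
  by (simp_all add: em_diff_def em_scale_def em_Re_def vec_Re_def)

lemma em_real_em_Re: "em_real D (em_Re U)"
  by (simp add: em_real_def vec_Re_def)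

text \<open>The imaginary part of U is the real part of -i U, and \<open>em_diff\<close> with the
  factor -i adds i times it.\<close>

lemma em_Re_Im: "U = em_diff (em_Re U) (em_scale (- \<i>) (em_Re (em_scale (- \<i>) U)))"
  by (simp add: em_diff_def em_scale_def em_Re_def prod_eq_iff fun_eq_iff vec_eq_iff complex_eq_iff)

context maxwell_data
begin

section \<open>Linear structure of the product spaces\<close>

lemma Lspace_iff: "U \<in> Lspace D \<longleftrightarrow> fst U \<in> L2 (vol D) \<and> snd U \<in> L2 (vol D)"
  by (cases U) (simp add: Lspace_def)

lemma Vspace_iff: "U \<in> Vspace D \<longleftrightarrow> fst U \<in> XPspace D \<and> snd U \<in> Xspace D"
  by (cases U) (simp add: Vspace_def)

lemma Vspace_Xspace: "U \<in> Vspace D \<Longrightarrow> fst U \<in> Xspace D" "U \<in> Vspace D \<Longrightarrow> snd U \<in> Xspace D"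
  by (auto simp: Vspace_iff XPspace_Xspace)

lemma Vspace_Lspace: "U \<in> Vspace D \<Longrightarrow> U \<in> Lspace D"
  by (simp add: Lspace_iff Vspace_Xspace XspaceD(1))

lemma Lspace_diff: "U \<in> Lspace D \<Longrightarrow> W \<in> Lspace D \<Longrightarrow> em_diff U W \<in> Lspace D"
  and Lspace_scale: "U \<in> Lspace D \<Longrightarrow> em_scale c U \<in> Lspace D"
  and Lspace_Re: "U \<in> Lspace D \<Longrightarrow> em_Re U \<in> Lspace D"
  by (simp_all add: Lspace_iff L2_diff L2_scale L2_vec_Re)

lemma Vspace_diff: "U \<in> Vspace D \<Longrightarrow> W \<in> Vspace D \<Longrightarrow> em_diff U W \<in> Vspace D"
  and Vspace_scale: "U \<in> Vspace D \<Longrightarrow> em_scale c U \<in> Vspace D"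
  and Vspace_Re: "U \<in> Vspace D \<Longrightarrow> em_Re U \<in> Vspace D"
  by (simp_all add: Vspace_iff XPspace_diff Xspace_diff XPspace_scale Xspace_scale XPspace_vec_Re Xspace_vec_Re)

lemma VspaceR_Re: "U \<in> Vspace D \<Longrightarrow> em_Re U \<in> VspaceR D"
  by (simp add: VspaceR_def Vspace_Re em_real_em_Re)

lemma VspaceR_LspaceR: "U \<in> VspaceR D \<Longrightarrow> U \<in> LspaceR D"
  by (simp add: VspaceR_def LspaceR_def Vspace_Lspace)

lemma VspaceI_VspaceR: "U \<in> VspaceI D s \<Longrightarrow> U \<in> VspaceR D"
  by (simp add: VspaceI_def)

lemma VspaceR_Vspace: "U \<in> VspaceR D \<Longrightarrow> U \<in> Vspace D"
  by (simp add: VspaceR_def)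

lemma LspaceR_Lspace: "U \<in> LspaceR D \<Longrightarrow> U \<in> Lspace D"
  by (simp add: LspaceR_def)

subsection \<open>The inner product\<close>

lemma ip_weights:
  "U \<in> Lspace D \<Longrightarrow> (\<lambda>x. cmat (eps D x) *v fst U x) \<in> L2 (vol D)"
  "U \<in> Lspace D \<Longrightarrow> (\<lambda>x. cmat (mu D x) *v snd U x) \<in> L2 (vol D)"
  "U \<in> Lspace D \<Longrightarrow> (\<lambda>x. cmat (transpose (eps D x)) *v fst U x) \<in> L2 (vol D)"
  "U \<in> Lspace D \<Longrightarrow> (\<lambda>x. cmat (transpose (mu D x)) *v snd U x) \<in> L2 (vol D)"
  by (auto simp: Lspace_iff intro!: coeff_mult_L2 bounded_coeff_transpose bounded_coeff_eps bounded_coeff_mu)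

lemma ip_left:
  "ip D U v = l2ip (vol D) (fst U) (\<lambda>x. cmat (transpose (eps D x)) *v fst v x)
     + l2ip (vol D) (snd U) (\<lambda>x. cmat (transpose (mu D x)) *v snd v x)"
  by (simp add: ip_def wip_transpose)

lemma ip_right:
  "ip D U v = l2ip (vol D) (\<lambda>x. cmat (eps D x) *v fst U x) (fst v)
     + l2ip (vol D) (\<lambda>x. cmat (mu D x) *v snd U x) (snd v)"
  by (simp add: ip_def wip_def)

lemma ip_diff_left:
  "\<lbrakk>U \<in> Lspace D; W \<in> Lspace D; v \<in> Lspace D\<rbrakk> \<Longrightarrow> ip D (em_diff U W) v = ip D U v - ip D W v"
  unfolding ip_left by (simp add: l2ip_diff_left ip_weights Lspace_iff[of U] Lspace_iff[of W])

lemma ip_diff_right: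
  "\<lbrakk>U \<in> Lspace D; W \<in> Lspace D; v \<in> Lspace D\<rbrakk> \<Longrightarrow> ip D v (em_diff U W) = ip D v U - ip D v W"
  unfolding ip_right by (simp add: l2ip_diff_right ip_weights Lspace_iff[of U] Lspace_iff[of W])

lemma ip_scale_left: "ip D (em_scale c U) v = c * ip D U v"
  unfolding ip_left by (simp add: l2ip_scale_left distrib_left)

lemma ip_scale_right: "ip D v (em_scale c U) = cnj c * ip D v U"
  unfolding ip_right by (simp add: l2ip_scale_right distrib_left)

lemma em_norm_scale: "em_norm D (em_scale c U) = cmod c * em_norm D U"
proof -
  have "Re (ip D (em_scale c U) (em_scale c U)) = (cmod c)\<^sup>2 * Re (ip D U U)"
  proof -
    have "ip D (em_scale c U) (em_scale c U) = (c * cnj c) * ip D U U"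
      by (simp add: ip_scale_left ip_scale_right)
    also have "c * cnj c = complex_of_real ((cmod c)\<^sup>2)"
      using complex_norm_square[of c] by simp
    finally show ?thesis by simp
  qed
  then show ?thesis
    by (simp add: em_norm_def real_sqrt_mult)
qed

text \<open>Unweighted counterpart of the square of \<open>em_norm\<close>. The two are equivalent
  by ellipticity and boundedness of the coefficients, and approximation estimates are made with
  \<open>em_sq\<close>, where a sum costs only a factor 2.\<close>

definition em_sq :: "em \<Rightarrow> real" where
  "em_sq U = l2sq (vol D) (fst U) + l2sq (vol D) (snd U)"

lemma em_sq_nonneg [simp]: "0 \<le> em_sq U"
  by (simp add: em_sq_def)

lemma coeff_ge:
  assumes "bounded_symmetric_on (Omega D) A" "elliptic_on (Omega D) A"
  shows "\<exists>c>0. \<forall>f\<in>L2 (vol D). c * l2sq (vol D) f \<le> wnorm2 (vol D) A f"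
proof -
  obtain c where c: "c > 0" "\<And>x \<xi>. x \<in> Omega D \<Longrightarrow> c * (norm \<xi>)\<^sup>2 \<le> \<xi> \<bullet> (A x *v \<xi>)"
    using assms(2) by (auto simp: elliptic_on_def)
  have "c * l2sq (vol D) f \<le> wnorm2 (vol D) A f" if "f \<in> L2 (vol D)" for f
  proof (rule wnorm2_ge[OF bounded_coeff_vol[OF assms(1)] that])
    show "AE x in vol D. c * (norm (f x))\<^sup>2 \<le> Re (cinner (cmat (A x) *v f x) (f x))"
      by (intro AE_I2 Re_cinner_cmat_ge[where P = "\<lambda>_. True"]) (use c(2) in auto)
  qed
  then show ?thesis
    using c(1) by blast
qed

lemma em_norm_ge: "\<exists>c>0. \<forall>U\<in>Lspace D. c * em_sq U \<le> (em_norm D U)\<^sup>2"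
proof -
  obtain c1 where c1: "c1 > 0" "\<forall>f\<in>L2 (vol D). c1 * l2sq (vol D) f \<le> wnorm2 (vol D) (eps D) f"
    using coeff_ge[OF eps_coeff] by blast
  obtain c2 where c2: "c2 > 0" "\<forall>f\<in>L2 (vol D). c2 * l2sq (vol D) f \<le> wnorm2 (vol D) (mu D) f"
    using coeff_ge[OF mu_coeff] by blast
  have "min c1 c2 * em_sq U \<le> (em_norm D U)\<^sup>2" if "U \<in> Lspace D" for U
  proof -
    have L: "fst U \<in> L2 (vol D)" "snd U \<in> L2 (vol D)"
      using that by (auto simp: Lspace_iff)
    have "min c1 c2 * em_sq U \<le> c1 * l2sq (vol D) (fst U) + c2 * l2sq (vol D) (snd U)"
      unfolding em_sq_def distrib_left by (intro add_mono mult_right_mono) auto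
    also have "\<dots> \<le> Re (ip D U U)"
      using c1(2) c2(2) L by (auto simp: ip_def wnorm2_def intro!: add_mono)
    finally have *: "min c1 c2 * em_sq U \<le> Re (ip D U U)" .
    moreover have "0 \<le> min c1 c2 * em_sq U"
      using c1(1) c2(1) by simp
    ultimately show ?thesis
      by (simp add: em_norm_def)
  qed
  then show ?thesis
    using c1(1) c2(1) by (intro exI[of _ "min c1 c2"]) auto
qed

lemma Re_ip_self_nonneg:
  assumes "U \<in> Lspace D"
  shows "0 \<le> Re (ip D U U)"
proof -
  have L: "fst U \<in> L2 (vol D)" "snd U \<in> L2 (vol D)"
    using assms by (auto simp: Lspace_iff)
  obtain c1 where "c1 > 0" "\<forall>f\<in>L2 (vol D). c1 * l2sq (vol D) f \<le> wnorm2 (vol D) (eps D) f"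
    using coeff_ge[OF eps_coeff] by blast
  then have 1: "0 \<le> wnorm2 (vol D) (eps D) (fst U)"
    using L(1) by (meson l2sq_nonneg less_imp_le mult_nonneg_nonneg order_trans)
  obtain c2 where "c2 > 0" "\<forall>f\<in>L2 (vol D). c2 * l2sq (vol D) f \<le> wnorm2 (vol D) (mu D) f"
    using coeff_ge[OF mu_coeff] by blast
  then have "0 \<le> wnorm2 (vol D) (mu D) (snd U)"
    using L(2) by (meson l2sq_nonneg less_imp_le mult_nonneg_nonneg order_trans)
  with 1 show ?thesis
    by (simp add: ip_def wnorm2_def)
qed

lemma em_norm_nonneg: "U \<in> Lspace D \<Longrightarrow> 0 \<le> em_norm D U"
  by (simp add: em_norm_def Re_ip_self_nonneg)

lemma em_norm_le: "\<exists>C\<ge>0. \<forall>U\<in>Lspace D. (em_norm D U)\<^sup>2 \<le> C * em_sq U"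
proof -
  obtain C1 where C1: "0 \<le> C1" "\<forall>f\<in>L2 (vol D). wnorm2 (vol D) (eps D) f \<le> C1 * l2sq (vol D) f"
    using wnorm2_le[OF bounded_coeff_eps] by blast
  obtain C2 where C2: "0 \<le> C2" "\<forall>f\<in>L2 (vol D). wnorm2 (vol D) (mu D) f \<le> C2 * l2sq (vol D) f"
    using wnorm2_le[OF bounded_coeff_mu] by blast
  have "(em_norm D U)\<^sup>2 \<le> max C1 C2 * em_sq U" if "U \<in> Lspace D" for U
  proof -
    have "(em_norm D U)\<^sup>2 = wnorm2 (vol D) (eps D) (fst U) + wnorm2 (vol D) (mu D) (snd U)"
      using Re_ip_self_nonneg[OF that] by (simp add: em_norm_def ip_def wnorm2_def)
    also have "\<dots> \<le> C1 * l2sq (vol D) (fst U) + C2 * l2sq (vol D) (snd U)"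
      using C1(2) C2(2) that by (intro add_mono) (auto simp: Lspace_iff)
    also have "\<dots> \<le> max C1 C2 * em_sq U"
      unfolding em_sq_def distrib_left by (intro add_mono mult_right_mono) auto
    finally show ?thesis .
  qed
  then show ?thesis
    using C1(1) by (intro exI[of _ "max C1 C2"]) auto
qed

text \<open>Cauchy-Schwarz in each component combined with ellipticity. The constant is uniform in
  U, as limits of Riemann sums, of difference quotients and of approximating solutions
  require.\<close>

lemma ip_bound:
  assumes "v \<in> Lspace D"
  shows "\<exists>K\<ge>0. \<forall>U\<in>Lspace D. cmod (ip D U v) \<le> K * em_norm D U"
proof -
  obtain c where c: "c > 0" "\<forall>U\<in>Lspace D. c * em_sq U \<le> (em_norm D U)\<^sup>2"
    using em_norm_ge by blast
  define p q where "p = (\<lambda>x. cmat (transpose (eps D x)) *v fst v x)" "q = (\<lambda>x. cmat (transpose (mu D x)) *v snd v x)"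
  have L: "p \<in> L2 (vol D)" "q \<in> L2 (vol D)"
    using ip_weights(3,4)[OF assms] by (simp_all add: p_q_def)
  define K where "K = (sqrt (l2sq (vol D) p) + sqrt (l2sq (vol D) q)) / sqrt c"
  have "cmod (ip D U v) \<le> K * em_norm D U" if U: "U \<in> Lspace D" for U
  proof -
    have "em_sq U \<le> (em_norm D U)\<^sup>2 / c"
      using c U by (simp add: field_simps)
    then have "sqrt (em_sq U) \<le> sqrt ((em_norm D U)\<^sup>2 / c)"
      by (rule real_sqrt_le_mono)
    then have e: "sqrt (em_sq U) \<le> em_norm D U / sqrt c"
      using em_norm_nonneg[OF U] by (simp add: real_sqrt_divide)
    have 1: "sqrt (l2sq (vol D) (fst U)) \<le> em_norm D U / sqrt c" "sqrt (l2sq (vol D) (snd U)) \<le> em_norm D U / sqrt c"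
      by (rule order_trans[OF real_sqrt_le_mono e]; simp add: em_sq_def)+
    have "cmod (ip D U v) \<le> cmod (l2ip (vol D) (fst U) p) + cmod (l2ip (vol D) (snd U) q)"
      unfolding ip_left p_q_def by (rule norm_triangle_ineq)
    also have "\<dots> \<le> sqrt (l2sq (vol D) (fst U)) * sqrt (l2sq (vol D) p) + sqrt (l2sq (vol D) (snd U)) * sqrt (l2sq (vol D) q)"
      using U L by (intro add_mono cmod_l2ip_le) (auto simp: Lspace_iff)
    also have "\<dots> \<le> em_norm D U / sqrt c * sqrt (l2sq (vol D) p) + em_norm D U / sqrt c * sqrt (l2sq (vol D) q)"
      using 1 by (intro add_mono mult_right_mono) auto
    also have "\<dots> = K * em_norm D U"
      by (simp add: K_def algebra_simps add_divide_distrib)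
    finally show ?thesis .
  qed
  moreover have "0 \<le> K"
    using c(1) by (simp add: K_def)
  ultimately show ?thesis by blast
qed

text \<open>The difference is tested with itself, and ellipticity makes its unweighted norm
  vanish.\<close>

lemma em_eq_of_ip:
  assumes "U \<in> Lspace D" "W \<in> Lspace D" "\<And>v. v \<in> Lspace D \<Longrightarrow> ip D U v = ip D W v"
  shows "em_eq D U W"
proof -
  define X where "X = em_diff U W"
  have X: "X \<in> Lspace D"
    unfolding X_def by (rule Lspace_diff[OF assms(1,2)])
  have "ip D X X = 0"
    using assms(3)[OF X] ip_diff_left[OF assms(1,2) X] by (simp add: X_def)
  then have "em_norm D X = 0"
    by (simp add: em_norm_def)
  moreover obtain c where "c > 0" "\<forall>U\<in>Lspace D. c * em_sq U \<le> (em_norm D U)\<^sup>2"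
    using em_norm_ge by blast
  ultimately have "c * em_sq X \<le> 0" "c > 0"
    using X by auto
  then have "em_sq X = 0"
    using em_sq_nonneg[of X] by (simp add: mult_le_0_iff)
  then have "l2sq (vol D) (fst X) = 0" "l2sq (vol D) (snd X) = 0"
    using l2sq_nonneg[of "vol D" "fst X"] l2sq_nonneg[of "vol D" "snd X"] unfolding em_sq_def by linarith+
  then have "AE x in vol D. fst X x = 0" "AE x in vol D. snd X x = 0"
    using X l2sq_zero_iff by (auto simp: Lspace_iff)
  then show ?thesis
    unfolding em_eq_def by eventually_elim (simp add: X_def)
qed

lemma ip_cong:
  assumes "U \<in> Lspace D" "W \<in> Lspace D" "em_eq D U W" "v \<in> Lspace D"
  shows "ip D U v = ip D W v"
proof -
  have AE: "AE x in vol D. fst U x = fst W x" "AE x in vol D. snd U x = snd W x"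
    using assms(3) by (auto simp: em_eq_def elim!: eventually_mono)
  show ?thesis
    unfolding ip_left
    using l2ip_cong_AE_left[OF _ _ AE(1) L2_measurable[OF ip_weights(3)[OF assms(4)]]]
      l2ip_cong_AE_left[OF _ _ AE(2) L2_measurable[OF ip_weights(4)[OF assms(4)]]] assms(1,2)
    by (simp add: Lspace_iff)
qed

subsection \<open>The sesquilinear form\<close>

lemma aform_weights:
  assumes "v \<in> Vspace D"
  shows "(\<lambda>x. cmat (sig D x) *v fst v x) \<in> L2 (vol D)"
    "(\<lambda>x. cmat (transpose (sig D x)) *v fst v x) \<in> L2 (vol D)"
    "(\<lambda>x. cmat (Yadm D x) *v tangential_trace D (fst v) x) \<in> L2 (surf D)"
    "(\<lambda>x. cmat (transpose (Yadm D x)) *v tangential_trace D (fst v) x) \<in> L2 (surf D)"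
    "(\<lambda>x. cmat (Zimp D x) *v tangential_trace D (snd v) x) \<in> L2 (surf D)"
    "(\<lambda>x. cmat (transpose (Zimp D x)) *v tangential_trace D (snd v) x) \<in> L2 (surf D)"
  using Vspace_Xspace[OF assms]
  by (simp_all add: coeff_mult_L2 bounded_coeff_transpose bounded_coeff_sig bounded_coeff_Yadm bounded_coeff_Zimp
      XspaceD(1,5))

lemma aform_left:
  "aform D U v = l2ip (vol D) (fst U) (\<lambda>x. cmat (transpose (sig D x)) *v fst v x)
     + l2ip (surf D) (tangential_trace D (fst U)) (\<lambda>x. cmat (transpose (Yadm D x)) *v tangential_trace D (fst v) x)
     + l2ip (surf D) (tangential_trace D (snd U)) (\<lambda>x. cmat (transpose (Zimp D x)) *v tangential_trace D (snd v) x)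
     + l2ip (vol D) (snd U) (weak_curl (Omega D) (fst v)) - l2ip (vol D) (fst U) (weak_curl (Omega D) (snd v))"
  by (simp add: aform_def wip_transpose)

lemma aform_right:
  "aform D v U = l2ip (vol D) (\<lambda>x. cmat (sig D x) *v fst v x) (fst U)
     + l2ip (surf D) (\<lambda>x. cmat (Yadm D x) *v tangential_trace D (fst v) x) (tangential_trace D (fst U))
     + l2ip (surf D) (\<lambda>x. cmat (Zimp D x) *v tangential_trace D (snd v) x) (tangential_trace D (snd U))
     + l2ip (vol D) (snd v) (weak_curl (Omega D) (fst U)) - l2ip (vol D) (fst v) (weak_curl (Omega D) (snd U))"
  by (simp add: aform_def wip_def)

lemma l2ip_trace_diff:
  assumes "f \<in> Xspace D" "g \<in> Xspace D" "k \<in> L2 (surf D)"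
  shows "l2ip (surf D) (tangential_trace D (\<lambda>x. f x - g x)) k
      = l2ip (surf D) (tangential_trace D f) k - l2ip (surf D) (tangential_trace D g) k"
    and "l2ip (surf D) k (tangential_trace D (\<lambda>x. f x - g x))
      = l2ip (surf D) k (tangential_trace D f) - l2ip (surf D) k (tangential_trace D g)"
proof -
  note L = XspaceD(5)[OF assms(1)] XspaceD(5)[OF assms(2)]
  note X = Xspace_diff[OF assms(1,2)]
  show "l2ip (surf D) (tangential_trace D (\<lambda>x. f x - g x)) k
      = l2ip (surf D) (tangential_trace D f) k - l2ip (surf D) (tangential_trace D g) k"
    unfolding l2ip_cong_AE_left[OF XspaceD(5)[OF X(1)] L2_diff(1)[OF L] X(3) L2_measurable[OF assms(3)]]
    by (rule l2ip_diff_left[OF L assms(3)])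
  show "l2ip (surf D) k (tangential_trace D (\<lambda>x. f x - g x))
      = l2ip (surf D) k (tangential_trace D f) - l2ip (surf D) k (tangential_trace D g)"
    unfolding l2ip_cong_AE_right[OF XspaceD(5)[OF X(1)] L2_diff(1)[OF L] X(3) L2_measurable[OF assms(3)]]
    by (rule l2ip_diff_right[OF L assms(3)])
qed

lemma l2ip_trace_scale:
  assumes "f \<in> Xspace D" "k \<in> L2 (surf D)"
  shows "l2ip (surf D) (tangential_trace D (\<lambda>x. c *s f x)) k = c * l2ip (surf D) (tangential_trace D f) k"
    and "l2ip (surf D) k (tangential_trace D (\<lambda>x. c *s f x)) = cnj c * l2ip (surf D) k (tangential_trace D f)"
proof -
  note L = XspaceD(5)[OF assms(1)]
  note X = Xspace_scale[OF assms(1), of c]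
  show "l2ip (surf D) (tangential_trace D (\<lambda>x. c *s f x)) k = c * l2ip (surf D) (tangential_trace D f) k"
    unfolding l2ip_cong_AE_left[OF XspaceD(5)[OF X(1)] L2_scale(1)[OF L] X(3) L2_measurable[OF assms(2)]]
    by (rule l2ip_scale_left)
  show "l2ip (surf D) k (tangential_trace D (\<lambda>x. c *s f x)) = cnj c * l2ip (surf D) k (tangential_trace D f)"
    unfolding l2ip_cong_AE_right[OF XspaceD(5)[OF X(1)] L2_scale(1)[OF L] X(3) L2_measurable[OF assms(2)]]
    by (rule l2ip_scale_right)
qed

lemma l2ip_curl_diff:
  assumes "f \<in> Xspace D" "g \<in> Xspace D" "k \<in> L2 (vol D)"
  shows "l2ip (vol D) k (weak_curl (Omega D) (\<lambda>x. f x - g x))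
      = l2ip (vol D) k (weak_curl (Omega D) f) - l2ip (vol D) k (weak_curl (Omega D) g)"
proof -
  note L = XspaceD(3)[OF assms(1)] XspaceD(3)[OF assms(2)]
  note X = Xspace_diff[OF assms(1,2)]
  show ?thesis
    unfolding l2ip_cong_AE_right[OF XspaceD(3)[OF X(1)] L2_diff(1)[OF L] X(2) L2_measurable[OF assms(3)]]
    by (rule l2ip_diff_right[OF L assms(3)])
qed

lemma l2ip_curl_scale:
  assumes "f \<in> Xspace D" "k \<in> L2 (vol D)"
  shows "l2ip (vol D) k (weak_curl (Omega D) (\<lambda>x. c *s f x)) = cnj c * l2ip (vol D) k (weak_curl (Omega D) f)"
proof -
  note L = XspaceD(3)[OF assms(1)]
  note X = Xspace_scale[OF assms(1), of c]
  show ?thesis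
    unfolding l2ip_cong_AE_right[OF XspaceD(3)[OF X(1)] L2_scale(1)[OF L] X(2) L2_measurable[OF assms(2)]]
    by (rule l2ip_scale_right)
qed

lemma aform_diff_left:
  assumes "U \<in> Vspace D" "W \<in> Vspace D" "v \<in> Vspace D"
  shows "aform D (em_diff U W) v = aform D U v - aform D W v"
  unfolding aform_left em_simps
  by (simp add: l2ip_diff_left l2ip_trace_diff aform_weights[OF assms(3)] Vspace_Xspace[OF assms(1)]
      Vspace_Xspace[OF assms(2)] XspaceD(1,3)[OF Vspace_Xspace(1)] XspaceD(1,3)[OF Vspace_Xspace(2)] assms)

lemma aform_diff_right:
  assumes "U \<in> Vspace D" "W \<in> Vspace D" "v \<in> Vspace D"
  shows "aform D v (em_diff U W) = aform D v U - aform D v W"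
  unfolding aform_right em_simps
  by (simp add: l2ip_diff_right l2ip_trace_diff l2ip_curl_diff aform_weights[OF assms(3)] Vspace_Xspace[OF assms(1)]
      Vspace_Xspace[OF assms(2)] XspaceD(1)[OF Vspace_Xspace(1)] XspaceD(1)[OF Vspace_Xspace(2)] assms)

lemma aform_scale_left:
  assumes "U \<in> Vspace D" "v \<in> Vspace D"
  shows "aform D (em_scale c U) v = c * aform D U v"
  unfolding aform_left em_simps
  by (simp add: l2ip_scale_left l2ip_trace_scale aform_weights[OF assms(2)] Vspace_Xspace[OF assms(1)] algebra_simps)

lemma aform_scale_right:
  assumes "U \<in> Vspace D" "v \<in> Vspace D"
  shows "aform D v (em_scale c U) = cnj c * aform D v U"
  unfolding aform_right em_simps
  by (simp add: l2ip_scale_right l2ip_trace_scale l2ip_curl_scale aform_weights[OF assms(2)] Vspace_Xspace[OF assms(1)]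
      XspaceD(1)[OF Vspace_Xspace(1)[OF assms(2)]] XspaceD(1)[OF Vspace_Xspace(2)[OF assms(2)]] algebra_simps)

text \<open>Well-posedness gives uniqueness only up to \<open>em_eq\<close>, and the filtered field
  is identified with a solution only almost everywhere; membership, form and energy norm must
  therefore pass between representatives.\<close>

lemma em_eq_Vspace:
  assumes "U \<in> Lspace D" "W \<in> Vspace D" "em_eq D U W"
  shows "U \<in> Vspace D" "v \<in> Vspace D \<Longrightarrow> aform D U v = aform D W v" "energy_norm D \<omega> U = energy_norm D \<omega> W"
proof -
  have AE: "AE x in vol D. fst U x = fst W x" "AE x in vol D. snd U x = snd W x"
    using assms(3) by (auto simp: em_eq_def elim!: eventually_mono)
  have L: "fst U \<in> L2 (vol D)" "snd U \<in> L2 (vol D)" "fst W \<in> L2 (vol D)" "snd W \<in> L2 (vol D)"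
    using assms(1) Vspace_Lspace[OF assms(2)] by (auto simp: Lspace_iff)
  note 1 = Xspace_cong[OF L(1) Vspace_Xspace(1)[OF assms(2)] AE(1)]
  note 2 = Xspace_cong[OF L(2) Vspace_Xspace(2)[OF assms(2)] AE(2)]
  show U: "U \<in> Vspace D"
    using 1(4) 2(3) assms(2) by (simp add: Vspace_iff)
  show "aform D U v = aform D W v" if v: "v \<in> Vspace D"
    unfolding aform_left 1(2) 2(2)
    using l2ip_cong_AE_left[OF L(1,3) AE(1) L2_measurable[OF aform_weights(2)[OF v]]]
      l2ip_cong_AE_left[OF L(2,4) AE(2) L2_measurable[OF XspaceD(3)[OF Vspace_Xspace(1)[OF v]]]]
      l2ip_cong_AE_left[OF L(1,3) AE(1) L2_measurable[OF XspaceD(3)[OF Vspace_Xspace(2)[OF v]]]]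
    by simp
  have "wip (vol D) (eps D) (fst U) (fst U) = wip (vol D) (eps D) (fst W) (fst W)"
    unfolding wip_def
    by (rule l2ip_cong_AE)
      (use AE L ip_weights(1)[OF assms(1)] ip_weights(1)[OF Vspace_Lspace[OF assms(2)]] in \<open>auto intro: L2_measurable elim: eventually_mono\<close>)
  moreover have "wip (vol D) (mu D) (snd U) (snd U) = wip (vol D) (mu D) (snd W) (snd W)"
    unfolding wip_def
    by (rule l2ip_cong_AE)
      (use AE L ip_weights(2)[OF assms(1)] ip_weights(2)[OF Vspace_Lspace[OF assms(2)]] in \<open>auto intro: L2_measurable elim: eventually_mono\<close>)
  moreover have "wip (vol D) (\<lambda>x. matrix_inv (eps D x)) (\<lambda>x. cmat (sig D x) *v fst U x) (\<lambda>x. cmat (sig D x) *v fst U x)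
      = wip (vol D) (\<lambda>x. matrix_inv (eps D x)) (\<lambda>x. cmat (sig D x) *v fst W x) (\<lambda>x. cmat (sig D x) *v fst W x)"
  proof (rule matrix_inv_coeff[OF eps_coeff])
    assume "bounded_coeff (vol D) (\<lambda>x. matrix_inv (eps D x))"
    note m = coeff_mult_L2[OF this aform_weights(1)[OF U]] coeff_mult_L2[OF this aform_weights(1)[OF assms(2)]]
    show ?thesis
      unfolding wip_def
      by (rule l2ip_cong_AE)
        (use AE aform_weights(1)[OF U] aform_weights(1)[OF assms(2)] m in \<open>auto intro: L2_measurable elim: eventually_mono\<close>)
  qed
  ultimately show "energy_norm D \<omega> U = energy_norm D \<omega> W"
    by (simp add: energy_norm_def wnorm2_def 1(1,2) 2(1,2))
qed

subsection \<open>The energy norm\<close>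

text \<open>Unweighted graph norm of field, traces and curls, squared. Bounded by the energy norm,
  it gives convergence of each of these quantities separately.\<close>

definition graph_sq :: "em \<Rightarrow> real" where
  "graph_sq U = em_sq U + l2sq (surf D) (tangential_trace D (fst U)) + l2sq (surf D) (tangential_trace D (snd U))
     + l2sq (vol D) (weak_curl (Omega D) (fst U)) + l2sq (vol D) (weak_curl (Omega D) (snd U))"

lemma graph_sq_nonneg [simp]: "0 \<le> graph_sq U"
  by (simp add: graph_sq_def)

text \<open>The normal is real, so the real and imaginary parts of a tangential trace are both
  tangential, and ellipticity on the tangent plane applies to each.\<close>

lemma trace_ge:
  assumes "bounded_coeff (surf D) A" "c > 0"
    and ell: "AE x in surf D. \<forall>\<xi>. \<xi> \<bullet> nu D x = 0 \<longrightarrow> c * (norm \<xi>)\<^sup>2 \<le> \<xi> \<bullet> (A x *v \<xi>)"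
    and f: "f \<in> Xspace D"
  shows "c * l2sq (surf D) (tangential_trace D f) \<le> wnorm2 (surf D) A (tangential_trace D f)"
proof (rule wnorm2_ge[OF assms(1) XspaceD(5)[OF f]])
  have "AE x in surf D. cinner (tangential_trace D f x) (cvec (nu D x)) = 0"
    using XspaceD(4)[OF f] by (simp add: has_tangential_trace_def)
  with ell show "AE x in surf D. c * (norm (tangential_trace D f x))\<^sup>2
      \<le> Re (cinner (cmat (A x) *v tangential_trace D f x) (tangential_trace D f x))"
  proof eventually_elim
    case (elim x)
    have "Re (cinner (tangential_trace D f x) (cvec (nu D x))) = (\<chi> i. Re (tangential_trace D f x $ i)) \<bullet> nu D x"
      "Im (cinner (tangential_trace D f x) (cvec (nu D x))) = (\<chi> i. Im (tangential_trace D f x $ i)) \<bullet> nu D x"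
      by (simp_all add: cinner_def cvec_def inner_vec_def)
    with elim show ?case
      by (intro Re_cinner_cmat_ge[where P = "\<lambda>\<xi>. \<xi> \<bullet> nu D x = 0"]) auto
  qed
qed

text \<open>Each summand of the energy norm is coercive in its own quantity, and the smallest of six
  constants serves all of them. Nonnegativity is recorded because stability bounds for the energy
  norm are squared later.\<close>

lemma energy_norm_ge:
  assumes "\<omega> > 0"
  shows "\<exists>c>0. \<forall>U\<in>Vspace D. 0 \<le> energy_norm D \<omega> U \<and> c * graph_sq U \<le> (energy_norm D \<omega> U)\<^sup>2"
proof -
  obtain c1 where c1: "c1 > 0" "\<forall>f\<in>L2 (vol D). c1 * l2sq (vol D) f \<le> wnorm2 (vol D) (eps D) f"
    using coeff_ge[OF eps_coeff] by blast
  obtain c2 where c2: "c2 > 0" "\<forall>f\<in>L2 (vol D). c2 * l2sq (vol D) f \<le> wnorm2 (vol D) (mu D) f"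
    using coeff_ge[OF mu_coeff] by blast
  obtain c3 where c3: "c3 > 0" "\<And>f. f \<in> Xspace D \<Longrightarrow> c3 * l2sq (surf D) (tangential_trace D f) \<le> wnorm2 (surf D) (Yadm D) (tangential_trace D f)"
    by (rule Yadm_coeff) (use trace_ge in blast)
  obtain c4 where c4: "c4 > 0" "\<And>f. f \<in> Xspace D \<Longrightarrow> c4 * l2sq (surf D) (tangential_trace D f) \<le> wnorm2 (surf D) (Zimp D) (tangential_trace D f)"
    by (rule Zimp_elliptic) (use trace_ge[OF bounded_coeff_Zimp] in blast)
  have inv: "\<exists>c>0. \<forall>f\<in>L2 (vol D). c * l2sq (vol D) f \<le> wnorm2 (vol D) (\<lambda>x. matrix_inv (A x)) f"
    if A: "bounded_symmetric_on (Omega D) A" "elliptic_on (Omega D) A" for A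
  proof (rule matrix_inv_coeff[OF A])
    fix c
    assume b: "bounded_coeff (vol D) (\<lambda>x. matrix_inv (A x))" and "0 < c"
      and e: "\<And>x \<xi>. x \<in> Omega D \<Longrightarrow> c * (norm \<xi>)\<^sup>2 \<le> \<xi> \<bullet> (matrix_inv (A x) *v \<xi>)"
    have "c * l2sq (vol D) f \<le> wnorm2 (vol D) (\<lambda>x. matrix_inv (A x)) f" if "f \<in> L2 (vol D)" for f
      by (rule wnorm2_ge[OF b that], intro AE_I2 Re_cinner_cmat_ge[where P = "\<lambda>_. True"]) (use e in auto)
    then show ?thesis
      using \<open>0 < c\<close> by blast
  qed
  obtain c5 where c5: "c5 > 0" "\<forall>f\<in>L2 (vol D). c5 * l2sq (vol D) f \<le> wnorm2 (vol D) (\<lambda>x. matrix_inv (mu D x)) f"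
    using inv[OF mu_coeff] by blast
  obtain c6 where c6: "c6 > 0" "\<forall>f\<in>L2 (vol D). c6 * l2sq (vol D) f \<le> wnorm2 (vol D) (\<lambda>x. matrix_inv (eps D x)) f"
    using inv[OF eps_coeff] by blast
  define c where "c = Min {\<omega>\<^sup>2 * c1, \<omega>\<^sup>2 * c2, c3, c4, c5, c6}"
  have c_le: "c \<le> \<omega>\<^sup>2 * c1" "c \<le> \<omega>\<^sup>2 * c2" "c \<le> c3" "c \<le> c4" "c \<le> c5" "c \<le> c6"
    by (simp_all add: c_def)
  have c: "c > 0"
    using assms c1 c2 c3 c4 c5 c6 by (simp add: c_def)
  have weaken: "c * l \<le> w" if "k * l \<le> w" "c \<le> k" "0 \<le> l" for k l w :: real
    using that mult_right_mono[of c k l] by linarith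
  have "0 \<le> energy_norm D \<omega> U \<and> c * graph_sq U \<le> (energy_norm D \<omega> U)\<^sup>2" if U: "U \<in> Vspace D" for U
  proof -
    note X = Vspace_Xspace[OF U]
    have t1: "c * l2sq (vol D) (fst U) \<le> \<omega>\<^sup>2 * wnorm2 (vol D) (eps D) (fst U)"
      using c1(2) XspaceD(1)[OF X(1)]
      by (intro weaken[OF _ c_le(1)]) (simp_all add: mult.assoc mult_left_mono)
    have t2: "c * l2sq (vol D) (snd U) \<le> \<omega>\<^sup>2 * wnorm2 (vol D) (mu D) (snd U)"
      using c2(2) XspaceD(1)[OF X(2)]
      by (intro weaken[OF _ c_le(2)]) (simp_all add: mult.assoc mult_left_mono)
    have t3: "c * l2sq (surf D) (tangential_trace D (fst U)) \<le> wnorm2 (surf D) (Yadm D) (tangential_trace D (fst U))"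
      by (rule weaken[OF c3(2)[OF X(1)] c_le(3)]) simp
    have t4: "c * l2sq (surf D) (tangential_trace D (snd U)) \<le> wnorm2 (surf D) (Zimp D) (tangential_trace D (snd U))"
      by (rule weaken[OF c4(2)[OF X(2)] c_le(4)]) simp
    have t5: "c * l2sq (vol D) (weak_curl (Omega D) (fst U)) \<le> wnorm2 (vol D) (\<lambda>x. matrix_inv (mu D x)) (weak_curl (Omega D) (fst U))"
      by (rule weaken[OF c5(2)[rule_format, OF XspaceD(3)[OF X(1)]] c_le(5)]) simp
    have t6: "c * l2sq (vol D) (weak_curl (Omega D) (snd U)) \<le> wnorm2 (vol D) (\<lambda>x. matrix_inv (eps D x)) (weak_curl (Omega D) (snd U))"
      by (rule weaken[OF c6(2)[rule_format, OF XspaceD(3)[OF X(2)]] c_le(6)]) simp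
    have t7: "c * l2sq (vol D) (\<lambda>x. cmat (sig D x) *v fst U x) \<le> wnorm2 (vol D) (\<lambda>x. matrix_inv (eps D x)) (\<lambda>x. cmat (sig D x) *v fst U x)"
      by (rule weaken[OF c6(2)[rule_format, OF aform_weights(1)[OF U]] c_le(6)]) simp
    have "0 \<le> c * l2sq (vol D) (\<lambda>x. cmat (sig D x) *v fst U x)" "0 \<le> c * graph_sq U"
      using c by simp_all
    moreover have "c * graph_sq U \<le>
       \<omega>\<^sup>2 * wnorm2 (vol D) (eps D) (fst U)
       + wnorm2 (surf D) (Yadm D) (tangential_trace D (fst U))
       + wnorm2 (vol D) (\<lambda>x. matrix_inv (mu D x)) (weak_curl (Omega D) (fst U))
       + wnorm2 (vol D) (\<lambda>x. matrix_inv (eps D x)) (\<lambda>x. cmat (sig D x) *v fst U x)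
       + \<omega>\<^sup>2 * wnorm2 (vol D) (mu D) (snd U)
       + wnorm2 (surf D) (Zimp D) (tangential_trace D (snd U))
       + wnorm2 (vol D) (\<lambda>x. matrix_inv (eps D x)) (weak_curl (Omega D) (snd U))"
      using t1 t2 t3 t4 t5 t6 t7 calculation(1) unfolding graph_sq_def em_sq_def distrib_left by linarith
    ultimately show ?thesis
      unfolding energy_norm_def by (subst real_sqrt_pow2) (auto intro!: real_sqrt_ge_zero)
  qed
  with c show ?thesis by blast
qed

subsection \<open>Continuous paths and their integrals\<close>

lemma l2_continuousI:
  assumes "\<And>t. t \<in> I \<Longrightarrow> f t \<in> L2 M"
    and "\<And>t. t \<in> I \<Longrightarrow> (g t \<longlongrightarrow> 0) (at t within I)"
    and "\<And>t \<tau>. \<lbrakk>t \<in> I; \<tau> \<in> I\<rbrakk> \<Longrightarrow> c * l2sq M (\<lambda>x. f \<tau> x - f t x) \<le> (g t \<tau>)\<^sup>2" "c > 0"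
  shows "l2_continuous M I f"
  unfolding l2_continuous_def
proof (intro conjI ballI assms(1))
  fix t assume t: "t \<in> I"
  show "((\<lambda>\<tau>. l2sq M (\<lambda>x. f \<tau> x - f t x)) \<longlongrightarrow> 0) (at t within I)"
  proof (rule Lim_null_comparison)
    show "\<forall>\<^sub>F \<tau> in at t within I. norm (l2sq M (\<lambda>x. f \<tau> x - f t x)) \<le> (g t \<tau>)\<^sup>2 / c"
      unfolding eventually_at_filter
      using assms(3)[OF t] \<open>c > 0\<close> by (intro eventuallyI impI) (simp add: field_simps)
    have "((\<lambda>\<tau>. (g t \<tau>)\<^sup>2 / c) \<longlongrightarrow> 0\<^sup>2 / c) (at t within I)"
      by (intro tendsto_intros assms(2) t) (use \<open>c > 0\<close> in simp)
    then show "((\<lambda>\<tau>. (g t \<tau>)\<^sup>2 / c) \<longlongrightarrow> 0) (at t within I)"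
      by simp
  qed
qed

lemma path_continuous_em_norm:
  assumes "path_continuous (em_norm D) I U" "\<And>t. t \<in> I \<Longrightarrow> U t \<in> Lspace D"
  shows "l2_continuous (vol D) I (\<lambda>t. fst (U t))" "l2_continuous (vol D) I (\<lambda>t. snd (U t))"
proof -
  obtain c where c: "c > 0" "\<forall>U\<in>Lspace D. c * em_sq U \<le> (em_norm D U)\<^sup>2"
    using em_norm_ge by blast
  have lim: "((\<lambda>\<tau>. em_norm D (em_diff (U \<tau>) (U t))) \<longlongrightarrow> 0) (at t within I)" if "t \<in> I" for t
    using assms(1) that by (simp add: path_continuous_def)
  have le: "c * a \<le> (em_norm D (em_diff (U \<tau>) (U t)))\<^sup>2"
    if "t \<in> I" "\<tau> \<in> I" "a \<le> em_sq (em_diff (U \<tau>) (U t))" for t \<tau> a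
  proof -
    have "c * a \<le> c * em_sq (em_diff (U \<tau>) (U t))"
      using c(1) that(3) by simp
    also have "\<dots> \<le> (em_norm D (em_diff (U \<tau>) (U t)))\<^sup>2"
      using c(2) Lspace_diff assms(2) that by blast
    finally show ?thesis .
  qed
  show "l2_continuous (vol D) I (\<lambda>t. fst (U t))" "l2_continuous (vol D) I (\<lambda>t. snd (U t))"
    using assms(2) by (intro l2_continuousI[OF _ lim le c(1)]; simp add: Lspace_iff em_sq_def)+
qed

lemma path_continuous_energy_norm:
  assumes "\<omega> > 0" "path_continuous (energy_norm D \<omega>) I U" and V: "\<And>t. t \<in> I \<Longrightarrow> U t \<in> Vspace D"
  shows "l2_continuous (vol D) I (\<lambda>t. fst (U t))" "l2_continuous (vol D) I (\<lambda>t. snd (U t))"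
    "l2_continuous (surf D) I (\<lambda>t. tangential_trace D (fst (U t)))"
    "l2_continuous (surf D) I (\<lambda>t. tangential_trace D (snd (U t)))"
    "l2_continuous (vol D) I (\<lambda>t. weak_curl (Omega D) (fst (U t)))"
    "l2_continuous (vol D) I (\<lambda>t. weak_curl (Omega D) (snd (U t)))"
proof -
  obtain c where c: "c > 0" "\<forall>U\<in>Vspace D. c * graph_sq U \<le> (energy_norm D \<omega> U)\<^sup>2"
    using energy_norm_ge[OF assms(1)] by blast
  have lim: "((\<lambda>\<tau>. energy_norm D \<omega> (em_diff (U \<tau>) (U t))) \<longlongrightarrow> 0) (at t within I)" if "t \<in> I" for t
    using assms(2) that by (simp add: path_continuous_def)
  have X: "fst (U t) \<in> Xspace D" "snd (U t) \<in> Xspace D" if "t \<in> I" for t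
    using Vspace_Xspace[OF V[OF that]] .
  have le: "c * a \<le> (energy_norm D \<omega> (em_diff (U \<tau>) (U t)))\<^sup>2"
    if "t \<in> I" "\<tau> \<in> I" "a \<le> graph_sq (em_diff (U \<tau>) (U t))" for t \<tau> a
  proof -
    have "c * a \<le> c * graph_sq (em_diff (U \<tau>) (U t))"
      using c(1) that(3) by simp
    also have "\<dots> \<le> (energy_norm D \<omega> (em_diff (U \<tau>) (U t)))\<^sup>2"
      using c(2) Vspace_diff V that by blast
    finally show ?thesis .
  qed
  have tr: "l2sq (surf D) (\<lambda>x. tangential_trace D f x - tangential_trace D g x) = l2sq (surf D) (tangential_trace D (\<lambda>x. f x - g x))"
    and cu: "l2sq (vol D) (\<lambda>x. weak_curl (Omega D) f x - weak_curl (Omega D) g x) = l2sq (vol D) (weak_curl (Omega D) (\<lambda>x. f x - g x))"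
    if "f \<in> Xspace D" "g \<in> Xspace D" for f g
    using l2sq_cong_AE[OF XspaceD(5)[OF Xspace_diff(1)[OF that]] L2_diff(1)[OF XspaceD(5)[OF that(1)] XspaceD(5)[OF that(2)]] Xspace_diff(3)[OF that]]
      l2sq_cong_AE[OF XspaceD(3)[OF Xspace_diff(1)[OF that]] L2_diff(1)[OF XspaceD(3)[OF that(1)] XspaceD(3)[OF that(2)]] Xspace_diff(2)[OF that]]
    by simp_all
  show "l2_continuous (vol D) I (\<lambda>t. fst (U t))" "l2_continuous (vol D) I (\<lambda>t. snd (U t))"
    by (intro l2_continuousI[OF _ lim le c(1)]; simp add: X XspaceD(1) graph_sq_def em_sq_def)+
  show "l2_continuous (surf D) I (\<lambda>t. tangential_trace D (fst (U t)))"
    "l2_continuous (surf D) I (\<lambda>t. tangential_trace D (snd (U t)))"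
    "l2_continuous (vol D) I (\<lambda>t. weak_curl (Omega D) (fst (U t)))"
    "l2_continuous (vol D) I (\<lambda>t. weak_curl (Omega D) (snd (U t)))"
    by (intro l2_continuousI[OF _ lim le c(1)]; simp add: X XspaceD(3,5) graph_sq_def em_sq_def tr cu)+
qed

lemma em_norm_tendsto_0:
  assumes "\<And>n. U n \<in> Lspace D" "((\<lambda>n. em_sq (U n)) \<longlongrightarrow> 0) F"
  shows "((\<lambda>n. em_norm D (U n)) \<longlongrightarrow> 0) F"
proof -
  obtain C where C: "C \<ge> 0" "\<forall>U\<in>Lspace D. (em_norm D U)\<^sup>2 \<le> C * em_sq U"
    using em_norm_le by blast
  have "em_norm D (U n) \<le> sqrt (C * em_sq (U n))" for n
    using C(2) assms(1) real_le_rsqrt by blast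
  moreover have "((\<lambda>n. sqrt (C * em_sq (U n))) \<longlongrightarrow> sqrt (C * 0)) F"
    by (intro tendsto_intros assms(2))
  ultimately show ?thesis
    by (intro Lim_null_comparison[of "\<lambda>n. em_norm D (U n)" "\<lambda>n. sqrt (C * em_sq (U n))"])
      (simp_all add: em_norm_nonneg[OF assms(1)])
qed

lemma em_sum_riemann:
  "fst (em_sum (\<lambda>(t, K). em_scale (of_real (measure lborel K)) (f t)) p) = riemann_sum (\<lambda>t. fst (f t)) p"
  "snd (em_sum (\<lambda>(t, K). em_scale (of_real (measure lborel K)) (f t)) p) = riemann_sum (\<lambda>t. snd (f t)) p"
  by (simp_all add: em_sum_def riemann_sum_def case_prod_beta)

lemma has_em_integral_exists:
  assumes "a \<le> b" "l2_continuous (vol D) {a..b} (\<lambda>t. fst (f t))" "l2_continuous (vol D) {a..b} (\<lambda>t. snd (f t))"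
  shows "\<exists>G. has_em_integral D f G {a..b}"
proof (rule l2_path_integral[OF assms(1,2)], rule l2_path_integral[OF assms(1,3)])
  fix g1 g2
  assume g: "g1 \<in> L2 (vol D)" "g2 \<in> L2 (vol D)"
    and e1: "\<And>e. e > 0 \<Longrightarrow> \<exists>\<gamma>. gauge \<gamma> \<and> (\<forall>p. p tagged_division_of {a..b} \<and> \<gamma> fine p \<longrightarrow>
        l2sq (vol D) (\<lambda>x. riemann_sum (\<lambda>t. fst (f t)) p x - g1 x) \<le> e)"
    and e2: "\<And>e. e > 0 \<Longrightarrow> \<exists>\<gamma>. gauge \<gamma> \<and> (\<forall>p. p tagged_division_of {a..b} \<and> \<gamma> fine p \<longrightarrow>
        l2sq (vol D) (\<lambda>x. riemann_sum (\<lambda>t. snd (f t)) p x - g2 x) \<le> e)"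
  obtain C where C: "C \<ge> 0" "\<forall>U\<in>Lspace D. (em_norm D U)\<^sup>2 \<le> C * em_sq U"
    using em_norm_le by blast
  have "has_em_integral D f (g1, g2) {a..b}"
    unfolding has_em_integral_def
  proof (intro conjI allI impI)
    show "(g1, g2) \<in> Lspace D"
      using g by (simp add: Lspace_iff)
    fix e :: real
    assume "e > 0"
    \<comment> \<open>With both components within k/4, the squared \<open>em_norm\<close> is at most
      (C + 1) k / 2, which is half of the squared tolerance; the summand 1 covers C = 0.\<close>
    define k where "k = e\<^sup>2 / (C + 1)"
    define d where "d = k / 4"
    have d: "d > 0"
      using \<open>e > 0\<close> C(1) by (simp add: d_def k_def)
    obtain \<gamma>1 where \<gamma>1: "gauge \<gamma>1" "\<forall>p. p tagged_division_of {a..b} \<and> \<gamma>1 fine p \<longrightarrow>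
        l2sq (vol D) (\<lambda>x. riemann_sum (\<lambda>t. fst (f t)) p x - g1 x) \<le> d"
      using e1[OF d] by (elim exE conjE) (rule that)
    obtain \<gamma>2 where \<gamma>2: "gauge \<gamma>2" "\<forall>p. p tagged_division_of {a..b} \<and> \<gamma>2 fine p \<longrightarrow>
        l2sq (vol D) (\<lambda>x. riemann_sum (\<lambda>t. snd (f t)) p x - g2 x) \<le> d"
      using e2[OF d] by (elim exE conjE) (rule that)
    show "\<exists>\<gamma>. gauge \<gamma> \<and> (\<forall>p. p tagged_division_of {a..b} \<and> \<gamma> fine p \<longrightarrow>
        em_norm D (em_diff (em_sum (\<lambda>(t, K). em_scale (of_real (measure lborel K)) (f t)) p) (g1, g2)) < e)"
    proof (intro exI[of _ "\<lambda>x. \<gamma>1 x \<inter> \<gamma>2 x"] conjI allI impI)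
      show "gauge (\<lambda>x. \<gamma>1 x \<inter> \<gamma>2 x)"
        using \<gamma>1(1) \<gamma>2(1) by (rule gauge_Int)
      fix p
      assume p: "p tagged_division_of {a..b} \<and> (\<lambda>x. \<gamma>1 x \<inter> \<gamma>2 x) fine p"
      define X where "X = em_diff (em_sum (\<lambda>(t, K). em_scale (of_real (measure lborel K)) (f t)) p) (g1, g2)"
      have X: "X \<in> Lspace D"
        unfolding X_def Lspace_iff em_simps em_sum_riemann fst_conv snd_conv
        using p g l2_continuous_L2[OF assms(2)] l2_continuous_L2[OF assms(3)]
        by (intro conjI L2_diff(1) riemann_sum_L2) auto
      have "em_sq X \<le> d + d"
        unfolding X_def em_sq_def em_simps em_sum_riemann fst_conv snd_conv
        using p by (intro add_mono \<gamma>1(2)[rule_format] \<gamma>2(2)[rule_format]) (simp_all add: fine_Int)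
      then have "(em_norm D X)\<^sup>2 \<le> C * (d + d)"
        using C X by (meson mult_left_mono order_trans)
      also have "\<dots> \<le> (C + 1) * (d + d)"
        using d by (simp add: mult_right_mono)
      also have "\<dots> = e\<^sup>2 / 2"
      proof -
        have "(C + 1) * k = e\<^sup>2"
          using C(1) by (simp add: k_def)
        moreover have "(C + 1) * (d + d) = (C + 1) * k / 2"
          by (simp add: d_def)
        ultimately show ?thesis by simp
      qed
      also have "\<dots> < e\<^sup>2"
        using \<open>e > 0\<close> by simp
      finally show "em_norm D (em_diff (em_sum (\<lambda>(t, K). em_scale (of_real (measure lborel K)) (f t)) p) (g1, g2)) < e"
        unfolding X_def[symmetric] using \<open>e > 0\<close> by (meson less_imp_le power2_less_imp_less)
    qed
  qed
  then show ?thesis by blast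
qed

text \<open>The functional is linear and bounded, so it maps Riemann sums of the path to those of
  the scalar function; a gauge for the tolerance e/(K + 1) works.\<close>

lemma has_em_integral_ip:
  assumes G: "has_em_integral D f G {a..b}" and f: "\<And>t. t \<in> {a..b} \<Longrightarrow> f t \<in> Lspace D" and v: "v \<in> Lspace D"
  shows "((\<lambda>t. ip D (f t) v) has_integral ip D G v) {a..b}"
proof -
  obtain K where K: "K \<ge> 0" "\<And>U. U \<in> Lspace D \<Longrightarrow> cmod (ip D U v) \<le> K * em_norm D U"
    using ip_bound[OF v] by blast
  have GL: "G \<in> Lspace D"
    using G by (simp add: has_em_integral_def)
  have "((\<lambda>t. ip D (f t) v) has_integral ip D G v) (cbox a b)"
    unfolding has_integral
  proof (intro allI impI)
    fix e :: real
    assume "e > 0"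
    then have e: "e / (K + 1) > 0"
      using K(1) by simp
    obtain \<gamma> where "gauge \<gamma>" and \<gamma>': "\<forall>p. p tagged_division_of {a..b} \<and> \<gamma> fine p \<longrightarrow>
        em_norm D (em_diff (em_sum (\<lambda>(t, K). em_scale (of_real (measure lborel K)) (f t)) p) G) < e / (K + 1)"
      using G[unfolded has_em_integral_def, THEN conjunct2, rule_format, OF e]
      by (elim exE conjE) (rule that)
    note \<gamma> = \<gamma>'[rule_format]
    show "\<exists>\<gamma>. gauge \<gamma> \<and> (\<forall>p. p tagged_division_of cbox a b \<and> \<gamma> fine p \<longrightarrow>
        norm ((\<Sum>(x, k)\<in>p. measure lborel k *\<^sub>R ip D (f x) v) - ip D G v) < e)"
    proof (intro exI[of _ \<gamma>] conjI allI impI)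
      fix p
      assume "p tagged_division_of cbox a b \<and> \<gamma> fine p"
      then have p: "p tagged_division_of {a..b}" "\<gamma> fine p" by auto
      define S where "S = em_sum (\<lambda>(t, K). em_scale (of_real (measure lborel K)) (f t)) p"
      have tag: "f (fst i) \<in> Lspace D" if "i \<in> p" for i
        using tagged_division_ofD(2,3)[OF p(1), of "fst i" "snd i"] that by (intro f) auto
      have S: "S \<in> Lspace D"
        unfolding S_def Lspace_iff em_sum_riemann
        using f by (intro conjI riemann_sum_L2[OF p(1)]) (auto simp: Lspace_iff)
      have R: "l2ip (vol D) (riemann_sum g p) h = (\<Sum>i\<in>p. of_real (measure lborel (snd i)) * l2ip (vol D) (g (fst i)) h)"
        if "\<And>i. i \<in> p \<Longrightarrow> g (fst i) \<in> L2 (vol D)" "h \<in> L2 (vol D)" for g h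
        unfolding riemann_sum_def case_prod_beta
      proof (subst l2ip_sum_left)
        show "finite p"
          using p(1) by (rule tagged_division_of_finite)
      qed (use that in \<open>auto intro: L2_scale simp: l2ip_scale_left\<close>)
      have "ip D S v = (\<Sum>i\<in>p. of_real (measure lborel (snd i)) * ip D (f (fst i)) v)"
        unfolding ip_left S_def em_sum_riemann
        using tag ip_weights(3,4)[OF v] by (simp add: R Lspace_iff distrib_left sum.distrib)
      then have "(\<Sum>(x, k)\<in>p. measure lborel k *\<^sub>R ip D (f x) v) - ip D G v = ip D (em_diff S G) v"
        by (simp add: ip_diff_left[OF S GL v] scaleR_conv_of_real case_prod_beta)
      then have "norm ((\<Sum>(x, k)\<in>p. measure lborel k *\<^sub>R ip D (f x) v) - ip D G v) \<le> K * em_norm D (em_diff S G)"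
        using K(2)[OF Lspace_diff[OF S GL]] by simp
      also have "\<dots> \<le> K * (e / (K + 1))"
        unfolding S_def by (rule mult_left_mono[OF less_imp_le[OF \<gamma>] K(1)]) (rule conjI[OF p])
      also have "\<dots> < e"
        using \<open>e > 0\<close> K(1) by (simp add: field_simps)
      finally show "norm ((\<Sum>(x, k)\<in>p. measure lborel k *\<^sub>R ip D (f x) v) - ip D G v) < e" .
    qed fact
  qed
  then show ?thesis by simp
qed

end

section \<open>Time averages of strong solutions\<close>

text \<open>This is Re(zU) = Re z Re U - Im z Im U, with Im U written as the real part of -i
  U.\<close>

lemma em_Re_scale:
  "em_Re (em_scale z U) = em_diff (em_scale (of_real (Re z)) (em_Re U)) (em_scale (of_real (Im z)) (em_Re (em_scale (- \<i>) U)))"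
  by (simp add: em_diff_def em_scale_def em_Re_def prod_eq_iff fun_eq_iff vec_eq_iff)

lemma exp_has_vector_derivative:
  "((\<lambda>t. exp (k * of_real t)) has_vector_derivative k * exp (k * of_real t)) (at t within I)" for k :: complex
proof -
  have "((\<lambda>z. exp (k * z)) has_field_derivative k * exp (k * of_real t)) (at (of_real t))"
    by (auto intro!: derivative_eq_intros)
  then show ?thesis
    by (rule has_vector_derivative_real_field)
qed

lemma period_phase:
  assumes "\<omega> > 0"
  shows "exp (- \<i> * of_real (\<omega> * period \<omega>)) = 1" "exp (- 2 * \<i> * of_real \<omega> * of_real (period \<omega>)) = 1"
proof -
  have *: "\<omega> * period \<omega> = 2 * pi"
    using assms by (simp add: period_def)
  show 1: "exp (- \<i> * of_real (\<omega> * period \<omega>)) = 1"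
    unfolding * by (simp add: exp_minus exp_two_pi_i mult.commute)
  have "exp (- 2 * \<i> * of_real \<omega> * of_real (period \<omega>)) = (exp (- \<i> * of_real (\<omega> * period \<omega>)))\<^sup>2"
    by (simp add: exp_double[symmetric] mult.assoc)
  then show "exp (- 2 * \<i> * of_real \<omega> * of_real (period \<omega>)) = 1"
    unfolding 1 by simp
qed

text \<open>Here a and b stand for the pairings with the real and imaginary part of the source. The
  integrand is (a + i b)/2 plus (a - i b)/2 times a phase of frequency 2\<omega>, and the latter
  integrates to zero over a period.\<close>

lemma demodulation_integral:
  fixes a b :: complex
  assumes "\<omega> > 0"
  shows "((\<lambda>t. exp (- \<i> * of_real (\<omega> * t)) * (of_real (cos (\<omega> * t)) * a - of_real (sin (\<omega> * t)) * b))
     has_integral of_real (period \<omega> / 2) * (a + \<i> * b)) {0..period \<omega>}"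
proof -
  let ?k = "- 2 * \<i> * complex_of_real \<omega>"
  define \<Phi> where "\<Phi> t = (a + \<i> * b) / 2 * of_real t + (a - \<i> * b) / 2 / ?k * exp (?k * of_real t)" for t
  have T: "0 \<le> period \<omega>"
    using assms by (simp add: period_def)
  have "((\<lambda>t. (a + \<i> * b) / 2 + (a - \<i> * b) / 2 * exp (?k * of_real t)) has_integral \<Phi> (period \<omega>) - \<Phi> 0) {0..period \<omega>}"
  proof (rule fundamental_theorem_of_calculus[OF T])
    fix t
    have "(\<Phi> has_vector_derivative (a + \<i> * b) / 2 * of_real 1 + (a - \<i> * b) / 2 / ?k * (?k * exp (?k * of_real t))) (at t within {0..period \<omega>})"
      unfolding \<Phi>_def
      by (intro has_vector_derivative_add has_vector_derivative_mult_right exp_has_vector_derivative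
          has_vector_derivative_of_real has_vector_derivative_id[unfolded id_def] has_real_derivative_iff_has_vector_derivative[THEN iffD1] DERIV_ident)
    then show "(\<Phi> has_vector_derivative (a + \<i> * b) / 2 + (a - \<i> * b) / 2 * exp (?k * of_real t)) (at t within {0..period \<omega>})"
      using assms by simp
  qed
  moreover have "\<Phi> (period \<omega>) - \<Phi> 0 = of_real (period \<omega> / 2) * (a + \<i> * b)"
    unfolding \<Phi>_def period_phase(2)[OF assms] by simp
  moreover have "(a + \<i> * b) / 2 + (a - \<i> * b) / 2 * exp (?k * of_real t)
      = exp (- \<i> * of_real (\<omega> * t)) * (of_real (cos (\<omega> * t)) * a - of_real (sin (\<omega> * t)) * b)" for t
  proof -
    define E where "E = exp (\<i> * complex_of_real (\<omega> * t))"
    have E: "exp (- \<i> * of_real (\<omega> * t)) = inverse E"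
      by (simp add: E_def exp_minus)
    have "exp (?k * of_real t) = (exp (- \<i> * of_real (\<omega> * t)))\<^sup>2"
      by (simp add: exp_double[symmetric] mult.assoc)
    then have E2: "exp (?k * of_real t) = inverse E * inverse E"
      unfolding E by (simp add: power2_eq_square)
    have c: "complex_of_real (cos (\<omega> * t)) = (E + inverse E) / 2"
      and s: "complex_of_real (sin (\<omega> * t)) = - \<i> * (E - inverse E) / 2"
      by (simp_all add: E_def cos_exp_eq sin_exp_eq exp_minus flip: cos_of_real sin_of_real)
    have "E \<noteq> 0"
      by (simp add: E_def)
    then have "inverse E * E = 1"
      by simp
    then show ?thesis
      unfolding E E2 c s by algebra
  qed
  ultimately show ?thesis by simp
qed

context maxwell_data
begin

lemma demodulated_source:
  assumes "\<omega> > 0" "\<phi> \<in> Lspace D" "v \<in> Lspace D"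
  shows "((\<lambda>t. exp (- \<i> * of_real (\<omega> * t)) * ip D (em_Re (em_scale (exp (\<i> * of_real (\<omega> * t))) \<phi>)) v)
     has_integral of_real (period \<omega> / 2) * ip D \<phi> v) {0..period \<omega>}"
proof -
  define a b where "a = ip D (em_Re \<phi>) v" "b = ip D (em_Re (em_scale (- \<i>) \<phi>)) v"
  have L: "em_Re \<phi> \<in> Lspace D" "em_Re (em_scale (- \<i>) \<phi>) \<in> Lspace D"
    using assms(2) by (simp_all add: Lspace_Re Lspace_scale)
  have "ip D \<phi> v = ip D (em_diff (em_Re \<phi>) (em_scale (- \<i>) (em_Re (em_scale (- \<i>) \<phi>)))) v"
    using em_Re_Im[of \<phi>] by simp
  also have "\<dots> = a + \<i> * b"
    unfolding ip_diff_left[OF L(1) Lspace_scale[OF L(2)] assms(3)] ip_scale_left by (simp add: a_b_def)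
  finally have ab: "ip D \<phi> v = a + \<i> * b" .
  have "ip D (em_Re (em_scale (exp (\<i> * of_real (\<omega> * t))) \<phi>)) v
      = of_real (cos (\<omega> * t)) * a - of_real (sin (\<omega> * t)) * b" for t
    unfolding em_Re_scale[of "exp (\<i> * of_real (\<omega> * t))"]
      ip_diff_left[OF Lspace_scale[OF L(1)] Lspace_scale[OF L(2)] assms(3)] ip_scale_left
    by (simp add: a_b_def Re_exp Im_exp)
  then show ?thesis
    using demodulation_integral[OF assms(1), of a b] by (simp add: ab)
qed

text \<open>Continuity in the energy norm makes field, curls and traces continuous separately, so
  the whole form can be integrated in time. \<open>G\<close> is characterised by scalar integrals
  only, and its equation is tested with real fields, like the evolution equation it comes
  from.\<close>

lemma strong_solution_average:
  assumes \<omega>: "\<omega> > 0" and \<phi>: "\<phi> \<in> Lspace D" and U\<^sub>0: "U\<^sub>0 \<in> Lspace D"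
    and sol: "strong_solution D s \<omega> \<phi> U\<^sub>0 u"
  obtains G where "G \<in> Vspace D"
    "\<And>v. v \<in> Lspace D \<Longrightarrow> ((\<lambda>t. exp (- \<i> * of_real (\<omega> * t)) * ip D (u t) v) has_integral ip D G v) {0..period \<omega>}"
    "\<And>v. v \<in> VspaceR D \<Longrightarrow> \<i> * of_real \<omega> * ip D G v + aform D G v
       = of_real (period \<omega> / 2) * ip D \<phi> v + ip D (em_diff U\<^sub>0 (u (period \<omega>))) v"
proof -
  define T where "T = period \<omega>"
  have T: "0 < T"
    using \<omega> by (simp add: T_def period_def)
  define c where "c t = exp (- \<i> * of_real (\<omega> * t))" for t
  define f where "f t = em_scale (c t) (u t)" for t
  have uV: "u t \<in> Vspace D" if "t \<in> {0..T}" for t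
    using sol that VspaceI_VspaceR VspaceR_Vspace unfolding strong_solution_def T_def by blast
  have fV: "f t \<in> Vspace D" if "t \<in> {0..T}" for t
    unfolding f_def by (rule Vspace_scale[OF uV[OF that]])
  have ucont: "path_continuous (energy_norm D \<omega>) {0..T} u"
    using sol by (simp add: strong_solution_def T_def)
  have c_eq: "c t = exp ((- \<i> * of_real \<omega>) * of_real t)" for t
    by (simp add: c_def mult.assoc)
  have c_deriv: "(c has_vector_derivative (- \<i> * of_real \<omega>) * c t) (at t within I)" for t I
    unfolding c_eq[abs_def] by (rule exp_has_vector_derivative)
  have ccont: "continuous_on I c" for I
    unfolding c_def by (intro continuous_intros)
  note X = Vspace_Xspace[OF uV] and uc = path_continuous_energy_norm[OF \<omega> ucont uV]
  note fX = Vspace_Xspace[OF fV]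
  have fcont: "l2_continuous (vol D) {0..T} (\<lambda>t. fst (f t))" "l2_continuous (vol D) {0..T} (\<lambda>t. snd (f t))"
    unfolding f_def em_simps by (intro l2_continuous_scale[OF ccont] uc; assumption)+
  have tcont: "l2_continuous (surf D) {0..T} (\<lambda>t. tangential_trace D (fst (f t)))"
    "l2_continuous (surf D) {0..T} (\<lambda>t. tangential_trace D (snd (f t)))"
  proof -
    show "l2_continuous (surf D) {0..T} (\<lambda>t. tangential_trace D (fst (f t)))"
    proof (rule l2_continuous_cong_AE[OF l2_continuous_scale[OF ccont uc(3)] XspaceD(5)[OF fX(1)]])
      fix t assume "t \<in> {0..T}"
      then show "AE x in surf D. tangential_trace D (fst (f t)) x = c t *s tangential_trace D (fst (u t)) x"
        unfolding f_def em_simps by (intro Xspace_scale(3) X(1))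
    qed
    show "l2_continuous (surf D) {0..T} (\<lambda>t. tangential_trace D (snd (f t)))"
    proof (rule l2_continuous_cong_AE[OF l2_continuous_scale[OF ccont uc(4)] XspaceD(5)[OF fX(2)]])
      fix t assume "t \<in> {0..T}"
      then show "AE x in surf D. tangential_trace D (snd (f t)) x = c t *s tangential_trace D (snd (u t)) x"
        unfolding f_def em_simps by (intro Xspace_scale(3) X(2))
    qed
  qed
  have ccurl: "l2_continuous (vol D) {0..T} (\<lambda>t. weak_curl (Omega D) (fst (f t)))"
    "l2_continuous (vol D) {0..T} (\<lambda>t. weak_curl (Omega D) (snd (f t)))"
  proof -
    show "l2_continuous (vol D) {0..T} (\<lambda>t. weak_curl (Omega D) (fst (f t)))"
    proof (rule l2_continuous_cong_AE[OF l2_continuous_scale[OF ccont uc(5)] XspaceD(3)[OF fX(1)]])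
      fix t assume "t \<in> {0..T}"
      then show "AE x in vol D. weak_curl (Omega D) (fst (f t)) x = c t *s weak_curl (Omega D) (fst (u t)) x"
        unfolding f_def em_simps by (intro Xspace_scale(2) X(1))
    qed
    show "l2_continuous (vol D) {0..T} (\<lambda>t. weak_curl (Omega D) (snd (f t)))"
    proof (rule l2_continuous_cong_AE[OF l2_continuous_scale[OF ccont uc(6)] XspaceD(3)[OF fX(2)]])
      fix t assume "t \<in> {0..T}"
      then show "AE x in vol D. weak_curl (Omega D) (snd (f t)) x = c t *s weak_curl (Omega D) (snd (u t)) x"
        unfolding f_def em_simps by (intro Xspace_scale(2) X(2))
    qed
  qed
  obtain G1 where G1: "G1 \<in> L2 (vol D)"
    "\<And>v. v \<in> L2 (vol D) \<Longrightarrow> ((\<lambda>t. l2ip (vol D) (fst (f t)) v) has_integral l2ip (vol D) G1 v) {0..T}"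
  proof (rule l2_path_integral[OF less_imp_le[OF T] fcont(1)])
    fix G
    assume "G \<in> L2 (vol D)"
      and "\<And>v. v \<in> L2 (vol D) \<Longrightarrow> ((\<lambda>t. l2ip (vol D) (fst (f t)) v) has_integral l2ip (vol D) G v) {0..T}"
    then show thesis by (rule that)
  qed
  obtain G2 where G2: "G2 \<in> L2 (vol D)"
    "\<And>v. v \<in> L2 (vol D) \<Longrightarrow> ((\<lambda>t. l2ip (vol D) (snd (f t)) v) has_integral l2ip (vol D) G2 v) {0..T}"
  proof (rule l2_path_integral[OF less_imp_le[OF T] fcont(2)])
    fix G
    assume "G \<in> L2 (vol D)"
      and "\<And>v. v \<in> L2 (vol D) \<Longrightarrow> ((\<lambda>t. l2ip (vol D) (snd (f t)) v) has_integral l2ip (vol D) G v) {0..T}"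
    then show thesis by (rule that)
  qed
  define G where "G = (G1, G2)"
  have f1P: "fst (f t) \<in> XPspace D" if "t \<in> {0..T}" for t
    using fV[OF that] by (simp add: Vspace_iff)
  note I1 = Xspace_path_integral[OF less_imp_le[OF T] fX(1) ccurl(1) tcont(1) G1]
  note I2 = Xspace_path_integral[OF less_imp_le[OF T] fX(2) ccurl(2) tcont(2) G2]
  have G: "G \<in> Vspace D"
  proof -
    have "G1 \<in> XPspace D"
      by (rule I1(4); (rule f1P)?; assumption)
    moreover have "G2 \<in> Xspace D"
      by (rule I2(1); assumption)
    ultimately show ?thesis
      by (simp add: G_def Vspace_iff)
  qed
  have int_ip: "((\<lambda>t. c t * ip D (u t) v) has_integral ip D G v) {0..T}" if "v \<in> Lspace D" for v
  proof -
    have "((\<lambda>t. ip D (f t) v) has_integral ip D G v) {0..T}"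
      unfolding ip_left G_def fst_conv snd_conv
      by (intro has_integral_add G1(2) G2(2) ip_weights that)
    then show ?thesis
      by (simp add: f_def ip_scale_left)
  qed
  have int_a: "((\<lambda>t. c t * aform D (u t) v) has_integral aform D G v) {0..T}" if v: "v \<in> Vspace D" for v
  proof -
    note vX = Vspace_Xspace[OF v]
    have "((\<lambda>t. aform D (f t) v) has_integral aform D G v) {0..T}"
      unfolding aform_left G_def fst_conv snd_conv
      by (intro has_integral_add has_integral_diff G1(2) G2(2) I1(3) I2(3) aform_weights[OF v] XspaceD(3) vX)
    then show ?thesis
      by (rule has_integral_eq[rotated]) (simp add: f_def aform_scale_left[OF uV v])
  qed
  obtain U' where U'L: "\<And>t. t \<in> {0..T} \<Longrightarrow> U' t \<in> LspaceR D"
    and deriv: "path_derivative (em_norm D) {0..T} u U'"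
    and eq: "\<And>t v. \<lbrakk>t \<in> {0<..<T}; v \<in> VspaceR D\<rbrakk> \<Longrightarrow> ip D (U' t) v + aform D (u t) v
           = ip D (em_Re (em_scale (exp (\<i> * of_real (\<omega> * t))) \<phi>)) v"
    using sol unfolding strong_solution_def T_def by blast
  have u0: "em_eq D (u 0) U\<^sub>0"
    using sol by (simp add: strong_solution_def)
  have "\<i> * of_real \<omega> * ip D G v + aform D G v = of_real (T / 2) * ip D \<phi> v + ip D (em_diff U\<^sub>0 (u T)) v"
    if v: "v \<in> VspaceR D" for v
  proof -
    have vV: "v \<in> Vspace D"
      by (rule VspaceR_Vspace[OF v])
    have vL: "v \<in> Lspace D"
      by (rule Vspace_Lspace[OF vV])
    obtain K where K: "K \<ge> 0" "\<And>U. U \<in> Lspace D \<Longrightarrow> cmod (ip D U v) \<le> K * em_norm D U"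
      using ip_bound[OF vL] by blast
    have ip_cont: "continuous_on {0..T} (\<lambda>t. ip D (u t) v)"
      unfolding ip_left using uc(1,2) ip_weights(3,4)[OF vL]
      by (intro continuous_on_add l2_continuous_l2ip)
    \<comment> \<open>Differentiability in \<open>em_norm\<close> passes to every pairing through
      \<open>ip_bound\<close>.\<close>
    have ip_deriv: "((\<lambda>t. ip D (u t) v) has_vector_derivative ip D (U' t) v) (at t within {0..T})"
      if t: "t \<in> {0..T}" for t
      unfolding has_vector_derivative_def has_derivative_within
    proof (intro conjI bounded_linear_scaleR_left, rule Lim_null_comparison)
      let ?N = "\<lambda>\<tau>. em_norm D (em_diff (em_scale (of_real (1 / (\<tau> - t))) (em_diff (u \<tau>) (u t))) (U' t))"
      show "\<forall>\<^sub>F \<tau> in at t within {0..T}. norm ((1 / norm (\<tau> - t)) *\<^sub>R (ip D (u \<tau>) v - (ip D (u t) v + (\<tau> - t) *\<^sub>R ip D (U' t) v))) \<le> K * ?N \<tau>"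
        unfolding eventually_at_filter
      proof (rule eventuallyI, intro impI)
        fix \<tau> assume \<tau>: "\<tau> \<noteq> t" "\<tau> \<in> {0..T}"
        have L: "u \<tau> \<in> Lspace D" "u t \<in> Lspace D" "U' t \<in> Lspace D"
          using uV t \<tau>(2) U'L LspaceR_Lspace Vspace_Lspace by blast+
        let ?X = "em_diff (em_scale (of_real (1 / (\<tau> - t))) (em_diff (u \<tau>) (u t))) (U' t)"
        have XL: "?X \<in> Lspace D"
          by (intro Lspace_diff Lspace_scale L)
        have "ip D ?X v = of_real (1 / (\<tau> - t)) * (ip D (u \<tau>) v - ip D (u t) v) - ip D (U' t) v"
          by (simp only: ip_diff_left[OF Lspace_scale[OF Lspace_diff[OF L(1,2)]] L(3) vL] ip_scale_left ip_diff_left[OF L(1,2) vL])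
        also have "\<dots> = (1 / (\<tau> - t)) *\<^sub>R (ip D (u \<tau>) v - (ip D (u t) v + (\<tau> - t) *\<^sub>R ip D (U' t) v))"
          using \<tau>(1) by (simp add: scaleR_conv_of_real field_simps)
        finally have "norm ((1 / norm (\<tau> - t)) *\<^sub>R (ip D (u \<tau>) v - (ip D (u t) v + (\<tau> - t) *\<^sub>R ip D (U' t) v))) = cmod (ip D ?X v)"
          by simp
        then show "norm ((1 / norm (\<tau> - t)) *\<^sub>R (ip D (u \<tau>) v - (ip D (u t) v + (\<tau> - t) *\<^sub>R ip D (U' t) v))) \<le> K * ?N \<tau>"
          using K(2)[OF XL] by simp
      qed
      have "(?N \<longlongrightarrow> 0) (at t within {0..T})"
        using deriv t unfolding path_derivative_def by blast
      then have "((\<lambda>\<tau>. K * ?N \<tau>) \<longlongrightarrow> K * 0) (at t within {0..T})"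
        by (intro tendsto_intros)
      then show "((\<lambda>\<tau>. K * ?N \<tau>) \<longlongrightarrow> 0) (at t within {0..T})"
        by simp
    qed
    define h where "h t = c t * ip D (u t) v" for t
    have "((\<lambda>t. c t * ip D (U' t) v + (- \<i> * of_real \<omega>) * c t * ip D (u t) v) has_integral h T - h 0) {0..T}"
      unfolding h_def
      by (intro fundamental_theorem_of_calculus has_vector_derivative_mult c_deriv ip_deriv)
        (use T in auto)
    \<comment> \<open>The evolution equation holds on the open interval; the two endpoints form a
      finite exceptional set for the integral.\<close>
    then have "((\<lambda>t. c t * ip D (em_Re (em_scale (exp (\<i> * of_real (\<omega> * t))) \<phi>)) v - c t * aform D (u t) v
        + (- \<i> * of_real \<omega>) * (c t * ip D (u t) v)) has_integral h T - h 0) {0..T}"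
    proof (rule has_integral_spike_finite[of "{0, T}", rotated 2])
      fix t assume "t \<in> {0..T} - {0, T}"
      then have "t \<in> {0<..<T}" by auto
      then have "ip D (em_Re (em_scale (exp (\<i> * of_real (\<omega> * t))) \<phi>)) v = ip D (U' t) v + aform D (u t) v"
        using eq[OF _ v] by simp
      then show "c t * ip D (em_Re (em_scale (exp (\<i> * of_real (\<omega> * t))) \<phi>)) v - c t * aform D (u t) v
        + (- \<i> * of_real \<omega>) * (c t * ip D (u t) v) = c t * ip D (U' t) v + (- \<i> * of_real \<omega>) * c t * ip D (u t) v"
        by (simp add: algebra_simps)
    qed simp
    moreover have "((\<lambda>t. c t * ip D (em_Re (em_scale (exp (\<i> * of_real (\<omega> * t))) \<phi>)) v - c t * aform D (u t) v
        + (- \<i> * of_real \<omega>) * (c t * ip D (u t) v))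
        has_integral of_real (T / 2) * ip D \<phi> v - aform D G v + (- \<i> * of_real \<omega>) * ip D G v) {0..T}"
      using demodulated_source[OF \<omega> \<phi> vL] unfolding T_def[symmetric] c_def[symmetric]
      by (intro has_integral_add has_integral_diff has_integral_mult_right int_a[OF vV] int_ip[OF vL])
    ultimately have "h T - h 0 = of_real (T / 2) * ip D \<phi> v - aform D G v + (- \<i> * of_real \<omega>) * ip D G v"
      by (rule has_integral_unique)
    then have "\<i> * of_real \<omega> * ip D G v + aform D G v = of_real (T / 2) * ip D \<phi> v - (h T - h 0)"
      by simp
    moreover have "h T = ip D (u T) v"
      using period_phase(1)[OF \<omega>] by (simp add: h_def c_def T_def)
    moreover have "h 0 = ip D U\<^sub>0 v"
      using ip_cong[OF _ U\<^sub>0 u0 vL] Vspace_Lspace[OF uV[of 0]] T by (simp add: h_def c_def)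
    moreover have "ip D (em_diff U\<^sub>0 (u T)) v = ip D U\<^sub>0 v - ip D (u T) v"
      using Vspace_Lspace[OF uV[of T]] T by (simp add: ip_diff_left U\<^sub>0 vL)
    ultimately show ?thesis
      by simp
  qed
  then show thesis
    using that[OF G] int_ip unfolding c_def T_def by blast
qed

text \<open>The field \<phi> + \<omega>/\<pi> (U0 - W), with the sum expressed as a difference with
  a negative factor.\<close>

definition filtered_source :: "real \<Rightarrow> em \<Rightarrow> em \<Rightarrow> em \<Rightarrow> em" where
  "filtered_source \<omega> \<phi> U\<^sub>0 W = em_diff \<phi> (em_scale (of_real (- \<omega> / pi)) (em_diff U\<^sub>0 W))"

lemma filtered_source_Lspace:
  "\<lbrakk>\<phi> \<in> Lspace D; U\<^sub>0 \<in> Lspace D; W \<in> Lspace D\<rbrakk> \<Longrightarrow> filtered_source \<omega> \<phi> U\<^sub>0 W \<in> Lspace D"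
  unfolding filtered_source_def by (intro Lspace_diff Lspace_scale)

lemma ip_filtered_source:
  "\<lbrakk>\<phi> \<in> Lspace D; U\<^sub>0 \<in> Lspace D; W \<in> Lspace D; v \<in> Lspace D\<rbrakk> \<Longrightarrow>
     ip D (filtered_source \<omega> \<phi> U\<^sub>0 W) v = ip D \<phi> v + of_real (\<omega> / pi) * ip D (em_diff U\<^sub>0 W) v"
  unfolding filtered_source_def
  by (simp add: ip_diff_left[of \<phi>] Lspace_diff Lspace_scale ip_scale_left)

text \<open>A complex test is a + i b with real a and b. Both sides are conjugate linear in the
  test, so the two real equations combine with the factors 1 and -i.\<close>

lemma harmonic_solution_of_real_tests:
  assumes "F \<in> Vspace D" "\<psi> \<in> Lspace D"
    and eq: "\<And>v. v \<in> VspaceR D \<Longrightarrow> \<i> * of_real \<omega> * ip D F v + aform D F v = ip D \<psi> v"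
  shows "harmonic_solution D \<omega> \<psi> F"
  unfolding harmonic_solution_def
proof (intro conjI ballI assms(1))
  fix w assume w: "w \<in> Vspace D"
  define a b where "a = em_Re w" "b = em_Re (em_scale (- \<i>) w)"
  have R: "a \<in> VspaceR D" "b \<in> VspaceR D"
    using w by (simp_all add: a_b_def VspaceR_Re Vspace_scale)
  have V: "a \<in> Vspace D" "em_scale (- \<i>) b \<in> Vspace D" "b \<in> Vspace D"
    using R VspaceR_Vspace Vspace_scale by blast+
  note L = Vspace_Lspace[OF V(1)] Vspace_Lspace[OF V(2)] and FL = Vspace_Lspace[OF assms(1)]
  have wab: "w = em_diff a (em_scale (- \<i>) b)"
    using em_Re_Im[of w] by (simp add: a_b_def)
  have 1: "ip D F w = ip D F a - \<i> * ip D F b" "ip D \<psi> w = ip D \<psi> a - \<i> * ip D \<psi> b"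
    unfolding wab by (simp_all only: ip_diff_right[OF L FL] ip_diff_right[OF L assms(2)] ip_scale_right) simp_all
  have 2: "aform D F w = aform D F a - \<i> * aform D F b"
    unfolding wab by (simp only: aform_diff_right[OF V(1,2) assms(1)] aform_scale_right[OF V(3) assms(1)]) simp
  show "\<i> * of_real \<omega> * ip D F w + aform D F w = ip D \<psi> w"
    unfolding 1 2 eq[OF R(1), symmetric] eq[OF R(2), symmetric] by (simp add: algebra_simps)
qed

lemma strong_solution_filter:
  assumes \<omega>: "\<omega> > 0" and \<phi>: "\<phi> \<in> Lspace D" and U\<^sub>0: "U\<^sub>0 \<in> Lspace D"
    and sol: "strong_solution D s \<omega> \<phi> U\<^sub>0 u"
  obtains F where "harmonic_solution D \<omega> (filtered_source \<omega> \<phi> U\<^sub>0 (u (period \<omega>))) F"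
    "\<And>v. v \<in> Lspace D \<Longrightarrow> ((\<lambda>t. exp (- \<i> * of_real (\<omega> * t)) * ip D (u t) v) has_integral of_real (period \<omega> / 2) * ip D F v) {0..period \<omega>}"
proof (rule strong_solution_average[OF assms])
  fix G
  assume G: "G \<in> Vspace D"
    and int: "\<And>v. v \<in> Lspace D \<Longrightarrow> ((\<lambda>t. exp (- \<i> * of_real (\<omega> * t)) * ip D (u t) v) has_integral ip D G v) {0..period \<omega>}"
    and eq: "\<And>v. v \<in> VspaceR D \<Longrightarrow> \<i> * of_real \<omega> * ip D G v + aform D G v
       = of_real (period \<omega> / 2) * ip D \<phi> v + ip D (em_diff U\<^sub>0 (u (period \<omega>))) v"
  \<comment> \<open>Since \<omega>/\<pi> = 2/T, multiplying the average by it normalises the source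
    term and produces the factor of the boundary term.\<close>
  have T: "complex_of_real (\<omega> / pi) * of_real (period \<omega> / 2) = 1"
    using \<omega> by (simp add: period_def flip: of_real_mult)
  have "period \<omega> \<in> {0..period \<omega>}"
    using \<omega> by (simp add: period_def)
  then have uT: "u (period \<omega>) \<in> Lspace D"
    using sol VspaceI_VspaceR VspaceR_LspaceR LspaceR_Lspace unfolding strong_solution_def by blast
  define F where "F = em_scale (of_real (\<omega> / pi)) G"
  have FV: "F \<in> Vspace D"
    unfolding F_def by (rule Vspace_scale[OF G])
  show thesis
  proof (rule that)
    show "harmonic_solution D \<omega> (filtered_source \<omega> \<phi> U\<^sub>0 (u (period \<omega>))) F"
    proof (rule harmonic_solution_of_real_tests[OF FV filtered_source_Lspace[OF \<phi> U\<^sub>0 uT]])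
      fix v assume v: "v \<in> VspaceR D"
      note vV = VspaceR_Vspace[OF v]
      have "\<i> * of_real \<omega> * ip D F v + aform D F v = of_real (\<omega> / pi) * (\<i> * of_real \<omega> * ip D G v + aform D G v)"
        unfolding F_def ip_scale_left aform_scale_left[OF G vV] by (simp only: distrib_left mult_ac)
      also have "\<dots> = (of_real (\<omega> / pi) * of_real (period \<omega> / 2)) * ip D \<phi> v + of_real (\<omega> / pi) * ip D (em_diff U\<^sub>0 (u (period \<omega>))) v"
        unfolding eq[OF v] by (simp only: distrib_left mult_ac)
      also have "\<dots> = ip D (filtered_source \<omega> \<phi> U\<^sub>0 (u (period \<omega>))) v"
        unfolding T ip_filtered_source[OF \<phi> U\<^sub>0 uT Vspace_Lspace[OF vV]] by simp
      finally show "\<i> * of_real \<omega> * ip D F v + aform D F v = ip D (filtered_source \<omega> \<phi> U\<^sub>0 (u (period \<omega>))) v" .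
    qed
    fix v assume "v \<in> Lspace D"
    moreover have "of_real (period \<omega> / 2) * ip D F v = ip D G v"
      unfolding F_def ip_scale_left using T by (metis mult.assoc mult.commute mult_1)
    ultimately show "((\<lambda>t. exp (- \<i> * of_real (\<omega> * t)) * ip D (u t) v) has_integral of_real (period \<omega> / 2) * ip D F v) {0..period \<omega>}"
      using int by simp
  qed
qed

section \<open>Existence of the extended evolution\<close>

lemma em_sq_triangle:
  assumes "a \<in> Lspace D" "b \<in> Lspace D" "c \<in> Lspace D"
  shows "em_sq (em_diff a c) \<le> 2 * em_sq (em_diff a b) + 2 * em_sq (em_diff b c)"
proof -
  have tri: "l2sq (vol D) (\<lambda>x. f x - h x) \<le> 2 * l2sq (vol D) (\<lambda>x. f x - g x) + 2 * l2sq (vol D) (\<lambda>x. g x - h x)"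
    if "f \<in> L2 (vol D)" "g \<in> L2 (vol D)" "h \<in> L2 (vol D)" for f g h
    using L2_add(2)[OF L2_diff(1)[OF that(1,2)] L2_diff(1)[OF that(2,3)]] by simp
  have L: "fst a \<in> L2 (vol D)" "snd a \<in> L2 (vol D)" "fst b \<in> L2 (vol D)" "snd b \<in> L2 (vol D)"
    "fst c \<in> L2 (vol D)" "snd c \<in> L2 (vol D)"
    using assms by (simp_all add: Lspace_iff)
  then show ?thesis
    unfolding em_sq_def em_simps distrib_left using tri[OF L(1,3,5)] tri[OF L(2,4,6)] by linarith
qed

lemma em_sq_commute: "em_sq (em_diff a b) = em_sq (em_diff b a)"
  by (simp add: em_sq_def l2sq_def norm_minus_commute)

lemma em_real_iff: "em_real D U \<longleftrightarrow> (AE x in vol D. fst U x = vec_Re (fst U x) \<and> snd U x = vec_Re (snd U x))"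
  by (simp add: em_real_def vec_Re_def vec_eq_iff complex_eq_iff all_conj_distrib)

text \<open>Taking real parts is a contraction that fixes real fields, so a limit of real fields may
  be replaced by its real part without loss.\<close>

lemma em_sq_diff_Re_le:
  assumes "U \<in> LspaceR D" "W \<in> Lspace D"
  shows "em_sq (em_diff U (em_Re W)) \<le> em_sq (em_diff U W)"
proof -
  have UL: "U \<in> Lspace D" and "em_real D U"
    using assms(1) by (simp_all add: LspaceR_def)
  then have AE: "AE x in vol D. fst U x = vec_Re (fst U x)" "AE x in vol D. snd U x = vec_Re (snd U x)"
    unfolding em_real_iff by (auto elim!: eventually_mono)
  have part: "l2sq (vol D) (\<lambda>x. f x - vec_Re (g x)) \<le> l2sq (vol D) (\<lambda>x. f x - g x)"
    if "f \<in> L2 (vol D)" "g \<in> L2 (vol D)" "AE x in vol D. f x = vec_Re (f x)" for f g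
  proof -
    have "AE x in vol D. norm (f x - vec_Re (g x)) \<le> 1 * norm (f x - g x)"
      using that(3)
    proof eventually_elim
      case (elim x)
      have "f x - vec_Re (g x) = vec_Re (f x - g x)"
        by (subst elim) (simp add: vec_Re_def vec_eq_iff)
      then show ?case
        using norm_vec_Re_le[of "f x - g x"] by simp
    qed
    from L2_bound(2)[OF L2_measurable[OF L2_diff(1)[OF that(1) L2_vec_Re[OF that(2)]]] L2_diff(1)[OF that(1,2)] this]
    show ?thesis by simp
  qed
  show ?thesis
    unfolding em_sq_def em_simps
    using UL assms(2) AE by (intro add_mono part) (simp_all add: Lspace_iff)
qed

text \<open>The rate 2 \<epsilon> n depends only on the Cauchy bound and not on the sequence, so
  applying the lemma at each time gives convergence uniform in time.\<close>

lemma Lspace_complete: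
  assumes X: "\<And>n::nat. X n \<in> LspaceR D" and \<epsilon>: "\<epsilon> \<longlonglongrightarrow> 0"
    and Cauchy: "\<And>m n. em_sq (em_diff (X m) (X n)) \<le> \<epsilon> m + \<epsilon> n"
  shows "\<exists>Y\<in>LspaceR D. \<forall>n. em_sq (em_diff (X n) Y) \<le> 2 * \<epsilon> n"
proof -
  have XL: "X n \<in> Lspace D" for n
    by (rule LspaceR_Lspace[OF X])
  have fL: "fst (X n) \<in> L2 (vol D)" and sL: "snd (X n) \<in> L2 (vol D)" for n
    using XL[of n] by (simp_all add: Lspace_iff)
  have C: "\<exists>N. \<forall>m\<ge>N. \<forall>n\<ge>N. em_sq (em_diff (X m) (X n)) \<le> e" if "e > 0" for e
  proof -
    have "\<forall>\<^sub>F n in sequentially. \<epsilon> n < e / 2"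
      using \<epsilon> \<open>e > 0\<close> by (intro order_tendstoD(2)) auto
    then obtain N where N: "\<And>n. n \<ge> N \<Longrightarrow> \<epsilon> n < e / 2"
      by (auto simp: eventually_sequentially)
    have "em_sq (em_diff (X m) (X n)) \<le> e" if "m \<ge> N" "n \<ge> N" for m n
      using Cauchy[of m n] N[OF that(1)] N[OF that(2)] by linarith
    then show ?thesis by blast
  qed
  obtain g1 where g1: "g1 \<in> L2 (vol D)" "(\<lambda>k. l2sq (vol D) (\<lambda>x. fst (X k) x - g1 x)) \<longlonglongrightarrow> 0"
  proof (rule L2_complete[OF fL])
    fix e :: real assume "e > 0"
    then obtain N where N: "\<forall>m\<ge>N. \<forall>n\<ge>N. em_sq (em_diff (X m) (X n)) \<le> e"
      using C by blast
    have "l2sq (vol D) (\<lambda>x. fst (X m) x - fst (X n) x) \<le> em_sq (em_diff (X m) (X n))" for m n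
      by (simp add: em_sq_def)
    with N show "\<exists>N. \<forall>m\<ge>N. \<forall>n\<ge>N. l2sq (vol D) (\<lambda>x. fst (X m) x - fst (X n) x) \<le> e"
      using order_trans by blast
  qed blast
  obtain g2 where g2: "g2 \<in> L2 (vol D)" "(\<lambda>k. l2sq (vol D) (\<lambda>x. snd (X k) x - g2 x)) \<longlonglongrightarrow> 0"
  proof (rule L2_complete[OF sL])
    fix e :: real assume "e > 0"
    then obtain N where N: "\<forall>m\<ge>N. \<forall>n\<ge>N. em_sq (em_diff (X m) (X n)) \<le> e"
      using C by blast
    have "l2sq (vol D) (\<lambda>x. snd (X m) x - snd (X n) x) \<le> em_sq (em_diff (X m) (X n))" for m n
      by (simp add: em_sq_def)
    with N show "\<exists>N. \<forall>m\<ge>N. \<forall>n\<ge>N. l2sq (vol D) (\<lambda>x. snd (X m) x - snd (X n) x) \<le> e"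
      using order_trans by blast
  qed blast
  define Y where "Y = (g1, g2)"
  have Y: "Y \<in> Lspace D"
    using g1 g2 by (simp add: Y_def Lspace_iff)
  have lim: "(\<lambda>m. em_sq (em_diff (X m) Y)) \<longlonglongrightarrow> 0"
    using tendsto_add[OF g1(2) g2(2)] by (simp add: em_sq_def Y_def)
  \<comment> \<open>With n fixed, m tends to infinity in the triangle inequality for
    \<open>em_sq\<close>.\<close>
  have le: "em_sq (em_diff (X n) Y) \<le> 2 * \<epsilon> n" for n
  proof (rule LIMSEQ_le_const)
    have "(\<lambda>m. 2 * (\<epsilon> n + \<epsilon> m) + 2 * em_sq (em_diff (X m) Y)) \<longlonglongrightarrow> 2 * (\<epsilon> n + 0) + 2 * 0"
      by (intro tendsto_intros \<epsilon> lim)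
    then show "(\<lambda>m. 2 * (\<epsilon> n + \<epsilon> m) + 2 * em_sq (em_diff (X m) Y)) \<longlonglongrightarrow> 2 * \<epsilon> n"
      by simp
    have "em_sq (em_diff (X n) Y) \<le> 2 * (\<epsilon> n + \<epsilon> m) + 2 * em_sq (em_diff (X m) Y)" for m
      using em_sq_triangle[OF XL[of n] XL[of m] Y] Cauchy[of n m] unfolding distrib_left by linarith
    then show "\<exists>N. \<forall>m\<ge>N. em_sq (em_diff (X n) Y) \<le> 2 * (\<epsilon> n + \<epsilon> m) + 2 * em_sq (em_diff (X m) Y)"
      by blast
  qed
  have "em_Re Y \<in> LspaceR D"
    using Lspace_Re[OF Y] em_real_em_Re by (simp add: LspaceR_def)
  moreover have "em_sq (em_diff (X n) (em_Re Y)) \<le> 2 * \<epsilon> n" for n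
    using em_sq_diff_Re_le[OF X[of n] Y] le[of n] by linarith
  ultimately show ?thesis by blast
qed

text \<open>\<open>solution_map\<close> is a choice, so its defining property is available only once
  some extended path exists. Data within 1/(n+1) and the Lipschitz bound make the strong solutions
  Cauchy uniformly in time, and continuity passes to the uniform limit.\<close>

lemma evolution_exists:
  assumes \<omega>: "\<omega> > 0" and wp: "evolution_wellposed D s \<omega>" and \<phi>: "\<phi> \<in> Lspace D" and U\<^sub>0: "U\<^sub>0 \<in> LspaceR D"
  shows "\<exists>U. evolution D s \<omega> \<phi> U\<^sub>0 U"
proof -
  define I where "I = {0..period \<omega>}"
  obtain c where c: "c > 0" "\<And>U. U \<in> Lspace D \<Longrightarrow> c * em_sq U \<le> (em_norm D U)\<^sup>2"
    using em_norm_ge by blast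
  obtain C' where C': "C' \<ge> 0" "\<And>U. U \<in> Lspace D \<Longrightarrow> (em_norm D U)\<^sup>2 \<le> C' * em_sq U"
    using em_norm_le by blast
  have U0L: "U\<^sub>0 \<in> Lspace D"
    by (rule LspaceR_Lspace[OF U\<^sub>0])
  have "\<exists>W\<^sub>0. W\<^sub>0 \<in> VspaceI D s \<and> em_norm D (em_diff W\<^sub>0 U\<^sub>0) < 1 / real (Suc n)" for n
    using wp U\<^sub>0 unfolding evolution_wellposed_def by (metis of_nat_0_less_iff zero_less_Suc zero_less_divide_1_iff)
  then obtain u0 where u0: "\<And>n. u0 n \<in> VspaceI D s" "\<And>n. em_norm D (em_diff (u0 n) U\<^sub>0) < 1 / real (Suc n)"
    by metis
  have "\<exists>U. strong_solution D s \<omega> \<phi> (u0 n) U" for n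
    using wp \<phi> u0(1) unfolding evolution_wellposed_def by meson
  then obtain u where u: "\<And>n. strong_solution D s \<omega> \<phi> (u0 n) (u n)"
    by metis
  obtain B where B: "\<And>m n t. t \<in> I \<Longrightarrow> em_norm D (em_diff (u m t) (u n t)) \<le> B * em_norm D (em_diff (u0 m) (u0 n))"
    using wp \<phi> u0(1) u unfolding evolution_wellposed_def I_def by meson
  have u0L: "u0 n \<in> Lspace D" for n
    using u0(1) VspaceI_VspaceR VspaceR_LspaceR LspaceR_Lspace by blast
  have uR: "u n t \<in> VspaceR D" if "t \<in> I" for n t
    using u[of n] that VspaceI_VspaceR unfolding strong_solution_def I_def by blast
  have uL: "u n t \<in> Lspace D" if "t \<in> I" for n t
    using uR[OF that] VspaceR_LspaceR LspaceR_Lspace by blast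
  \<comment> \<open>\<open>B\<close> is the Lipschitz constant. \<open>C'\<close> and
    \<open>c\<close> convert between \<open>em_norm\<close> and \<open>em_sq\<close>, with
    \<open>c\<close> used once for the data and once for the paths, and the 2 comes from the
    triangle inequality through \<open>U\<^sub>0\<close>.\<close>
  define \<epsilon> where "\<epsilon> n = B\<^sup>2 * C' * 2 / c / c * (1 / real (Suc n))\<^sup>2" for n
  have inv_lim: "(\<lambda>n. 1 / real (Suc n)) \<longlonglongrightarrow> 0"
    using LIMSEQ_Suc[OF lim_1_over_n[where 'a = real]] .
  have \<epsilon>_lim: "\<epsilon> \<longlonglongrightarrow> 0"
  proof -
    have "(\<lambda>n. B\<^sup>2 * C' * 2 / c / c * (1 / real (Suc n))\<^sup>2) \<longlonglongrightarrow> B\<^sup>2 * C' * 2 / c / c * 0\<^sup>2"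
      by (intro tendsto_mult tendsto_power inv_lim tendsto_const)
    then show ?thesis
      by (simp add: \<epsilon>_def[abs_def])
  qed
  have sq0: "em_sq (em_diff (u0 n) U\<^sub>0) \<le> (1 / real (Suc n))\<^sup>2 / c" for n
  proof -
    have L: "em_diff (u0 n) U\<^sub>0 \<in> Lspace D"
      by (rule Lspace_diff[OF u0L U0L])
    have "(em_norm D (em_diff (u0 n) U\<^sub>0))\<^sup>2 \<le> (1 / real (Suc n))\<^sup>2"
      using u0(2)[of n] em_norm_nonneg[OF L] by (intro power_mono) auto
    then have "c * em_sq (em_diff (u0 n) U\<^sub>0) \<le> (1 / real (Suc n))\<^sup>2"
      using c(2)[OF L] by linarith
    then show ?thesis
      using c(1) by (simp add: pos_le_divide_eq mult.commute)
  qed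
  have Cauchy: "em_sq (em_diff (u m t) (u n t)) \<le> \<epsilon> m + \<epsilon> n" if t: "t \<in> I" for m n t
  proof -
    note L = Lspace_diff[OF uL[OF t] uL[OF t], of m n] Lspace_diff[OF u0L u0L, of m n]
    have "c * em_sq (em_diff (u m t) (u n t)) \<le> (em_norm D (em_diff (u m t) (u n t)))\<^sup>2"
      by (rule c(2)[OF L(1)])
    also have "\<dots> \<le> (B * em_norm D (em_diff (u0 m) (u0 n)))\<^sup>2"
      by (intro power_mono B t em_norm_nonneg L)
    also have "\<dots> = B\<^sup>2 * (em_norm D (em_diff (u0 m) (u0 n)))\<^sup>2"
      by (simp add: power_mult_distrib)
    also have "\<dots> \<le> B\<^sup>2 * (C' * em_sq (em_diff (u0 m) (u0 n)))"
      by (intro mult_left_mono C'(2) L) simp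
    also have "\<dots> \<le> B\<^sup>2 * (C' * (2 * ((1 / real (Suc m))\<^sup>2 / c) + 2 * ((1 / real (Suc n))\<^sup>2 / c)))"
    proof (intro mult_left_mono C'(1))
      show "em_sq (em_diff (u0 m) (u0 n)) \<le> 2 * ((1 / real (Suc m))\<^sup>2 / c) + 2 * ((1 / real (Suc n))\<^sup>2 / c)"
        using em_sq_triangle[OF u0L[of m] U0L u0L[of n]] sq0[of m] sq0[of n] em_sq_commute[of U\<^sub>0 "u0 n"] by linarith
    qed simp
    also have "\<dots> = c * (\<epsilon> m + \<epsilon> n)"
    proof -
      have "c * \<epsilon> k = B\<^sup>2 * C' * 2 / c * (1 / real (Suc k))\<^sup>2" for k
        using c(1) by (simp add: \<epsilon>_def)
      then have "c * (\<epsilon> m + \<epsilon> n) = B\<^sup>2 * C' * 2 / c * (1 / real (Suc m))\<^sup>2 + B\<^sup>2 * C' * 2 / c * (1 / real (Suc n))\<^sup>2"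
        by (simp only: distrib_left)
      then show ?thesis
        by (simp only: distrib_left times_divide_eq_right times_divide_eq_left mult_ac)
    qed
    finally show ?thesis
      using c(1) by simp
  qed
  have "\<exists>Y\<in>LspaceR D. \<forall>n. em_sq (em_diff (u n t) Y) \<le> 2 * \<epsilon> n" if t: "t \<in> I" for t
    by (rule Lspace_complete[OF VspaceR_LspaceR[OF uR[OF t]] \<epsilon>_lim Cauchy[OF t]])
  then obtain U' where U': "\<And>t. t \<in> I \<Longrightarrow> U' t \<in> LspaceR D" "\<And>t n. t \<in> I \<Longrightarrow> em_sq (em_diff (u n t) (U' t)) \<le> 2 * \<epsilon> n"
    by metis
  \<comment> \<open>Outside the period a default value is set, because
    \<open>em_norm_tendsto_0\<close> asks for membership in \<open>Lspace\<close> at all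
    times.\<close>
  define U where "U t = (if t \<in> I then U' t else U\<^sub>0)" for t
  have U: "U t \<in> LspaceR D" "t \<in> I \<Longrightarrow> em_sq (em_diff (u n t) (U t)) \<le> 2 * \<epsilon> n" for t n
    using U' U\<^sub>0 by (auto simp: U_def)
  have UL: "U t \<in> Lspace D" for t
    by (rule LspaceR_Lspace[OF U(1)])
  have "path_continuous (em_norm D) I U"
    unfolding path_continuous_def
  proof
    fix t assume t: "t \<in> I"
    show "((\<lambda>\<tau>. em_norm D (em_diff (U \<tau>) (U t))) \<longlongrightarrow> 0) (at t within I)"
    proof (rule em_norm_tendsto_0)
      show "em_diff (U \<tau>) (U t) \<in> Lspace D" for \<tau>
        by (rule Lspace_diff[OF UL UL])
      show "((\<lambda>\<tau>. em_sq (em_diff (U \<tau>) (U t))) \<longlongrightarrow> 0) (at t within I)"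
      proof (rule tendstoI)
        fix e :: real assume "e > 0"
        \<comment> \<open>The two approximation errors contribute 12 \<epsilon> n in total, which is
          below e/2, and the oscillation of the n-th path contributes 4 times e/8.\<close>
        have "\<forall>\<^sub>F n in sequentially. \<epsilon> n < e / 24"
          using \<epsilon>_lim \<open>e > 0\<close> by (intro order_tendstoD(2)) auto
        then obtain n where n: "\<epsilon> n < e / 24"
          by (auto simp: eventually_sequentially)
        have ucont: "path_continuous (energy_norm D \<omega>) I (u n)"
          using u[of n] by (simp add: strong_solution_def I_def)
        have uc: "l2_continuous (vol D) I (\<lambda>t. fst (u n t))" "l2_continuous (vol D) I (\<lambda>t. snd (u n t))"
          by (rule path_continuous_energy_norm(1,2)[OF \<omega> ucont]; rule VspaceR_Vspace[OF uR]; assumption)+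
        have "((\<lambda>\<tau>. em_sq (em_diff (u n \<tau>) (u n t))) \<longlongrightarrow> 0 + 0) (at t within I)"
          unfolding em_sq_def em_simps using uc t by (intro tendsto_add) (auto simp: l2_continuous_def)
        then have "\<forall>\<^sub>F \<tau> in at t within I. em_sq (em_diff (u n \<tau>) (u n t)) < e / 8"
          using \<open>e > 0\<close> by (intro order_tendstoD(2)) auto
        moreover have "\<forall>\<^sub>F \<tau> in at t within I. \<tau> \<in> I"
          by (simp add: eventually_at_filter)
        ultimately show "\<forall>\<^sub>F \<tau> in at t within I. dist (em_sq (em_diff (U \<tau>) (U t))) 0 < e"
        proof eventually_elim
          case (elim \<tau>)
          have "em_sq (em_diff (U \<tau>) (U t)) \<le> 2 * em_sq (em_diff (u n \<tau>) (U \<tau>)) + 2 * em_sq (em_diff (u n \<tau>) (U t))"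
            using em_sq_triangle[OF UL[of \<tau>] uL[OF elim(2), of n] UL[of t]] em_sq_commute[of "U \<tau>" "u n \<tau>"] by simp
          moreover have "em_sq (em_diff (u n \<tau>) (U t)) \<le> 2 * em_sq (em_diff (u n \<tau>) (u n t)) + 2 * em_sq (em_diff (u n t) (U t))"
            by (rule em_sq_triangle[OF uL[OF elim(2)] uL[OF t] UL])
          ultimately have "em_sq (em_diff (U \<tau>) (U t)) < e"
            using U(2)[OF elim(2), of n] U(2)[OF t, of n] n elim(1) by linarith
          then show ?case by simp
        qed
      qed
    qed
  qed
  moreover have "(\<lambda>n. em_norm D (em_diff (u0 n) U\<^sub>0)) \<longlonglongrightarrow> 0"
  proof (rule Lim_null_comparison[OF _ inv_lim])
    show "\<forall>\<^sub>F n in sequentially. norm (em_norm D (em_diff (u0 n) U\<^sub>0)) \<le> 1 / real (Suc n)"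
      using u0(2) em_norm_nonneg[OF Lspace_diff[OF u0L U0L]] by (intro always_eventually allI) (simp add: less_imp_le)
  qed
  moreover have "\<forall>\<^sub>F n in sequentially. \<forall>t \<in> I. em_norm D (em_diff (u n t) (U t)) < e" if "e > 0" for e
  proof -
    have "(\<lambda>n. C' * (2 * \<epsilon> n)) \<longlonglongrightarrow> C' * (2 * 0)"
      by (intro tendsto_mult tendsto_const \<epsilon>_lim)
    then have "\<forall>\<^sub>F n in sequentially. C' * (2 * \<epsilon> n) < e\<^sup>2"
      using \<open>e > 0\<close> by (intro order_tendstoD(2)) auto
    then show ?thesis
    proof eventually_elim
      case (elim n)
      show ?case
      proof
        fix t assume t: "t \<in> I"
        have "(em_norm D (em_diff (u n t) (U t)))\<^sup>2 \<le> C' * em_sq (em_diff (u n t) (U t))"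
          by (rule C'(2)[OF Lspace_diff[OF uL[OF t] UL]])
        also have "\<dots> \<le> C' * (2 * \<epsilon> n)"
          by (rule mult_left_mono[OF U(2)[OF t] C'(1)])
        also have "\<dots> < e\<^sup>2"
          by (rule elim)
        finally show "em_norm D (em_diff (u n t) (U t)) < e"
          using \<open>e > 0\<close> by (meson less_imp_le power2_less_imp_less)
      qed
    qed
  qed
  ultimately have "evolution D s \<omega> \<phi> U\<^sub>0 U"
    unfolding evolution_def I_def[symmetric] using U(1) u0(1) u by blast
  then show ?thesis by blast
qed

section \<open>The filtered field\<close>

lemma harmonic_solution_diff:
  assumes "harmonic_solution D \<omega> \<psi>1 S1" "harmonic_solution D \<omega> \<psi>2 S2"
    and "\<And>w. w \<in> Vspace D \<Longrightarrow> ip D \<psi> w = ip D \<psi>1 w - ip D \<psi>2 w"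
  shows "harmonic_solution D \<omega> \<psi> (em_diff S1 S2)"
  unfolding harmonic_solution_def
proof (intro conjI ballI)
  have V: "S1 \<in> Vspace D" "S2 \<in> Vspace D"
    using assms(1,2) by (simp_all add: harmonic_solution_def)
  then show "em_diff S1 S2 \<in> Vspace D"
    by (rule Vspace_diff)
  fix w assume w: "w \<in> Vspace D"
  have "ip D \<psi> w = (\<i> * of_real \<omega> * ip D S1 w + aform D S1 w) - (\<i> * of_real \<omega> * ip D S2 w + aform D S2 w)"
    using assms w by (simp add: harmonic_solution_def)
  then show "\<i> * of_real \<omega> * ip D (em_diff S1 S2) w + aform D (em_diff S1 S2) w = ip D \<psi> w"
    unfolding ip_diff_left[OF Vspace_Lspace[OF V(1)] Vspace_Lspace[OF V(2)] Vspace_Lspace[OF w]] aform_diff_left[OF V w]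
    by (simp add: algebra_simps)
qed

text \<open>Well-posedness bounds the energy norm of one representative; uniqueness up to
  \<open>em_eq\<close> extends the bound to every solution.\<close>

lemma harmonic_solution_bound:
  assumes "harmonic_wellposed D \<omega> Cstab" "\<psi> \<in> Lspace D" "harmonic_solution D \<omega> \<psi> S"
  shows "energy_norm D \<omega> S \<le> Cstab * em_norm D \<psi>"
proof -
  obtain S' where S': "harmonic_solution D \<omega> \<psi> S'" "em_eq D S S'" "energy_norm D \<omega> S' \<le> Cstab * em_norm D \<psi>"
    using assms unfolding harmonic_wellposed_def by meson
  have "energy_norm D \<omega> S = energy_norm D \<omega> S'"
    using assms(3) S'(1,2) Vspace_Lspace by (intro em_eq_Vspace(3)) (auto simp: harmonic_solution_def)
  with S'(3) show ?thesis by simp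
qed

text \<open>\<open>F\<close> enters only through its scalar integrals. With S the solution for the
  expected source and F_n the filtered fields of the approximating paths, F_n tends to S by
  stability, and the pairings of F_n tend to those of F by uniform convergence of the paths. Hence F
  and S agree almost everywhere, and membership of F in \<open>Vspace\<close> is a
  conclusion.\<close>

lemma evolution_filter:
  assumes \<omega>: "\<omega> > 0" and wp: "harmonic_wellposed D \<omega> Cstab" and \<phi>: "\<phi> \<in> Lspace D" and U\<^sub>0: "U\<^sub>0 \<in> LspaceR D"
    and ev: "evolution D s \<omega> \<phi> U\<^sub>0 U"
    and F: "F \<in> Lspace D"
      "\<And>v. v \<in> Lspace D \<Longrightarrow> ((\<lambda>t. exp (- \<i> * of_real (\<omega> * t)) * ip D (U t) v) has_integral of_real (period \<omega> / 2) * ip D F v) {0..period \<omega>}"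
  shows "harmonic_solution D \<omega> (filtered_source \<omega> \<phi> U\<^sub>0 (U (period \<omega>))) F"
proof -
  define T where "T = period \<omega>"
  have T: "0 < T"
    using \<omega> by (simp add: T_def period_def)
  have U0L: "U\<^sub>0 \<in> Lspace D"
    by (rule LspaceR_Lspace[OF U\<^sub>0])
  have UL: "U t \<in> Lspace D" if "t \<in> {0..T}" for t
    using ev that LspaceR_Lspace unfolding evolution_def T_def by blast
  obtain u0 u where u: "\<And>n::nat. u0 n \<in> VspaceI D s" "\<And>n. strong_solution D s \<omega> \<phi> (u0 n) (u n)"
    and u0_lim: "(\<lambda>n. em_norm D (em_diff (u0 n) U\<^sub>0)) \<longlonglongrightarrow> 0"
    and u_lim: "\<And>e. e > 0 \<Longrightarrow> \<forall>\<^sub>F n in sequentially. \<forall>t \<in> {0..T}. em_norm D (em_diff (u n t) (U t)) < e"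
    using ev unfolding evolution_def T_def by blast
  have u0L: "u0 n \<in> Lspace D" for n
    using u(1) VspaceI_VspaceR VspaceR_LspaceR LspaceR_Lspace by blast
  have uL: "u n t \<in> Lspace D" if "t \<in> {0..T}" for n t
    using u(2)[of n] that VspaceI_VspaceR VspaceR_LspaceR LspaceR_Lspace unfolding strong_solution_def T_def by blast
  have T_mem: "T \<in> {0..T}"
    using T by simp
  define \<psi> where "\<psi> = filtered_source \<omega> \<phi> U\<^sub>0 (U T)"
  define \<psi>n where "\<psi>n n = filtered_source \<omega> \<phi> (u0 n) (u n T)" for n
  have \<psi>L: "\<psi> \<in> Lspace D" "\<psi>n n \<in> Lspace D" for n
    unfolding \<psi>_def \<psi>n_def by (intro filtered_source_Lspace \<phi> U0L UL u0L uL T_mem)+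
  obtain S where S: "harmonic_solution D \<omega> \<psi> S"
    using wp \<psi>L(1) unfolding harmonic_wellposed_def by meson
  have SL: "S \<in> Lspace D"
    using S Vspace_Lspace by (simp add: harmonic_solution_def)
  \<comment> \<open>Bundling both properties lets one field per index be chosen that works for all
    tests at once.\<close>
  define P where "P n Fn \<longleftrightarrow> harmonic_solution D \<omega> (\<psi>n n) Fn \<and> (\<forall>v\<in>Lspace D.
      ((\<lambda>t. exp (- \<i> * of_real (\<omega> * t)) * ip D (u n t) v) has_integral of_real (T / 2) * ip D Fn v) {0..T})" for n Fn
  have "\<exists>Fn. P n Fn" for n
    unfolding P_def by (rule strong_solution_filter[OF \<omega> \<phi> u0L u(2), of n]) (unfold \<psi>n_def T_def, blast)
  then obtain Fn where "\<And>n. P n (Fn n)"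
    by metis
  then have Fn: "\<And>n. harmonic_solution D \<omega> (\<psi>n n) (Fn n)"
    "\<And>n v. v \<in> Lspace D \<Longrightarrow> ((\<lambda>t. exp (- \<i> * of_real (\<omega> * t)) * ip D (u n t) v) has_integral of_real (T / 2) * ip D (Fn n) v) {0..T}"
    unfolding P_def by (simp_all del: of_real_divide)
  have FnV: "Fn n \<in> Vspace D" for n
    using Fn(1)[of n] by (simp add: harmonic_solution_def)
  obtain c where c: "c > 0" "\<And>U. U \<in> Lspace D \<Longrightarrow> c * em_sq U \<le> (em_norm D U)\<^sup>2"
    using em_norm_ge by blast
  have sq_lim: "(\<lambda>n. em_sq (X n)) \<longlonglongrightarrow> 0" if XL: "\<And>n. X n \<in> Lspace D" and "(\<lambda>n. em_norm D (X n)) \<longlonglongrightarrow> 0" for X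
  proof (rule Lim_null_comparison)
    show "\<forall>\<^sub>F n in sequentially. norm (em_sq (X n)) \<le> (em_norm D (X n))\<^sup>2 / c"
      using c(2)[OF XL] c(1) by (intro always_eventually allI) (simp add: field_simps)
    have "(\<lambda>n. (em_norm D (X n))\<^sup>2 / c) \<longlonglongrightarrow> 0\<^sup>2 / c"
      using c(1) by (intro tendsto_intros that(2)) simp
    then show "(\<lambda>n. (em_norm D (X n))\<^sup>2 / c) \<longlonglongrightarrow> 0"
      by simp
  qed
  have uT_lim: "(\<lambda>n. em_norm D (em_diff (u n T) (U T))) \<longlonglongrightarrow> 0"
  proof (rule tendstoI)
    fix e :: real assume "e > 0"
    from u_lim[OF this] show "\<forall>\<^sub>F n in sequentially. dist (em_norm D (em_diff (u n T) (U T))) 0 < e"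
      by eventually_elim (use T_mem em_norm_nonneg[OF Lspace_diff[OF uL[OF T_mem] UL[OF T_mem]]] in \<open>auto simp: dist_real_def\<close>)
  qed
  \<comment> \<open>Up to the factor \<omega>/\<pi> this is the n-th source minus the expected one,
    since \<phi> cancels.\<close>
  define R where "R n = em_diff (em_diff (u0 n) (u n T)) (em_diff U\<^sub>0 (U T))" for n
  have RL: "R n \<in> Lspace D" for n
    unfolding R_def by (intro Lspace_diff u0L uL UL U0L T_mem)
  have R_lim: "(\<lambda>n. em_norm D (R n)) \<longlonglongrightarrow> 0"
  proof (rule em_norm_tendsto_0[OF RL])
    show "(\<lambda>n. em_sq (R n)) \<longlonglongrightarrow> 0"
    proof (rule Lim_null_comparison)
      have "R n = em_diff (em_diff (u0 n) U\<^sub>0) (em_diff (u n T) (U T))" for n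
        by (simp add: R_def em_diff_def algebra_simps)
      then have "em_sq (R n) \<le> 2 * em_sq (em_diff (u0 n) U\<^sub>0) + 2 * em_sq (em_diff (u n T) (U T))" for n
        using L2_diff(2)[of "fst (em_diff (u0 n) U\<^sub>0)" "vol D" "fst (em_diff (u n T) (U T))"]
          L2_diff(2)[of "snd (em_diff (u0 n) U\<^sub>0)" "vol D" "snd (em_diff (u n T) (U T))"]
          Lspace_diff[OF u0L[of n] U0L] Lspace_diff[OF uL[OF T_mem, of n] UL[OF T_mem]]
        unfolding Lspace_iff em_sq_def by simp
      then show "\<forall>\<^sub>F n in sequentially. norm (em_sq (R n)) \<le> 2 * em_sq (em_diff (u0 n) U\<^sub>0) + 2 * em_sq (em_diff (u n T) (U T))"
        by simp
      have "(\<lambda>n. 2 * em_sq (em_diff (u0 n) U\<^sub>0) + 2 * em_sq (em_diff (u n T) (U T))) \<longlonglongrightarrow> 2 * 0 + 2 * 0"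
        by (intro tendsto_intros sq_lim Lspace_diff u0L U0L uL UL T_mem u0_lim uT_lim)
      then show "(\<lambda>n. 2 * em_sq (em_diff (u0 n) U\<^sub>0) + 2 * em_sq (em_diff (u n T) (U T))) \<longlonglongrightarrow> 0"
        by simp
    qed
  qed
  have energy: "energy_norm D \<omega> (em_diff (Fn n) S) \<le> Cstab * (\<omega> / pi * em_norm D (R n))" for n
  proof -
    have "harmonic_solution D \<omega> (em_scale (of_real (\<omega> / pi)) (R n)) (em_diff (Fn n) S)"
    proof (rule harmonic_solution_diff[OF Fn(1) S])
      fix w assume "w \<in> Vspace D"
      then have w: "w \<in> Lspace D" by (rule Vspace_Lspace)
      show "ip D (em_scale (of_real (\<omega> / pi)) (R n)) w = ip D (\<psi>n n) w - ip D \<psi> w"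
        unfolding \<psi>_def \<psi>n_def R_def ip_filtered_source[OF \<phi> U0L UL[OF T_mem] w] ip_filtered_source[OF \<phi> u0L uL[OF T_mem] w]
          ip_scale_left ip_diff_left[OF Lspace_diff[OF u0L uL[OF T_mem]] Lspace_diff[OF U0L UL[OF T_mem]] w]
        by (simp add: algebra_simps)
    qed
    from harmonic_solution_bound[OF wp Lspace_scale[OF RL] this] show ?thesis
      using \<omega> by (simp add: em_norm_scale norm_divide)
  qed
  obtain k where k: "k > 0" "\<And>U. U \<in> Vspace D \<Longrightarrow> k * graph_sq U \<le> (energy_norm D \<omega> U)\<^sup>2"
    and nn: "\<And>U. U \<in> Vspace D \<Longrightarrow> 0 \<le> energy_norm D \<omega> U"
    using energy_norm_ge[OF \<omega>] by blast
  have FS: "em_diff (Fn n) S \<in> Vspace D" for n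
    using FnV[of n] S by (simp add: Vspace_diff harmonic_solution_def)
  have FS_lim: "(\<lambda>n. em_norm D (em_diff (Fn n) S)) \<longlonglongrightarrow> 0"
  proof (rule em_norm_tendsto_0[OF Vspace_Lspace[OF FS]], rule Lim_null_comparison)
    have "em_sq (em_diff (Fn n) S) \<le> (Cstab * (\<omega> / pi * em_norm D (R n)))\<^sup>2 / k" for n
    proof -
      have "k * em_sq (em_diff (Fn n) S) \<le> k * graph_sq (em_diff (Fn n) S)"
        using k(1) by (simp add: graph_sq_def)
      also have "\<dots> \<le> (energy_norm D \<omega> (em_diff (Fn n) S))\<^sup>2"
        by (rule k(2)[OF FS])
      also have "\<dots> \<le> (Cstab * (\<omega> / pi * em_norm D (R n)))\<^sup>2"
        by (intro power_mono energy nn FS)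
      finally show ?thesis
        using k(1) by (simp add: pos_le_divide_eq mult.commute)
    qed
    then show "\<forall>\<^sub>F n in sequentially. norm (em_sq (em_diff (Fn n) S)) \<le> (Cstab * (\<omega> / pi * em_norm D (R n)))\<^sup>2 / k"
      by simp
    have "(\<lambda>n. (Cstab * (\<omega> / pi * em_norm D (R n)))\<^sup>2 / k) \<longlonglongrightarrow> (Cstab * (\<omega> / pi * 0))\<^sup>2 / k"
      using k(1) by (intro tendsto_divide tendsto_power tendsto_mult tendsto_const R_lim) simp
    then show "(\<lambda>n. (Cstab * (\<omega> / pi * em_norm D (R n)))\<^sup>2 / k) \<longlonglongrightarrow> 0"
      by simp
  qed
  have "em_eq D F S"
  proof (rule em_eq_of_ip[OF F(1) SL])
    fix v assume v: "v \<in> Lspace D"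
    obtain K where K: "K \<ge> 0" "\<And>U. U \<in> Lspace D \<Longrightarrow> cmod (ip D U v) \<le> K * em_norm D U"
      using ip_bound[OF v] by blast
    have lim1: "(\<lambda>n. ip D (Fn n) v) \<longlonglongrightarrow> ip D S v"
    proof (rule LIM_zero_cancel, rule Lim_null_comparison)
      have "ip D (Fn n) v - ip D S v = ip D (em_diff (Fn n) S) v" for n
        by (simp add: ip_diff_left[OF Vspace_Lspace[OF FnV] SL v])
      then show "\<forall>\<^sub>F n in sequentially. norm (ip D (Fn n) v - ip D S v) \<le> K * em_norm D (em_diff (Fn n) S)"
        using K(2)[OF Vspace_Lspace[OF FS]] by simp
      have "(\<lambda>n. K * em_norm D (em_diff (Fn n) S)) \<longlonglongrightarrow> K * 0"
        by (intro tendsto_intros FS_lim)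
      then show "(\<lambda>n. K * em_norm D (em_diff (Fn n) S)) \<longlonglongrightarrow> 0"
        by simp
    qed
    have "(\<lambda>n. of_real (T / 2) * ip D (Fn n) v) \<longlonglongrightarrow> of_real (T / 2) * ip D F v"
    proof (rule tendstoI)
      fix e :: real assume "e > 0"
      \<comment> \<open>The integrands differ by at most K d and the integrals by at most K d T; the
        added units keep the denominators positive and make this strictly less than e.\<close>
      define d where "d = e / (K + 1) / (T + 1)"
      have d: "d > 0"
        using \<open>e > 0\<close> K(1) T by (simp add: d_def)
      have Kd: "K * d * T < e"
      proof -
        have "K * d * T \<le> (K + 1) * d * T"
          using d T by (intro mult_right_mono) auto
        also have "\<dots> < (K + 1) * d * (T + 1)"
          using d K(1) by (intro mult_strict_left_mono) auto
        also have "\<dots> = e"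
          using K(1) T by (simp add: d_def)
        finally show ?thesis .
      qed
      from u_lim[OF d] show "\<forall>\<^sub>F n in sequentially. dist (of_real (T / 2) * ip D (Fn n) v) (of_real (T / 2) * ip D F v) < e"
      proof eventually_elim
        case (elim n)
        have "((\<lambda>t. exp (- \<i> * of_real (\<omega> * t)) * ip D (u n t) v - exp (- \<i> * of_real (\<omega> * t)) * ip D (U t) v)
            has_integral of_real (T / 2) * ip D (Fn n) v - of_real (T / 2) * ip D F v) {0..T}"
          using Fn(2)[OF v] F(2)[OF v] unfolding T_def[symmetric] by (rule has_integral_diff)
        then have "norm (of_real (T / 2) * ip D (Fn n) v - of_real (T / 2) * ip D F v) \<le> (K * d) * measure lborel {0..T}"
        proof (rule has_integral_bound_real[rotated 2])
          show "0 \<le> K * d"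
            using K(1) d by simp
          fix t assume t: "t \<in> {0..T} - {}"
          then have t': "t \<in> {0..T}" by simp
          have "norm (exp (- \<i> * of_real (\<omega> * t)) * ip D (u n t) v - exp (- \<i> * of_real (\<omega> * t)) * ip D (U t) v)
              = norm (exp (- \<i> * of_real (\<omega> * t)) * ip D (em_diff (u n t) (U t)) v)"
            by (simp add: ip_diff_left[OF uL[OF t'] UL[OF t'] v] right_diff_distrib)
          also have "\<dots> = norm (ip D (em_diff (u n t) (U t)) v)"
            by (simp add: norm_mult)
          also have "\<dots> \<le> K * em_norm D (em_diff (u n t) (U t))"
            by (rule K(2)[OF Lspace_diff[OF uL[OF t'] UL[OF t']]])
          also have "\<dots> \<le> K * d"
            using elim t' K(1) by (intro mult_left_mono) (auto intro: less_imp_le)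
          finally show "norm (exp (- \<i> * of_real (\<omega> * t)) * ip D (u n t) v - exp (- \<i> * of_real (\<omega> * t)) * ip D (U t) v) \<le> K * d" .
        qed simp_all
        then show ?case
          using Kd T by (simp add: dist_norm)
      qed
    qed
    moreover have "(\<lambda>n. of_real (T / 2) * ip D (Fn n) v) \<longlonglongrightarrow> of_real (T / 2) * ip D S v"
      by (intro tendsto_mult tendsto_const lim1)
    ultimately have "complex_of_real (T / 2) * ip D F v = of_real (T / 2) * ip D S v"
      by (rule LIMSEQ_unique)
    then show "ip D F v = ip D S v"
      using T by simp
  qed
  moreover have "S \<in> Vspace D"
    using S by (simp add: harmonic_solution_def)
  ultimately have eqv: "F \<in> Vspace D" "\<And>v. v \<in> Vspace D \<Longrightarrow> aform D F v = aform D S v"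
    "\<And>v. v \<in> Vspace D \<Longrightarrow> ip D F v = ip D S v"
    using em_eq_Vspace(1,2)[OF F(1)] ip_cong[OF F(1) SL] Vspace_Lspace by blast+
  then show ?thesis
    using S unfolding harmonic_solution_def \<psi>_def T_def by simp
qed

text \<open>\<open>solution_map\<close> and \<open>em_integral\<close> are choices. Existence of an
  extended path, and of the integral of its product with the phase, makes both satisfy their
  defining properties, and \<open>has_em_integral_ip\<close> supplies the weak description on which
  \<open>evolution_filter\<close> rests.\<close>

lemma time_filter_harmonic:
  assumes \<omega>: "\<omega> > 0" and ewp: "evolution_wellposed D s \<omega>" and wp: "harmonic_wellposed D \<omega> Cstab"
    and \<phi>: "\<phi> \<in> Lspace D" and U\<^sub>0: "U\<^sub>0 \<in> LspaceR D"
  shows "propagator D s \<omega> \<phi> U\<^sub>0 \<in> Lspace D"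
    and "harmonic_solution D \<omega> (filtered_source \<omega> \<phi> U\<^sub>0 (propagator D s \<omega> \<phi> U\<^sub>0)) (time_filter D s \<omega> \<phi> U\<^sub>0)"
proof -
  define T where "T = period \<omega>"
  have T: "0 < T" "complex_of_real (T / 2) * of_real (2 / T) = 1"
    using \<omega> by (auto simp: T_def period_def simp flip: of_real_mult)
  define U where "U = solution_map D s \<omega> \<phi> U\<^sub>0"
  have ev: "evolution D s \<omega> \<phi> U\<^sub>0 U"
    unfolding U_def solution_map_def by (rule someI_ex[OF evolution_exists[OF \<omega> ewp \<phi> U\<^sub>0]])
  have UL: "U t \<in> Lspace D" if "t \<in> {0..T}" for t
    using ev that LspaceR_Lspace unfolding evolution_def T_def by blast
  then show "propagator D s \<omega> \<phi> U\<^sub>0 \<in> Lspace D"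
    using T(1) by (simp add: propagator_def U_def T_def)
  define f where "f t = em_scale (exp (- \<i> * of_real (\<omega> * t))) (U t)" for t
  have pc: "path_continuous (em_norm D) {0..T} U"
    using ev by (simp add: evolution_def T_def)
  have cont: "l2_continuous (vol D) {0..T} (\<lambda>t. fst (f t))" "l2_continuous (vol D) {0..T} (\<lambda>t. snd (f t))"
    unfolding f_def em_simps
    by (intro l2_continuous_scale continuous_intros path_continuous_em_norm[OF pc UL]; assumption)+
  define G where "G = em_integral D {0..T} f"
  have G: "has_em_integral D f G {0..T}"
    unfolding G_def em_integral_def by (rule someI_ex[OF has_em_integral_exists[OF less_imp_le[OF T(1)] cont]])
  have GL: "G \<in> Lspace D"
    using G by (simp add: has_em_integral_def)
  have TF: "time_filter D s \<omega> \<phi> U\<^sub>0 = em_scale (of_real (2 / T)) G"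
    by (simp add: time_filter_def G_def f_def[abs_def] U_def T_def)
  have "harmonic_solution D \<omega> (filtered_source \<omega> \<phi> U\<^sub>0 (U (period \<omega>))) (em_scale (of_real (2 / T)) G)"
  proof (rule evolution_filter[OF \<omega> wp \<phi> U\<^sub>0 ev Lspace_scale[OF GL]])
    fix v assume v: "v \<in> Lspace D"
    have "((\<lambda>t. ip D (f t) v) has_integral ip D G v) {0..T}"
      using UL by (intro has_em_integral_ip[OF G _ v]) (simp add: f_def Lspace_scale)
    moreover have "complex_of_real (T / 2) * ip D (em_scale (of_real (2 / T)) G) v = ip D G v"
      unfolding ip_scale_left mult.assoc[symmetric] T(2) by simp
    ultimately show "((\<lambda>t. exp (- \<i> * of_real (\<omega> * t)) * ip D (U t) v) has_integral
        of_real (period \<omega> / 2) * ip D (em_scale (of_real (2 / T)) G) v) {0..period \<omega>}"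
      by (simp only: f_def ip_scale_left T_def[symmetric])
  qed
  then show "harmonic_solution D \<omega> (filtered_source \<omega> \<phi> U\<^sub>0 (propagator D s \<omega> \<phi> U\<^sub>0)) (time_filter D s \<omega> \<phi> U\<^sub>0)"
    unfolding TF by (simp add: propagator_def U_def)
qed

end

theorem theorem4p6:
  fixes D :: maxwell and s \<omega> Cstab :: real
  assumes "maxwell_setting D"
    and "s = 1 \<or> s = -1"
    and "\<omega> > 0"
    and "evolution_wellposed D s \<omega>"
    and "harmonic_wellposed D \<omega> Cstab"
  shows "(\<forall>\<phi> \<in> Lspace D. \<forall>U\<^sub>0 \<in> LspaceR D.
            time_filter D s \<omega> \<phi> U\<^sub>0 \<in> Vspace D \<and>
            (\<forall>v \<in> Vspace D.
               \<i> * of_real \<omega> * ip D (time_filter D s \<omega> \<phi> U\<^sub>0) v + aform D (time_filter D s \<omega> \<phi> U\<^sub>0) v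
               = ip D \<phi> v + of_real (\<omega> / pi) * ip D (em_diff U\<^sub>0 (propagator D s \<omega> \<phi> U\<^sub>0)) v) \<and>
            (\<forall>G \<in> Vspace D.
               (\<forall>v \<in> Vspace D.
                  \<i> * of_real \<omega> * ip D G v + aform D G v
                  = ip D \<phi> v + of_real (\<omega> / pi) * ip D (em_diff U\<^sub>0 (propagator D s \<omega> \<phi> U\<^sub>0)) v)
               \<longrightarrow> em_eq D G (time_filter D s \<omega> \<phi> U\<^sub>0)))
       \<and> (\<forall>\<psi> \<in> Lspace D. \<forall>U. harmonic_solution D \<omega> \<psi> U \<longrightarrow>
            (\<forall>U\<^sub>0 \<in> VspaceR D.
               energy_norm D \<omega> (em_diff U (time_filter D s \<omega> \<psi> U\<^sub>0))
               \<le> \<omega> / pi * Cstab * em_norm D (em_diff U\<^sub>0 (propagator D s \<omega> \<psi> U\<^sub>0))))"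
proof -
  interpret maxwell_data D
    by unfold_locales fact
  note filter = time_filter_harmonic[OF assms(3-5)]
  have source: "ip D (filtered_source \<omega> \<phi> U\<^sub>0 (propagator D s \<omega> \<phi> U\<^sub>0)) v
      = ip D \<phi> v + of_real (\<omega> / pi) * ip D (em_diff U\<^sub>0 (propagator D s \<omega> \<phi> U\<^sub>0)) v"
    if "\<phi> \<in> Lspace D" "U\<^sub>0 \<in> LspaceR D" "v \<in> Vspace D" for \<phi> U\<^sub>0 v
    by (rule ip_filtered_source[OF that(1) LspaceR_Lspace[OF that(2)] filter(1)[OF that(1,2)] Vspace_Lspace[OF that(3)]])
  show ?thesis
  proof (intro conjI ballI allI impI)
    fix \<phi> U\<^sub>0 assume \<phi>: "\<phi> \<in> Lspace D" and U\<^sub>0: "U\<^sub>0 \<in> LspaceR D"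
    note F = filter(2)[OF \<phi> U\<^sub>0]
    show "time_filter D s \<omega> \<phi> U\<^sub>0 \<in> Vspace D"
      using F by (simp add: harmonic_solution_def)
    show "\<i> * of_real \<omega> * ip D (time_filter D s \<omega> \<phi> U\<^sub>0) v + aform D (time_filter D s \<omega> \<phi> U\<^sub>0) v
        = ip D \<phi> v + of_real (\<omega> / pi) * ip D (em_diff U\<^sub>0 (propagator D s \<omega> \<phi> U\<^sub>0)) v" if v: "v \<in> Vspace D" for v
      using F v source[OF \<phi> U\<^sub>0 v] by (simp add: harmonic_solution_def)
    fix G assume G: "G \<in> Vspace D" "\<forall>v \<in> Vspace D. \<i> * of_real \<omega> * ip D G v + aform D G v
        = ip D \<phi> v + of_real (\<omega> / pi) * ip D (em_diff U\<^sub>0 (propagator D s \<omega> \<phi> U\<^sub>0)) v"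
    then have "harmonic_solution D \<omega> (filtered_source \<omega> \<phi> U\<^sub>0 (propagator D s \<omega> \<phi> U\<^sub>0)) G"
      using source[OF \<phi> U\<^sub>0] by (simp add: harmonic_solution_def)
    moreover have "filtered_source \<omega> \<phi> U\<^sub>0 (propagator D s \<omega> \<phi> U\<^sub>0) \<in> Lspace D"
      by (rule filtered_source_Lspace[OF \<phi> LspaceR_Lspace[OF U\<^sub>0] filter(1)[OF \<phi> U\<^sub>0]])
    \<comment> \<open>\<open>S\<close> is the reference solution provided by well-posedness; both
      candidates agree with it almost everywhere.\<close>
    ultimately obtain S where "em_eq D G S" "em_eq D (time_filter D s \<omega> \<phi> U\<^sub>0) S"
      using assms(5) F unfolding harmonic_wellposed_def by meson
    then show "em_eq D G (time_filter D s \<omega> \<phi> U\<^sub>0)"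
      unfolding em_eq_def by eventually_elim simp
  next
    fix \<psi> U U\<^sub>0
    assume \<psi>: "\<psi> \<in> Lspace D" and U: "harmonic_solution D \<omega> \<psi> U" and U\<^sub>0: "U\<^sub>0 \<in> VspaceR D"
    note R = VspaceR_LspaceR[OF U\<^sub>0]
    define X where "X = em_diff U\<^sub>0 (propagator D s \<omega> \<psi> U\<^sub>0)"
    have X: "X \<in> Lspace D"
      unfolding X_def by (rule Lspace_diff[OF LspaceR_Lspace[OF R] filter(1)[OF \<psi> R]])
    \<comment> \<open>Subtracting the two problems cancels \<psi> and leaves -\<omega>/\<pi> times
      \<open>X\<close> as source, whose norm is \<omega>/\<pi> times that of
      \<open>X\<close>.\<close>
    have "harmonic_solution D \<omega> (em_scale (of_real (- \<omega> / pi)) X) (em_diff U (time_filter D s \<omega> \<psi> U\<^sub>0))"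
    proof (rule harmonic_solution_diff[OF U filter(2)[OF \<psi> R]])
      fix w assume "w \<in> Vspace D"
      then show "ip D (em_scale (of_real (- \<omega> / pi)) X) w
          = ip D \<psi> w - ip D (filtered_source \<omega> \<psi> U\<^sub>0 (propagator D s \<omega> \<psi> U\<^sub>0)) w"
        by (simp add: source[OF \<psi> R] ip_scale_left X_def)
    qed
    from harmonic_solution_bound[OF assms(5) Lspace_scale[OF X] this]
    have "energy_norm D \<omega> (em_diff U (time_filter D s \<omega> \<psi> U\<^sub>0)) \<le> Cstab * (\<omega> / pi * em_norm D X)"
      using assms(3) by (simp add: em_norm_scale norm_divide)
    then show "energy_norm D \<omega> (em_diff U (time_filter D s \<omega> \<psi> U\<^sub>0))
        \<le> \<omega> / pi * Cstab * em_norm D (em_diff U\<^sub>0 (propagator D s \<omega> \<psi> U\<^sub>0))"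
      by (simp add: X_def mult_ac)
  qed
qed

end
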